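(* Let $d\in\mathbb{N}$ and $2<p<\infty$, and let $\Omega\subseteq\mathbb{R}^d$ be either $\mathbb{R}^d$ itself, a bounded Lipschitz domain, or an interval (if $d=1$). Let $0<\epsilon<\min\{1/(p-1),\,1-1/(p-1)\}$. Then for all $1<\mu\leq\infty$ there exists a compactly supported right-hand side $f=f_\mu$ with $$f\in L_\nu(\Omega)\cap W^{-1}_{p'}(\Omega)\quad\text{for all}\quad\begin{cases}0<\nu<\mu & \text{if } \mu<\infty,\\ 0<\nu\leq\infty & \text{if } \mu=\infty,\end{cases}$$ such that the corresponding weak solution $u\in W^1_{p,0}(\Omega)$ of $-\Delta_p(u)=f$ is compactly supported as well and satisfies $$u\in\begin{cases} B^{1+\frac{1}{p-1}-\epsilon}_{\rho,q}(\Omega)\setminus B^{1+\frac{1}{p-1}}_{\rho,q}(\Omega) & \text{if } \mu(p-1)<\rho\leq\infty \text{ and } 0<q\leq\infty,\\ B^{1+\frac{1}{p-1}}_{\rho,\infty}(\Omega)\setminus B^{1+\frac{1}{p-1}}_{\rho,q}(\Omega) & \text{if } \rho=\mu(p-1) \text{ and } 0<q<\infty,\\ B^{1+\frac{1}{p-1}}_{\rho,q}(\Omega)\setminus B^{1+\frac{1}{p-1}+\epsilon}_{\rho,q}(\Omega) & \text{if } 1\leq\rho<\mu(p-1) \text{ and } 0<q\leq\infty.\end{cases}$$ Moreover, for $1<\rho<\infty$ there holds $A(\nabla u)\in(W^1_\rho(\Omega))^d$ if and only if $\rho<\mu$.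
   Context: For $1<p<\infty$, $1/p+1/p'=1$. The $p$-Laplacian is $\Delta_p(u)=\mathrm{div}(A(\nabla u))$ with $A(\nabla u):=|\nabla u|^{p-2}\nabla u$ ($|\cdot|$ the Euclidean norm). $W^1_{p,0}(\Omega)$ is the closure of $C_0^\infty(\Omega)$ in the first-order $L_p$-Sobolev norm, and $W^{-1}_{p'}(\Omega):=(W^1_{p,0}(\Omega))'$. For $f\in W^{-1}_{p'}(\Omega)$, $u\in W^1_{p,0}(\Omega)$ is a weak solution of $-\Delta_p(u)=f$ if $\int_\Omega\langle A(\nabla u)(x),\nabla\psi(x)\rangle_{\mathbb{R}^d}\,dx=f(\psi)$ for all $\psi\in C_0^\infty(\Omega)$. $B^s_{\rho,q}(\mathbb{R}^d)$ are the standard Besov spaces and $B^s_{\rho,q}(\Omega)$ denotes the space of restrictions to $\Omega$ of elements of $B^s_{\rho,q}(\mathbb{R}^d)$; $W^1_\rho(\Omega)$ is the usual first-order Sobolev space. A vector field belongs to $(X)^d$ if each component belongs to $X$. *)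

theory Defs
  imports "HOL-Analysis.Analysis"
begin

text \<open>Real power of an extended nonnegative real (used with positive exponents).\<close>
definition enn_rpow :: "ennreal \<Rightarrow> real \<Rightarrow> ennreal" where
  "enn_rpow x a = (if x = top then top else ennreal (enn2real x powr a))"

definition lp_nrm :: "ereal \<Rightarrow> 'a::euclidean_space set \<Rightarrow> ('a \<Rightarrow> real) \<Rightarrow> ennreal" where
  "lp_nrm \<rho> S f =
     (if \<rho> = \<infinity> then Inf {C. AE x in lebesgue_on S. ennreal \<bar>f x\<bar> \<le> C}
      else enn_rpow (\<integral>\<^sup>+ x. ennreal (\<bar>f x\<bar> powr real_of_ereal \<rho>) \<partial>lebesgue_on S)
                    (1 / real_of_ereal \<rho>))"

definition lp_mem :: "ereal \<Rightarrow> 'a::euclidean_space set \<Rightarrow> ('a \<Rightarrow> real) \<Rightarrow> bool" where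
  "lp_mem \<rho> S f \<longleftrightarrow> f \<in> borel_measurable (lebesgue_on S) \<and> lp_nrm \<rho> S f < \<infinity>"

definition fdiff :: "nat \<Rightarrow> 'a::euclidean_space \<Rightarrow> ('a \<Rightarrow> real) \<Rightarrow> 'a \<Rightarrow> real" where
  "fdiff r h f x = (\<Sum>k\<le>r. (-1) ^ (r - k) * real (r choose k) * f (x + real k *\<^sub>R h))"

definition modsmooth :: "nat \<Rightarrow> ereal \<Rightarrow> ('a::euclidean_space \<Rightarrow> real) \<Rightarrow> real \<Rightarrow> ennreal" where
  "modsmooth r \<rho> f t = (SUP h \<in> cball 0 t. lp_nrm \<rho> UNIV (fdiff r h f))"

text \<open>B^s_{rho,q}(R^d), s > 0, 0 < rho, q <= infinity, with r = floor s + 1 > s.\<close>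
definition besov :: "real \<Rightarrow> ereal \<Rightarrow> ereal \<Rightarrow> ('a::euclidean_space \<Rightarrow> real) \<Rightarrow> bool" where
  "besov s \<rho> q f \<longleftrightarrow>
     lp_mem \<rho> UNIV f \<and>
     (let r = nat \<lfloor>s\<rfloor> + 1 in
      if q = \<infinity> then (SUP t \<in> {0<..}. ennreal (t powr (- s)) * modsmooth r \<rho> f t) < \<infinity>
      else (\<integral>\<^sup>+ t. indicator {0<..} t *
               enn_rpow (ennreal (t powr (- s)) * modsmooth r \<rho> f t) (real_of_ereal q)
               / ennreal t \<partial>lborel) < \<infinity>)"

definition besov_on :: "'a::euclidean_space set \<Rightarrow> real \<Rightarrow> ereal \<Rightarrow> ereal \<Rightarrow> ('a \<Rightarrow> real) \<Rightarrow> bool" where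
  "besov_on \<Omega> s \<rho> q u \<longleftrightarrow> (\<exists>g. besov s \<rho> q g \<and> (AE x in lebesgue. x \<in> \<Omega> \<longrightarrow> g x = u x))"

fun dderivs :: "'a::euclidean_space list \<Rightarrow> ('a \<Rightarrow> real) \<Rightarrow> 'a \<Rightarrow> real" where
  "dderivs [] f = f"
| "dderivs (v # vs) f = (\<lambda>x. frechet_derivative (dderivs vs f) (at x) v)"

definition smooth_fn :: "('a::euclidean_space \<Rightarrow> real) \<Rightarrow> bool" where
  "smooth_fn f \<longleftrightarrow> (\<forall>vs x. dderivs vs f differentiable (at x))"

definition test_fn :: "'a::euclidean_space set \<Rightarrow> ('a \<Rightarrow> real) \<Rightarrow> bool" where
  "test_fn \<Omega> \<phi> \<longleftrightarrow> smooth_fn \<phi> \<and>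
     (\<exists>K. compact K \<and> K \<subseteq> \<Omega> \<and> (\<forall>x. x \<notin> K \<longrightarrow> \<phi> x = 0))"

definition pd :: "('a::euclidean_space \<Rightarrow> real) \<Rightarrow> 'a \<Rightarrow> 'a \<Rightarrow> real" where
  "pd \<phi> i x = frechet_derivative \<phi> (at x) i"

definition loc_int :: "'a::euclidean_space set \<Rightarrow> ('a \<Rightarrow> real) \<Rightarrow> bool" where
  "loc_int \<Omega> f \<longleftrightarrow> (\<forall>K. compact K \<and> K \<subseteq> \<Omega> \<longrightarrow> set_integrable lebesgue K f)"

definition weak_deriv :: "'a::euclidean_space set \<Rightarrow> 'a \<Rightarrow> ('a \<Rightarrow> real) \<Rightarrow> ('a \<Rightarrow> real) \<Rightarrow> bool" where
  "weak_deriv \<Omega> i u g \<longleftrightarrow> loc_int \<Omega> u \<and> loc_int \<Omega> g \<and>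
     (\<forall>\<phi>. test_fn \<Omega> \<phi> \<longrightarrow>
        (\<integral>x\<in>\<Omega>. u x * pd \<phi> i x \<partial>lebesgue) = - (\<integral>x\<in>\<Omega>. g x * \<phi> x \<partial>lebesgue))"

definition weak_gradient :: "'a::euclidean_space set \<Rightarrow> ('a \<Rightarrow> real) \<Rightarrow> ('a \<Rightarrow> 'a) \<Rightarrow> bool" where
  "weak_gradient \<Omega> u G \<longleftrightarrow> (\<forall>i\<in>Basis. weak_deriv \<Omega> i u (\<lambda>x. G x \<bullet> i))"

definition sobolev1 :: "ereal \<Rightarrow> 'a::euclidean_space set \<Rightarrow> ('a \<Rightarrow> real) \<Rightarrow> bool" where
  "sobolev1 \<rho> \<Omega> u \<longleftrightarrow> lp_mem \<rho> \<Omega> u \<and>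
     (\<exists>G. weak_gradient \<Omega> u G \<and> (\<forall>i\<in>Basis. lp_mem \<rho> \<Omega> (\<lambda>x. G x \<bullet> i)))"

definition sobolev1_0 :: "ereal \<Rightarrow> 'a::euclidean_space set \<Rightarrow> ('a \<Rightarrow> real) \<Rightarrow> bool" where
  "sobolev1_0 p \<Omega> u \<longleftrightarrow> lp_mem p \<Omega> u \<and>
     (\<exists>G. weak_gradient \<Omega> u G \<and> (\<forall>i\<in>Basis. lp_mem p \<Omega> (\<lambda>x. G x \<bullet> i)) \<and>
       (\<exists>\<phi>s. (\<forall>n. test_fn \<Omega> (\<phi>s n)) \<and>
          (\<lambda>n. lp_nrm p \<Omega> (\<lambda>x. u x - \<phi>s n x)) \<longlonglongrightarrow> 0 \<and>
          (\<forall>i\<in>Basis. (\<lambda>n. lp_nrm p \<Omega> (\<lambda>x. G x \<bullet> i - pd (\<phi>s n) i x)) \<longlonglongrightarrow> 0)))"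

definition w1_norm :: "ereal \<Rightarrow> 'a::euclidean_space set \<Rightarrow> ('a \<Rightarrow> real) \<Rightarrow> real" where
  "w1_norm p \<Omega> \<phi> = enn2real (lp_nrm p \<Omega> \<phi>) + (\<Sum>i\<in>Basis. enn2real (lp_nrm p \<Omega> (pd \<phi> i)))"

text \<open>A function f defines an element of W^{-1}_{p'}(Omega) via psi |-> int f psi:
  the functional is bounded on C_0^infinity(Omega) w.r.t. the W^1_p norm.\<close>
definition dual_sobolev :: "ereal \<Rightarrow> 'a::euclidean_space set \<Rightarrow> ('a \<Rightarrow> real) \<Rightarrow> bool" where
  "dual_sobolev p \<Omega> f \<longleftrightarrow> loc_int \<Omega> f \<and>
     (\<exists>C. \<forall>\<phi>. test_fn \<Omega> \<phi> \<longrightarrow> \<bar>\<integral>x\<in>\<Omega>. f x * \<phi> x \<partial>lebesgue\<bar> \<le> C * w1_norm p \<Omega> \<phi>)"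

definition pA :: "real \<Rightarrow> 'a::euclidean_space \<Rightarrow> 'a" where
  "pA p \<xi> = (norm \<xi> powr (p - 2)) *\<^sub>R \<xi>"

definition weak_sol_plap :: "real \<Rightarrow> 'a::euclidean_space set \<Rightarrow> ('a \<Rightarrow> real) \<Rightarrow> ('a \<Rightarrow> 'a) \<Rightarrow> ('a \<Rightarrow> real) \<Rightarrow> bool" where
  "weak_sol_plap p \<Omega> u G f \<longleftrightarrow> sobolev1_0 (ereal p) \<Omega> u \<and> weak_gradient \<Omega> u G \<and>
     (\<forall>\<psi>. test_fn \<Omega> \<psi> \<longrightarrow>
        (\<integral>x\<in>\<Omega>. (\<Sum>i\<in>Basis. (pA p (G x) \<bullet> i) * pd \<psi> i x) \<partial>lebesgue)
          = (\<integral>x\<in>\<Omega>. f x * \<psi> x \<partial>lebesgue))"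

definition compact_supp_in :: "'a::euclidean_space set \<Rightarrow> ('a \<Rightarrow> real) \<Rightarrow> bool" where
  "compact_supp_in \<Omega> f \<longleftrightarrow> (\<exists>K. compact K \<and> K \<subseteq> \<Omega> \<and> (\<forall>x\<in>\<Omega> - K. f x = 0))"

text \<open>Bounded Lipschitz domain: bounded, open, connected, nonempty, and near every
  boundary point the set is (in rotated coordinates) the subgraph of a Lipschitz function.\<close>
definition bounded_lipschitz_domain :: "'a::euclidean_space set \<Rightarrow> bool" where
  "bounded_lipschitz_domain \<Omega> \<longleftrightarrow> open \<Omega> \<and> connected \<Omega> \<and> bounded \<Omega> \<and> \<Omega> \<noteq> {} \<and>
     (\<forall>x\<in>frontier \<Omega>. \<exists>r>0. \<exists>n. norm n = 1 \<and> (\<exists>g::'a \<Rightarrow> real. \<exists>L.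
        (\<forall>v w. v \<bullet> n = 0 \<longrightarrow> w \<bullet> n = 0 \<longrightarrow> \<bar>g v - g w\<bar> \<le> L * norm (v - w)) \<and>
        (\<forall>y\<in>ball x r. y \<in> \<Omega> \<longleftrightarrow> (y - x) \<bullet> n < g ((y - x) - ((y - x) \<bullet> n) *\<^sub>R n))))"

end

theory Submission
  imports Defs "HOL-Computational_Algebra.Polynomial"
begin

text \<open>
  The solution is an explicit lacunary superposition of tiny bumps with disjoint supports. Level \<open>j\<close> consists of
  \<open>N j\<close> translates of \<open>b * \<psi> ((x - z) / r)\<close> with \<open>r = lam * 2^(-C j)\<close>, where \<open>C\<close> is large, while \<open>N j * r^d\<close> is
  comparable to \<open>2^(-d j)\<close>. As the supports are disjoint, the nonlinear map \<open>A\<close> acts on each bump separately: with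
  \<open>b = a^\<sigma> * r^(1 + \<sigma>)\<close>, \<open>\<sigma> = 1 / (p - 1)\<close>, the flux is \<open>a * r * A(\<nabla>\<psi>)\<close> on each bump, and \<open>f\<close>, its negative
  divergence, has height \<open>a = 2^(d j / \<mu>)\<close>; hence \<open>f\<close> belongs to \<open>L_\<nu>\<close> for \<open>\<nu> < \<mu>\<close>
  (\<open>\<nu> \<le> \<infinity>\<close> if \<open>\<mu> = \<infinity>\<close>). The weight of level \<open>j\<close> in the \<open>B^s_(\<rho>,q)\<close> norm of \<open>u\<close> is
  \<open>r^(-s) * b * (N j * r^d)^(1/\<rho>)\<close>, that is, \<open>2^(j (C (s - 1 - \<sigma>) + d (\<sigma>/\<mu> - 1/\<rho>)))\<close> up to a constant: the sign of
  this exponent decides membership, and for large \<open>C\<close> a change of \<open>s\<close> by \<open>\<epsilon>\<close> outweighs the second summand.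
\<close>

section \<open>A smooth bump\<close>

text \<open>The critical cases are settled by counting levels: if the exponent is zero, all levels
  contribute equally, which keeps a supremum finite but makes a sum or integral over infinitely many
  levels diverge. The same count shows that the gradient of the flux leaves L_\<rho> already at
  \<rho> = \<mu>. Membership in a Besov space on \<Omega> allows an arbitrary extension, so
  non-membership has to be shown for all extensions at once. The lower bounds therefore use second
  differences whose three points lie in \<Omega>; room for two steps across a bump is the reason for
  keeping five-fold enlarged balls apart. A series of bumps has at most one nonzero term at each
  point, but need not be smooth where bumps accumulate. Its weak derivatives come from finite
  truncations by dominated convergence, and the truncations of \<open>u\<close> are the test
  functions required by W^1_(p,0). \<open>f\<close> may be unbounded; it is a bounded functional
  because the flux, of height \<open>a * r\<close>, is bounded once C exceeds d / \<mu>. The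
  hypothesis p > 2 makes A(\<nabla>\<psi>) continuously differentiable despite the degeneracy at
  zeros of \<nabla>\<psi>.\<close>

definition flat :: "real poly \<Rightarrow> real \<Rightarrow> real" where
  "flat Q t = (if t > 0 then poly Q (1 / t) * exp (- (1 / t)) else 0)"

lemma poly_times_exp_minus_tendsto_0:
  "((\<lambda>x::real. poly Q x * exp (- x)) \<longlongrightarrow> 0) at_top"
proof -
  have "((\<lambda>x::real. \<Sum>i\<le>degree Q. coeff Q i * (x ^ i / exp x)) \<longlongrightarrow> (\<Sum>i\<le>degree Q. coeff Q i * 0)) at_top"
    by (intro tendsto_sum tendsto_mult tendsto_const tendsto_power_div_exp_0)
  then show ?thesis
    by (simp add: poly_altdef exp_minus field_simps sum_distrib_left sum_divide_distrib)
qed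

text \<open>With y = 1/t one has dy/dt = -y^2, and the y-derivative of Q(y) exp(-y) is (Q' - Q)(y)
  exp(-y). Carrying an arbitrary polynomial \<open>Q\<close> makes the family closed under
  differentiation.\<close>

lemma flat_has_derivative:
  "(flat Q has_real_derivative flat ([:0, 0, 1:] * (Q - pderiv Q)) t) (at t)"
proof -
  consider "t > 0" | "t < 0" | "t = 0" by linarith
  then show ?thesis
  proof cases
    case 1
    have "((\<lambda>t. poly Q (1 / t) * exp (- (1 / t))) has_real_derivative
            poly (pderiv Q) (1 / t) * (- (1 / t ^ 2)) * exp (- (1 / t))
             + poly Q (1 / t) * (exp (- (1 / t)) * (1 / t ^ 2))) (at t)"
      using 1 by (auto intro!: derivative_eq_intros DERIV_chain2[OF poly_DERIV] simp: power2_eq_square field_simps)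
    moreover have "eventually (\<lambda>s. flat Q s = poly Q (1 / s) * exp (- (1 / s))) (nhds t)"
      using eventually_nhds_in_open[of "{0<..}" t] 1 by (auto simp: flat_def elim!: eventually_mono)
    ultimately have "(flat Q has_real_derivative poly (pderiv Q) (1 / t) * (- (1 / t ^ 2)) * exp (- (1 / t))
             + poly Q (1 / t) * (exp (- (1 / t)) * (1 / t ^ 2))) (at t)"
      by (subst DERIV_cong_ev[OF refl _ refl]) auto
    then show ?thesis
      using 1 by (simp add: flat_def algebra_simps power2_eq_square add_divide_distrib diff_divide_distrib)
  next
    case 2
    have "eventually (\<lambda>s. flat Q s = 0) (nhds t)"
      using eventually_nhds_in_open[of "{..<0}" t] 2 by (auto simp: flat_def elim!: eventually_mono)
    then have "(flat Q has_real_derivative 0) (at t)"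
      by (subst DERIV_cong_ev[OF refl _ refl]) auto
    then show ?thesis using 2 by (simp add: flat_def)
  next
    case 3
    \<comment> \<open>With y = 1/h the right-hand difference quotient at 0 is y Q(y) exp(-y), which
      tends to 0 as y grows.\<close>
    have "((\<lambda>h. poly ([:0, 1:] * Q) (inverse h) * exp (- inverse h)) \<longlongrightarrow> 0) (at_right (0::real))"
      by (rule filterlim_compose[OF poly_times_exp_minus_tendsto_0 filterlim_inverse_at_top_right])
    then have r: "((\<lambda>h. flat Q h / h) \<longlongrightarrow> 0) (at_right (0::real))"
      by (rule Lim_transform_eventually)
         (auto simp: flat_def eventually_at_right_less field_simps intro!: eventually_at_rightI[of 0 1])
    have l: "((\<lambda>h. flat Q h / h) \<longlongrightarrow> 0) (at_left (0::real))"
      by (rule Lim_transform_eventually[OF tendsto_const])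
         (auto simp: flat_def intro!: eventually_at_leftI[of "-1" 0])
    have "((\<lambda>h. flat Q h / h) \<longlongrightarrow> 0) (at (0::real))"
      using l r by (simp add: filterlim_at_split)
    then show ?thesis using 3 by (simp add: DERIV_def flat_def)
  qed
qed

text \<open>Contains the bumps and is closed under directional derivatives, hence consists of smooth functions.\<close>

inductive flat_gen :: "('a::euclidean_space \<Rightarrow> real) \<Rightarrow> bool" where
  flat_gen_const: "flat_gen (\<lambda>x. c)"
| flat_gen_inner: "flat_gen (\<lambda>x. x \<bullet> v)"
| flat_gen_add: "flat_gen f \<Longrightarrow> flat_gen g \<Longrightarrow> flat_gen (\<lambda>x. f x + g x)"
| flat_gen_mult: "flat_gen f \<Longrightarrow> flat_gen g \<Longrightarrow> flat_gen (\<lambda>x. f x * g x)"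
| flat_gen_flat: "flat_gen f \<Longrightarrow> flat_gen (\<lambda>x. flat Q (f x))"

text \<open>Differentiability and closure of the class under directional derivatives go through the
  induction together: each rule of calculus expresses \<open>f' v\<close> by generators and the
  derivatives of the parts.\<close>

lemma flat_gen_has_derivative:
  "flat_gen f \<Longrightarrow> \<exists>f'. (\<forall>x. (f has_derivative (\<lambda>v. f' v x)) (at x)) \<and> (\<forall>v. flat_gen (f' v))"
proof (induction rule: flat_gen.induct)
  case (flat_gen_const c)
  show ?case by (rule exI[of _ "\<lambda>v x. 0"]) (auto intro: flat_gen.intros)
next
  case (flat_gen_inner v)
  show ?case by (rule exI[of _ "\<lambda>w x. w \<bullet> v"]) (auto intro!: flat_gen.intros derivative_eq_intros)
next
  case (flat_gen_add f g)
  then obtain f' g' where "\<forall>x. (f has_derivative (\<lambda>v. f' v x)) (at x)" "\<forall>v. flat_gen (f' v)"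
    "\<forall>x. (g has_derivative (\<lambda>v. g' v x)) (at x)" "\<forall>v. flat_gen (g' v)" by blast
  then show ?case
    by (intro exI[of _ "\<lambda>v x. f' v x + g' v x"]) (auto intro!: flat_gen.intros derivative_intros)
next
  case (flat_gen_mult f g)
  then obtain f' g' where "\<forall>x. (f has_derivative (\<lambda>v. f' v x)) (at x)" "\<forall>v. flat_gen (f' v)"
    "\<forall>x. (g has_derivative (\<lambda>v. g' v x)) (at x)" "\<forall>v. flat_gen (g' v)" by blast
  then show ?case using flat_gen_mult(1,2)
    by (intro exI[of _ "\<lambda>v x. f x * g' v x + f' v x * g x"]) (auto intro!: flat_gen.intros has_derivative_mult)
next
  case (flat_gen_flat f Q)
  then obtain f' where f': "\<forall>x. (f has_derivative (\<lambda>v. f' v x)) (at x)" "\<forall>v. flat_gen (f' v)" by blast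
  have "((\<lambda>x. flat Q (f x)) has_derivative (\<lambda>v. flat ([:0, 0, 1:] * (Q - pderiv Q)) (f x) * f' v x)) (at x)" for x
    using has_derivative_compose[OF f'(1)[rule_format] flat_has_derivative[where Q=Q, unfolded has_field_derivative_def], of x]
    by simp
  then show ?case using f' flat_gen_flat(1)
    by (intro exI[of _ "\<lambda>v x. flat ([:0, 0, 1:] * (Q - pderiv Q)) (f x) * f' v x"])
       (auto intro!: flat_gen.flat_gen_mult flat_gen.flat_gen_flat)
qed

lemma flat_gen_differentiable: "flat_gen f \<Longrightarrow> f differentiable (at x)"
  using flat_gen_has_derivative unfolding differentiable_def by blast

lemma flat_gen_frechet_derivative:
  assumes "flat_gen f" shows "flat_gen (\<lambda>x. frechet_derivative f (at x) v)"
proof -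
  obtain f' where f': "\<forall>x. (f has_derivative (\<lambda>v. f' v x)) (at x)" "\<forall>v. flat_gen (f' v)"
    using flat_gen_has_derivative[OF assms] by blast
  then have "frechet_derivative f (at x) = (\<lambda>v. f' v x)" for x
    by (metis frechet_derivative_at)
  then show ?thesis using f'(2) by simp
qed

lemma flat_gen_pd: "flat_gen f \<Longrightarrow> flat_gen (pd f i)"
  using flat_gen_frechet_derivative[of f i] by (simp add: pd_def[abs_def])

lemma flat_gen_smooth_fn: assumes "flat_gen f" shows "smooth_fn f"
proof -
  have "flat_gen (dderivs vs f)" for vs
    by (induction vs) (auto simp: assms intro: flat_gen_frechet_derivative)
  then show ?thesis unfolding smooth_fn_def by (auto intro: flat_gen_differentiable)
qed

lemma flat_gen_continuous: "flat_gen f \<Longrightarrow> continuous_on UNIV f"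
  by (auto intro!: continuous_at_imp_continuous_on differentiable_imp_continuous_within flat_gen_differentiable)

lemma flat_gen_sum: "finite I \<Longrightarrow> (\<And>k. k \<in> I \<Longrightarrow> flat_gen (f k)) \<Longrightarrow> flat_gen (\<lambda>x. \<Sum>k\<in>I. f k x)"
  by (induction I rule: finite_induct) (auto intro: flat_gen_const flat_gen_add)

text \<open>The unnormalised standard mollifier exp(-1/(1 - |y|^2)), positive exactly on the open
  unit ball.\<close>

definition bump :: "'a::euclidean_space \<Rightarrow> real" where
  "bump y = flat 1 (1 - y \<bullet> y)"

text \<open>The class is generated from linear forms, so the squared norm is expanded in coordinates
  and becomes a polynomial in them.\<close>

lemma flat_gen_bump_scaled: "flat_gen (\<lambda>x::'a::euclidean_space. bump ((x - z) /\<^sub>R r))"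
proof -
  have e: "1 - ((x - z) /\<^sub>R r) \<bullet> ((x - z) /\<^sub>R r)
      = 1 + (- (inverse r ^ 2)) * (\<Sum>i\<in>Basis. (x \<bullet> i + - (z \<bullet> i)) * (x \<bullet> i + - (z \<bullet> i)))" for x :: 'a
    by (subst (1) euclidean_inner)
       (simp add: inner_diff_left power2_eq_square sum_distrib_left algebra_simps sum_subtractf sum.distrib
          sum_negf)
  show ?thesis unfolding bump_def e
    by (intro flat_gen.intros flat_gen_sum) auto
qed

lemma flat_gen_bump: "flat_gen (bump :: 'a::euclidean_space \<Rightarrow> real)"
  using flat_gen_bump_scaled[where z=0 and r=1] by simp

lemma bump_pos: "norm y < 1 \<Longrightarrow> 0 < bump y"
  by (auto simp: bump_def flat_def power2_norm_eq_inner[symmetric] power_less_one_iff)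

lemma bump_eq_0: "1 \<le> norm y \<Longrightarrow> bump y = 0"
  using one_le_power[of "norm y" 2] by (simp add: bump_def flat_def power2_norm_eq_inner)

text \<open>Here 1 - |y|^2 \<ge> 3/4, which explains the constant 4/3. The bound later makes second
  differences of \<open>u\<close> large on the inner halves of the balls.\<close>

lemma bump_ge: assumes "norm y \<le> 1/2" shows "exp (- (4/3)) \<le> bump y"
proof -
  have "y \<bullet> y \<le> 1/4"
    using power_mono[OF assms, of 2] by (simp add: power2_norm_eq_inner[symmetric] power2_eq_square)
  then have "1 / (1 - y \<bullet> y) \<le> 4/3" "y \<bullet> y < 1" by (auto simp: field_simps)
  then show ?thesis by (auto simp: bump_def flat_def)
qed

section \<open>Integration by parts\<close>

lemma integrable_bounded_compact:
  fixes f :: "'a::euclidean_space \<Rightarrow> real"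
  assumes "f \<in> borel_measurable borel" "\<And>x. \<bar>f x\<bar> \<le> B" "compact K" "\<And>x. x \<notin> K \<Longrightarrow> f x = 0"
  shows "integrable lborel f"
proof (rule Bochner_Integration.integrable_bound)
  have "emeasure lborel K < \<infinity>" by (rule emeasure_compact_finite[OF assms(3)])
  then show "integrable lborel (\<lambda>x. B * indicator K x :: real)"
    using assms(3) by (intro integrable_mult_right integrable_real_indicator) (auto intro: borel_compact)
  show "AE x in lborel. norm (f x) \<le> norm (B * indicator K x :: real)"
    using assms(2,4) by (auto simp: indicator_def intro: order_trans[OF _ abs_ge_self])
qed (use assms(1) in simp)

lemma continuous_compact_bounded:
  fixes f :: "'a::euclidean_space \<Rightarrow> real"
  assumes "continuous_on UNIV f" "compact K" "\<And>x. x \<notin> K \<Longrightarrow> f x = 0"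
  obtains B where "0 \<le> B" "\<And>x. \<bar>f x\<bar> \<le> B"
proof -
  have "bounded (f ` K)"
    using assms by (meson compact_continuous_image compact_imp_bounded continuous_on_subset subset_UNIV)
  then obtain B where "\<And>x. x \<in> K \<Longrightarrow> \<bar>f x\<bar> \<le> B"
    by (auto simp: bounded_iff)
  then show ?thesis using assms(3) by (intro that[of "\<bar>B\<bar>"]) (fastforce intro: order_trans[OF _ abs_ge_self])+
qed

section \<open>Partial derivatives and derivatives along lines\<close>

lemma pd_outside_support:
  assumes "closed K" "\<And>x. x \<notin> K \<Longrightarrow> F x = 0" "x \<notin> K"
  shows "pd F i x = 0"
proof -
  have "((\<lambda>x. 0) has_derivative (\<lambda>v. 0)) (at x)" by simp
  then have "(F has_derivative (\<lambda>v. 0)) (at x)"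
    using assms by (intro has_derivative_transform_within_open[of "\<lambda>x. 0" _ x UNIV "- K" F]) auto
  then show ?thesis unfolding pd_def by (metis frechet_derivative_at)
qed

lemma has_derivative_pd:
  assumes "F differentiable (at x)"
  shows "(F has_derivative (\<lambda>v. \<Sum>i\<in>Basis. (v \<bullet> i) * pd F i x)) (at x)"
proof -
  have F: "(F has_derivative frechet_derivative F (at x)) (at x)"
    using assms by (simp add: frechet_derivative_works)
  then have l: "linear (frechet_derivative F (at x))" by (rule has_derivative_linear)
  have "frechet_derivative F (at x) v = (\<Sum>i\<in>Basis. (v \<bullet> i) * pd F i x)" for v
  proof -
    have "frechet_derivative F (at x) v = frechet_derivative F (at x) (\<Sum>i\<in>Basis. (v \<bullet> i) *\<^sub>R i)"
      by (simp add: euclidean_representation)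
    also have "\<dots> = (\<Sum>i\<in>Basis. (v \<bullet> i) * pd F i x)"
      by (simp add: linear_sum[OF l] linear_cmul[OF l] pd_def)
    finally show ?thesis .
  qed
  then show ?thesis using F by (metis (no_types, lifting) ext)
qed

lemma pd_eqI: "(F has_derivative D) (at x) \<Longrightarrow> pd F i x = D i"
  unfolding pd_def by (metis frechet_derivative_at)

lemma has_real_derivative_line:
  fixes F :: "'a::euclidean_space \<Rightarrow> real"
  assumes "F differentiable (at (x + s *\<^sub>R v))"
  shows "((\<lambda>s. F (x + s *\<^sub>R v)) has_real_derivative (\<Sum>i\<in>Basis. (v \<bullet> i) * pd F i (x + s *\<^sub>R v))) (at s)"
proof -
  have "((\<lambda>s. x + s *\<^sub>R v) has_derivative (\<lambda>t. t *\<^sub>R v)) (at s)"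
    by (auto intro!: derivative_eq_intros)
  from has_derivative_compose[OF this has_derivative_pd[OF assms]]
  have "((\<lambda>s. F (x + s *\<^sub>R v)) has_derivative (\<lambda>t. \<Sum>i\<in>Basis. (t *\<^sub>R v \<bullet> i) * pd F i (x + s *\<^sub>R v))) (at s)" .
  moreover have "(\<lambda>t. \<Sum>i\<in>Basis. (t *\<^sub>R v \<bullet> i) * pd F i (x + s *\<^sub>R v))
     = (*) (\<Sum>i\<in>Basis. (v \<bullet> i) * pd F i (x + s *\<^sub>R v))"
    by (auto simp: sum_distrib_left algebra_simps)
  ultimately show ?thesis unfolding has_field_derivative_def by simp
qed

lemma has_real_derivative_line_pd:
  fixes F :: "'a::euclidean_space \<Rightarrow> real"
  assumes "F differentiable (at (x + s *\<^sub>R i))" "i \<in> Basis"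
  shows "((\<lambda>s. F (x + s *\<^sub>R i)) has_real_derivative pd F i (x + s *\<^sub>R i)) (at s)"
proof -
  have "(\<Sum>j\<in>Basis. (i \<bullet> j) * pd F j (x + s *\<^sub>R i)) = (\<Sum>j\<in>Basis. if j = i then pd F j (x + s *\<^sub>R i) else 0)"
    using assms(2) by (intro sum.cong) (auto simp: inner_Basis)
  then show ?thesis using has_real_derivative_line[OF assms(1)] assms(2) by simp
qed

lemma integral_lborel_translate:
  fixes F :: "'a::euclidean_space \<Rightarrow> real"
  assumes "F \<in> borel_measurable borel"
  shows "(\<integral>x. F (x + c) \<partial>lborel) = integral\<^sup>L lborel F"
proof -
  have "integral\<^sup>L (distr lborel borel ((+) c)) F = (\<integral>x. F (c + x) \<partial>lborel)"
    using assms by (intro integral_distr) auto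
  then show ?thesis by (simp add: lborel_distr_plus add.commute)
qed

lemma nn_integral_lborel_translate:
  fixes F :: "'a::euclidean_space \<Rightarrow> ennreal"
  assumes "F \<in> borel_measurable borel"
  shows "(\<integral>\<^sup>+x. F (x + c) \<partial>lborel) = integral\<^sup>N lborel F"
proof -
  have "integral\<^sup>N (distr lborel borel ((+) c)) F = (\<integral>\<^sup>+x. F (c + x) \<partial>lborel)"
    using assms by (intro nn_integral_distr) auto
  then show ?thesis by (simp add: lborel_distr_plus add.commute)
qed

text \<open>Difference quotients have integral zero by translation invariance; dominated convergence.\<close>
lemma integral_pd_eq_0:
  fixes F :: "'a::euclidean_space \<Rightarrow> real"
  assumes d: "\<And>x. F differentiable (at x)" and K: "compact K" "\<And>x. x \<notin> K \<Longrightarrow> F x = 0"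
    and B: "\<And>x. \<bar>pd F i x\<bar> \<le> B" and i: "i \<in> Basis"
  shows "integral\<^sup>L lborel (pd F i) = 0"
proof -
  have c: "continuous_on UNIV F"
    using d by (auto intro!: continuous_at_imp_continuous_on differentiable_imp_continuous_within)
  then have m: "F \<in> borel_measurable borel" by (rule borel_measurable_continuous_onI)
  obtain C where C: "\<And>x. \<bar>F x\<bar> \<le> C" using continuous_compact_bounded[OF c K] by blast
  have int: "integrable lborel F" by (rule integrable_bounded_compact[OF m C K])
  obtain R where R: "K \<subseteq> cball 0 R" using compact_imp_bounded[OF K(1)] by (auto simp: bounded_iff subset_iff)
  define D where "D n x = (F (x + inverse (real (Suc n)) *\<^sub>R i) - F x) * real (Suc n)" for n x
  have Dm: "D n \<in> borel_measurable borel" for n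
    unfolding D_def using m by measurable
  have lip: "\<bar>F (x + h *\<^sub>R i) - F x\<bar> \<le> B * h" if "h > 0" for x h
  proof -
    have "\<exists>z>0. z < h \<and> F (x + h *\<^sub>R i) - F (x + 0 *\<^sub>R i) = (h - 0) * pd F i (x + z *\<^sub>R i)"
      by (rule MVT2[where f="\<lambda>s. F (x + s *\<^sub>R i)" and f'="\<lambda>s. pd F i (x + s *\<^sub>R i)", OF that has_real_derivative_line_pd[OF d i]])
    then obtain z where "F (x + h *\<^sub>R i) - F (x + 0 *\<^sub>R i) = (h - 0) * pd F i (x + z *\<^sub>R i)"
      by blast
    then show ?thesis using B[of "x + z *\<^sub>R i"] that by (simp add: abs_mult)
  qed
  have "(\<lambda>n. integral\<^sup>L lborel (D n)) \<longlonglongrightarrow> integral\<^sup>L lborel (pd F i)"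
  proof (rule integral_dominated_convergence)
    have lim: "(\<lambda>n. D n x) \<longlonglongrightarrow> pd F i x" for x
    proof -
      have 1: "((\<lambda>h. (F (x + h *\<^sub>R i) - F x) / h) \<longlongrightarrow> pd F i x) (at 0)"
        using has_real_derivative_line_pd[OF d i, of x 0] by (simp add: DERIV_def)
      have 2: "filterlim (\<lambda>n. inverse (real (Suc n))) (at 0) sequentially"
        using LIMSEQ_inverse_real_of_nat by (auto simp: filterlim_at)
      show ?thesis
        using filterlim_compose[OF 1 2] by (simp add: D_def divide_inverse del: of_nat_Suc)
    qed
    then show "pd F i \<in> borel_measurable lborel"
      by (rule borel_measurable_LIMSEQ_real[where u=D]) (use Dm lim in auto)
    show "AE x in lborel. (\<lambda>n. D n x) \<longlonglongrightarrow> pd F i x" using lim by simp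
    show "D n \<in> borel_measurable lborel" for n using Dm by simp
    have B0: "0 \<le> B" using B[of 0] by linarith
    \<comment> \<open>Steps have length at most 1, so all difference quotients vanish outside the
      ball of radius R + 1; inside it the mean value theorem bounds them by
      \<open>B\<close>.\<close>
    show "integrable lborel (\<lambda>x::'a. B * indicator (cball 0 (R + 1)) x :: real)"
      using B0 by (intro integrable_bounded_compact[of _ B "cball 0 (R + 1)"]) (auto simp: indicator_def)
    show "AE x in lborel. norm (D n x) \<le> B * indicator (cball 0 (R + 1)) x" for n
    proof (rule AE_I2)
      fix x
      have h: "inverse (real (Suc n)) \<le> 1" by (simp add: field_simps)
      show "norm (D n x) \<le> B * indicator (cball 0 (R + 1)) x"
      proof (cases "x \<in> cball 0 (R + 1)")
        case True
        have "norm (D n x) \<le> B * inverse (real (Suc n)) * real (Suc n)"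
          unfolding D_def real_norm_def abs_mult using lip[of "inverse (real (Suc n))" x]
          by (intro mult_mono) auto
        also have "\<dots> = B" by (simp add: field_simps del: of_nat_Suc)
        finally show ?thesis using True by simp
      next
        case False
        have "norm x \<le> norm (x + inverse (real (Suc n)) *\<^sub>R i) + inverse (real (Suc n))"
          using norm_triangle_ineq4[of "x + inverse (real (Suc n)) *\<^sub>R i" "inverse (real (Suc n)) *\<^sub>R i"] i
          by simp
        with False h have "x + inverse (real (Suc n)) *\<^sub>R i \<notin> cball 0 R" "x \<notin> cball 0 R" by auto
        then have "F (x + inverse (real (Suc n)) *\<^sub>R i) = 0" "F x = 0" using R K(2) by blast+
        then show ?thesis using False unfolding D_def by simp
      qed
    qed
  qed
  moreover have "integral\<^sup>L lborel (D n) = 0" for n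
  proof -
    have "integrable lborel (\<lambda>x. F (x + inverse (real (Suc n)) *\<^sub>R i))"
    proof -
      have "integrable (distr lborel borel ((+) (inverse (real (Suc n)) *\<^sub>R i))) F"
        using int by (simp add: lborel_distr_plus)
      then show ?thesis by (subst (asm) integrable_distr_eq) (use m in \<open>auto simp: add.commute\<close>)
    qed
    then show ?thesis unfolding D_def
      using int integral_lborel_translate[OF m] by simp
  qed
  ultimately have "(\<lambda>n. 0) \<longlonglongrightarrow> integral\<^sup>L lborel (pd F i)" by simp
  from LIMSEQ_unique[OF this tendsto_const] show ?thesis by simp
qed

text \<open>The product of \<open>g\<close> and \<open>\<phi>\<close> inherits compact support from
  \<open>\<phi>\<close>, so \<open>integral_pd_eq_0\<close> applies to it, and the product rule
  gives the identity.\<close>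

lemma integral_by_parts_pd:
  fixes g \<phi> :: "'a::euclidean_space \<Rightarrow> real"
  assumes g: "\<And>x. g differentiable (at x)" "\<And>x. \<bar>g x\<bar> \<le> A" "\<And>x. \<bar>pd g i x\<bar> \<le> A'"
    "pd g i \<in> borel_measurable borel"
    and \<phi>: "\<And>x. \<phi> differentiable (at x)" "\<And>x. \<bar>\<phi> x\<bar> \<le> B" "\<And>x. \<bar>pd \<phi> i x\<bar> \<le> B'"
    "pd \<phi> i \<in> borel_measurable borel"
    and K: "compact K" "\<And>x. x \<notin> K \<Longrightarrow> \<phi> x = 0" and i: "i \<in> Basis"
  shows "(\<integral>x. g x * pd \<phi> i x \<partial>lborel) = - (\<integral>x. pd g i x * \<phi> x \<partial>lborel)"
proof -
  have m: "F \<in> borel_measurable borel" if "\<And>x. F differentiable (at x)" for F :: "'a \<Rightarrow> real"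
    using that by (auto intro!: borel_measurable_continuous_onI continuous_at_imp_continuous_on
        differentiable_imp_continuous_within)
  note gm = m[OF g(1)] m[OF \<phi>(1)]
  have A: "0 \<le> A" "0 \<le> A'" using g(2)[of 0] g(3)[of 0] by linarith+
  have "pd \<phi> i x = 0" if "x \<notin> K" for x
    by (rule pd_outside_support[OF compact_imp_closed[OF K(1)] K(2) that])
  then have i1: "integrable lborel (\<lambda>x. g x * pd \<phi> i x)"
    using gm \<phi>(4) g(2) \<phi>(3) A
    by (intro integrable_bounded_compact[of _ "A * B'" K]) (auto simp: abs_mult K intro!: mult_mono)
  have i2: "integrable lborel (\<lambda>x. pd g i x * \<phi> x)"
    using gm g(4) g(3) \<phi>(2) A
    by (intro integrable_bounded_compact[of _ "A' * B" K]) (auto simp: abs_mult K intro!: mult_mono)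
  have e: "pd (\<lambda>x. g x * \<phi> x) i = (\<lambda>x. g x * pd \<phi> i x + pd g i x * \<phi> x)"
  proof
    fix x
    show "pd (\<lambda>x. g x * \<phi> x) i x = g x * pd \<phi> i x + pd g i x * \<phi> x"
      using pd_eqI[OF has_derivative_mult[OF frechet_derivative_works[THEN iffD1, OF g(1)]
          frechet_derivative_works[THEN iffD1, OF \<phi>(1)]], of i x]
      unfolding pd_def .
  qed
  have "\<bar>pd (\<lambda>x. g x * \<phi> x) i x\<bar> \<le> A * B' + A' * B" for x
    unfolding e using g(2,3)[of x] \<phi>(2,3)[of x] A
    by (intro order_trans[OF abs_triangle_ineq] add_mono) (auto simp: abs_mult intro!: mult_mono)
  then have "integral\<^sup>L lborel (pd (\<lambda>x. g x * \<phi> x) i) = 0"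
    using g(1) \<phi>(1) K by (intro integral_pd_eq_0[of _ K _ "A * B' + A' * B"] i) (auto intro: differentiable_mult)
  then show ?thesis unfolding e using i1 i2 by simp
qed

lemma test_fnE:
  fixes \<phi> :: "'a::euclidean_space \<Rightarrow> real"
  assumes "test_fn \<Omega> \<phi>"
  obtains K B where "compact K" "K \<subseteq> \<Omega>" "\<And>x. x \<notin> K \<Longrightarrow> \<phi> x = 0" "\<And>x i. x \<notin> K \<Longrightarrow> pd \<phi> i x = 0"
    "\<And>x. \<bar>\<phi> x\<bar> \<le> B" "\<And>x i. i \<in> Basis \<Longrightarrow> \<bar>pd \<phi> i x\<bar> \<le> B" "0 \<le> B"
    "\<And>x. \<phi> differentiable (at x)" "\<phi> \<in> borel_measurable borel" "\<And>i. pd \<phi> i \<in> borel_measurable borel"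
proof -
  obtain K where s: "smooth_fn \<phi>" and K: "compact K" "K \<subseteq> \<Omega>" "\<And>x. x \<notin> K \<Longrightarrow> \<phi> x = 0"
    using assms by (auto simp: test_fn_def)
  have d: "\<phi> differentiable (at x)" for x using s by (auto simp: smooth_fn_def dest: spec[of _ "[]"])
  have "pd \<phi> i differentiable (at x)" for i x
    using s by (auto simp: smooth_fn_def pd_def[abs_def] dest: spec[of _ "[i]"])
  then have c: "continuous_on UNIV \<phi>" "\<And>i. continuous_on UNIV (pd \<phi> i)"
    using d by (auto intro!: continuous_at_imp_continuous_on differentiable_imp_continuous_within)
  have o: "\<And>x i. x \<notin> K \<Longrightarrow> pd \<phi> i x = 0"
    using pd_outside_support[of K \<phi>] K compact_imp_closed by blast
  obtain B where B: "\<And>x. \<bar>\<phi> x\<bar> \<le> B" "0 \<le> B" using continuous_compact_bounded[OF c(1) K(1,3)] by metis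
  have "\<exists>B. \<forall>x. \<bar>pd \<phi> i x\<bar> \<le> B" for i using continuous_compact_bounded[OF c(2) K(1) o] by metis
  then obtain B' where B': "\<And>i x. \<bar>pd \<phi> i x\<bar> \<le> B' i" by metis
  have B'0: "0 \<le> B' i" for i using B'[of 0 i] by (meson abs_ge_zero order_trans B')
  have "\<bar>pd \<phi> i x\<bar> \<le> B + (\<Sum>i\<in>Basis. B' i)" if "i \<in> Basis" for i x
    using B'[of i x] member_le_sum[of i Basis B'] that B'0 B(2) by fastforce
  moreover have "\<bar>\<phi> x\<bar> \<le> B + (\<Sum>i\<in>Basis. B' i)" for x
    using B(1)[of x] sum_nonneg[of Basis B'] B'0 by (smt (verit))
  moreover have "0 \<le> B + (\<Sum>i\<in>Basis. B' i)" using B(2) sum_nonneg[of Basis B'] B'0 by auto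
  ultimately show ?thesis
    using K o d c by (intro that[of K "B + (\<Sum>i\<in>Basis. B' i)"]) (auto intro: borel_measurable_continuous_onI)
qed

section \<open>Bump profiles\<close>

text \<open>Continuity is what the bump, its derivatives, the flux components and their first
  derivatives have in common; the flux need not be smooth where the gradient of the bump vanishes.
  Support in the closed unit ball keeps copies in separated balls independent.\<close>

definition profile :: "('a::euclidean_space \<Rightarrow> real) \<Rightarrow> bool" where
  "profile \<Phi> \<longleftrightarrow> continuous_on UNIV \<Phi> \<and> (\<forall>y. 1 < norm y \<longrightarrow> \<Phi> y = 0)"

lemma profile_bounded:
  assumes "profile \<Phi>" obtains B where "0 \<le> B" "\<And>y. \<bar>\<Phi> y\<bar> \<le> B"
  using assms continuous_compact_bounded[of \<Phi> "cball 0 1"] by (auto simp: profile_def)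

lemma profile_measurable: "profile \<Phi> \<Longrightarrow> \<Phi> \<in> borel_measurable borel"
  by (auto simp: profile_def intro: borel_measurable_continuous_onI)

lemma profile_eq_0: "profile \<Phi> \<Longrightarrow> 1 < norm y \<Longrightarrow> \<Phi> y = 0"
  by (auto simp: profile_def)

lemma profile_sum: "(\<And>i. i \<in> I \<Longrightarrow> profile (\<Phi> i)) \<Longrightarrow> profile (\<lambda>y. \<Sum>i\<in>I. \<Phi> i y)"
  unfolding profile_def by (auto intro!: continuous_on_sum)

lemma profile_uminus: "profile \<Phi> \<Longrightarrow> profile (\<lambda>y. - \<Phi> y)"
  unfolding profile_def by (auto intro!: continuous_on_minus)

lemma profile_bump: "profile bump"
  by (auto simp: profile_def flat_gen_continuous flat_gen_bump bump_eq_0)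

lemma profile_pd:
  assumes "\<And>y. 1 < norm y \<Longrightarrow> \<Phi> y = 0" "continuous_on UNIV (pd \<Phi> i)"
  shows "profile (pd \<Phi> i)"
  using assms pd_outside_support[of "cball 0 1" \<Phi>] by (auto simp: profile_def)

lemma profile_pd_bump: "profile (pd bump i)"
  by (rule profile_pd) (auto simp: bump_eq_0 flat_gen_continuous flat_gen_bump flat_gen_pd)

lemma profile_pd_pd_bump: "profile (pd (pd bump i) k)"
  using profile_pd_bump
  by (intro profile_pd) (auto simp: profile_def flat_gen_continuous flat_gen_bump flat_gen_pd)

section \<open>The flux of a single bump and its regularity\<close>

definition grad_bump :: "'a::euclidean_space \<Rightarrow> 'a" where
  "grad_bump y = (\<Sum>i\<in>Basis. pd bump i y *\<^sub>R i)"

definition flux :: "real \<Rightarrow> 'a::euclidean_space \<Rightarrow> 'a \<Rightarrow> real" where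
  "flux p i y = pA p (grad_bump y) \<bullet> i"

lemma grad_bump_inner: "i \<in> Basis \<Longrightarrow> grad_bump y \<bullet> i = pd bump i y"
  by (simp add: grad_bump_def inner_sum_left inner_Basis if_distrib cong: if_cong)

lemma grad_bump_continuous: "continuous_on UNIV grad_bump"
  unfolding grad_bump_def[abs_def]
  using profile_pd_bump by (intro continuous_on_sum continuous_on_scaleR continuous_on_const) (auto simp: profile_def)

text \<open>At the origin both summands of the derivative vanish, since \<open>0 powr x = 0\<close> even for \<open>x \<le> 0\<close>.\<close>
lemma pA_has_derivative:
  assumes p: "2 < p"
  shows "(pA p has_derivative (\<lambda>\<eta>. (norm \<xi> powr (p - 2)) *\<^sub>R \<eta> + ((p - 2) * norm \<xi> powr (p - 4) * (\<xi> \<bullet> \<eta>)) *\<^sub>R \<xi>)) (at \<xi>)"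
proof (cases "\<xi> = 0")
  case False
  have n: "(norm has_derivative (\<lambda>\<eta>. \<eta> \<bullet> sgn \<xi>)) (at \<xi>)" using has_derivative_norm[OF False] by simp
  have pw: "((\<lambda>t. t powr (p - 2)) has_derivative (*) ((p - 2) * norm \<xi> powr (p - 2 - 1))) (at (norm \<xi>))"
    using has_real_derivative_powr[of "norm \<xi>" "p - 2"] False by (simp add: has_field_derivative_def)
  have "((\<lambda>\<xi>. norm \<xi> powr (p - 2)) has_derivative (\<lambda>\<eta>. (p - 2) * norm \<xi> powr (p - 3) * (\<eta> \<bullet> sgn \<xi>))) (at \<xi>)"
    using has_derivative_compose[OF n pw] by simp
  from has_derivative_scaleR[OF this has_derivative_ident]
  have "((\<lambda>\<xi>. norm \<xi> powr (p - 2) *\<^sub>R \<xi>) has_derivative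
     (\<lambda>\<eta>. norm \<xi> powr (p - 2) *\<^sub>R \<eta> + ((p - 2) * norm \<xi> powr (p - 3) * (\<eta> \<bullet> sgn \<xi>)) *\<^sub>R \<xi>)) (at \<xi>)" .
  \<comment> \<open>Writing sgn \<xi> as \<xi> / |\<xi>| turns the exponent p - 3 into p - 4 and
    gives a formula that can also be read at the origin.\<close>
  moreover have "norm \<xi> powr (p - 3) * (\<eta> \<bullet> sgn \<xi>) = norm \<xi> powr (p - 4) * (\<xi> \<bullet> \<eta>)" for \<eta>
  proof -
    have "norm \<xi> powr (p - 3) = norm \<xi> powr (p - 4) * norm \<xi>"
      using False powr_add[of "norm \<xi>" "p - 4" 1] by simp
    then show ?thesis using False by (simp add: sgn_div_norm inner_commute)
  qed
  ultimately show ?thesis unfolding pA_def[abs_def] by (simp add: mult.assoc)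
next
  case True
  have "(pA p has_derivative (\<lambda>\<eta>. 0)) (at (0::'a))"
  proof (rule has_derivativeI)
    \<comment> \<open>The difference quotient at 0 has norm |h|^(p - 2), and p > 2.\<close>
    have c: "((\<lambda>h::'a. norm h powr (p - 2)) \<longlongrightarrow> 0) (at 0)"
      using p by (intro tendsto_zero_powrI[where b="p - 2"]) (auto intro!: tendsto_eq_intros)
    show "((\<lambda>y. ((pA p y - pA p 0) - 0) /\<^sub>R norm (y - 0)) \<longlongrightarrow> 0) (at (0::'a))"
      by (rule tendsto_norm_zero_cancel, rule Lim_transform_eventually[OF c])
         (auto simp: pA_def eventually_at intro!: exI[of _ 1])
  qed simp
  then show ?thesis using True p by simp
qed

text \<open>For p < 4 the power is singular at the origin; the two linear factors compensate for it,
  since the product is bounded by a multiple of |\<xi>|^(p - 2).\<close>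

lemma pA_weight_continuous:
  fixes a b :: "'a::euclidean_space"
  assumes p: "2 < p"
  shows "continuous_on UNIV (\<lambda>\<xi>::'a. norm \<xi> powr (p - 4) * (\<xi> \<bullet> a) * (\<xi> \<bullet> b))"
proof (rule continuous_at_imp_continuous_on, rule ballI)
  fix \<xi> :: 'a
  show "isCont (\<lambda>\<xi>::'a. norm \<xi> powr (p - 4) * (\<xi> \<bullet> a) * (\<xi> \<bullet> b)) \<xi>"
  proof (cases "\<xi> = 0")
    case False
    then show ?thesis by (intro continuous_intros) auto
  next
    case True
    have bd: "\<bar>norm h powr (p - 4) * (h \<bullet> a) * (h \<bullet> b)\<bar> \<le> norm h powr (p - 2) * (norm a * norm b)" for h :: 'a
    proof (cases "h = 0")
      case False
      have "\<bar>h \<bullet> a\<bar> * \<bar>h \<bullet> b\<bar> \<le> (norm h * norm a) * (norm h * norm b)"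
        by (intro mult_mono Cauchy_Schwarz_ineq2) auto
      then have "norm h powr (p - 4) * (\<bar>h \<bullet> a\<bar> * \<bar>h \<bullet> b\<bar>) \<le> norm h powr (p - 4) * ((norm h * norm a) * (norm h * norm b))"
        by (intro mult_left_mono) auto
      also have "\<dots> = norm h powr (p - 2) * (norm a * norm b)"
        using False powr_add[of "norm h" "p - 4" 2] by (simp add: power2_eq_square)
      finally show ?thesis by (simp add: abs_mult mult.assoc)
    qed simp
    have "((\<lambda>h::'a. norm h powr (p - 2) * (norm a * norm b)) \<longlongrightarrow> 0) (at 0)"
      using p by (intro tendsto_mult_left_zero tendsto_zero_powrI[where b="p - 2"]) (auto intro!: tendsto_eq_intros)
    then have "((\<lambda>\<xi>::'a. norm \<xi> powr (p - 4) * (\<xi> \<bullet> a) * (\<xi> \<bullet> b)) \<longlongrightarrow> 0) (at 0)"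
      by (rule Lim_null_comparison[rotated]) (use bd in auto)
    then show ?thesis using True by (simp add: isCont_def)
  qed
qed

context
  fixes p :: real and i :: "'a::euclidean_space"
  assumes p: "2 < p"
begin

lemma pA_continuous: "continuous_on UNIV (pA p :: 'a \<Rightarrow> 'a)"
  using pA_has_derivative[OF p]
  by (auto intro!: continuous_at_imp_continuous_on has_derivative_continuous)

lemma profile_flux: "profile (flux p i)"
  unfolding profile_def
proof (intro conjI allI impI)
  show "continuous_on UNIV (flux p i)"
    unfolding flux_def[abs_def]
    by (intro continuous_intros continuous_on_compose2[OF pA_continuous grad_bump_continuous]) auto
  fix y :: 'a assume "1 < norm y"
  then have "grad_bump y = 0" unfolding grad_bump_def
    using profile_pd_bump by (intro sum.neutral) (auto simp: profile_def)
  then show "flux p i y = 0" by (simp add: flux_def pA_def)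
qed

text \<open>The second-order terms are arranged so that each contains the weight of
  \<open>pA_weight_continuous\<close> evaluated at the gradient; the continuity of the derivative
  can then be read off.\<close>

lemma flux_has_derivative:
  assumes i: "i \<in> Basis"
  shows "\<exists>D. (flux p i has_derivative D) (at y) \<and> (\<forall>k. D k =
     norm (grad_bump y) powr (p - 2) * pd (pd bump i) k y
     + (p - 2) * (\<Sum>l\<in>Basis. norm (grad_bump y) powr (p - 4) * (grad_bump y \<bullet> l) * (grad_bump y \<bullet> i) * pd (pd bump l) k y))"
proof -
  have g: "(grad_bump has_derivative (\<lambda>v. \<Sum>l\<in>Basis. (frechet_derivative (pd bump l) (at y) v) *\<^sub>R l)) (at y)"
    unfolding grad_bump_def[abs_def]
    by (intro has_derivative_sum has_derivative_scaleR_left frechet_derivative_works[THEN iffD1]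
        flat_gen_differentiable flat_gen_pd flat_gen_bump)
  have "((\<lambda>y. pA p (grad_bump y) \<bullet> i) has_derivative
     (\<lambda>k. ((norm (grad_bump y) powr (p - 2)) *\<^sub>R (\<Sum>l\<in>Basis. pd (pd bump l) k y *\<^sub>R l)
      + ((p - 2) * norm (grad_bump y) powr (p - 4) * (grad_bump y \<bullet> (\<Sum>l\<in>Basis. pd (pd bump l) k y *\<^sub>R l))) *\<^sub>R grad_bump y) \<bullet> i)) (at y)"
    using has_derivative_inner_left[OF has_derivative_compose[OF g pA_has_derivative[OF p]], of i]
    unfolding pd_def .
  moreover have "((norm (grad_bump y) powr (p - 2)) *\<^sub>R (\<Sum>l\<in>Basis. pd (pd bump l) k y *\<^sub>R l)
      + ((p - 2) * norm (grad_bump y) powr (p - 4) * (grad_bump y \<bullet> (\<Sum>l\<in>Basis. pd (pd bump l) k y *\<^sub>R l))) *\<^sub>R grad_bump y) \<bullet> i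
     = norm (grad_bump y) powr (p - 2) * pd (pd bump i) k y
     + (p - 2) * (\<Sum>l\<in>Basis. norm (grad_bump y) powr (p - 4) * (grad_bump y \<bullet> l) * (grad_bump y \<bullet> i) * pd (pd bump l) k y)" for k
    using i by (simp add: inner_add_left inner_sum_left inner_sum_right inner_Basis sum_distrib_left sum_distrib_right
        if_distrib mult_ac cong: if_cong)
  ultimately show ?thesis unfolding flux_def[abs_def] by blast
qed

lemma flux_differentiable: "i \<in> Basis \<Longrightarrow> flux p i differentiable (at y)"
  using flux_has_derivative unfolding differentiable_def by blast

text \<open>The flux is continuously differentiable although A degenerates at zeros of the gradient.
  Consequently \<open>f\<close> is bounded on each bump by a fixed multiple of its amplitude
  there.\<close>

lemma profile_pd_flux:
  assumes i: "i \<in> Basis"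
  shows "profile (pd (flux p i) k)"
proof (rule profile_pd)
  have e: "pd (flux p i) k = (\<lambda>y. norm (grad_bump y) powr (p - 2) * pd (pd bump i) k y
     + (p - 2) * (\<Sum>l\<in>Basis. norm (grad_bump y) powr (p - 4) * (grad_bump y \<bullet> l) * (grad_bump y \<bullet> i) * pd (pd bump l) k y))"
    using flux_has_derivative[OF i] by (metis (no_types, lifting) ext pd_eqI)
  have c: "continuous_on UNIV (pd (pd bump l) k)" for l :: 'a
    using profile_pd_pd_bump by (auto simp: profile_def)
  have w: "continuous_on UNIV (\<lambda>y. norm (grad_bump y) powr (p - 4) * (grad_bump y \<bullet> l) * (grad_bump y \<bullet> i))" for l :: 'a
    by (rule continuous_on_compose2[OF pA_weight_continuous[OF p] grad_bump_continuous]) auto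
  have v: "continuous_on UNIV (\<lambda>y::'a. norm (grad_bump y) powr (p - 2))"
    using p by (intro continuous_on_powr' continuous_intros grad_bump_continuous) auto
  show "continuous_on UNIV (pd (flux p i) k)"
    unfolding e by (intro continuous_on_add continuous_on_mult continuous_on_const continuous_on_sum c w v)
qed (use profile_flux in \<open>auto simp: profile_def\<close>)

end

section \<open>Lebesgue norms\<close>

lemma enn_rpow_mono: "x \<le> y \<Longrightarrow> 0 \<le> a \<Longrightarrow> enn_rpow x a \<le> enn_rpow y a"
  by (auto simp: enn_rpow_def top_unique enn2real_mono less_top intro!: ennreal_leI powr_mono2)

lemma enn_rpow_ennreal: "0 \<le> x \<Longrightarrow> enn_rpow (ennreal x) a = ennreal (x powr a)"
  by (simp add: enn_rpow_def)

lemma enn_rpow_less_top: "enn_rpow x a < top \<longleftrightarrow> x < top"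
  by (auto simp: enn_rpow_def less_top)

lemma lp_nrm_real: "lp_nrm (ereal \<rho>) S f = enn_rpow (\<integral>\<^sup>+ x. ennreal (\<bar>f x\<bar> powr \<rho>) \<partial>lebesgue_on S) (1 / \<rho>)"
  by (simp add: lp_nrm_def)

lemma nn_integral_lebesgue_on_le:
  assumes "S \<in> sets lebesgue"
  shows "(\<integral>\<^sup>+ x. f x \<partial>lebesgue_on S) \<le> (\<integral>\<^sup>+ x. f x \<partial>lborel)"
proof -
  have "(\<integral>\<^sup>+ x. f x \<partial>lebesgue_on S) = (\<integral>\<^sup>+ x. f x * indicator S x \<partial>lebesgue)"
    using assms by (intro nn_integral_restrict_space) auto
  also have "\<dots> \<le> (\<integral>\<^sup>+ x. f x \<partial>lebesgue)"
    by (intro nn_integral_mono) (auto simp: indicator_def)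
  finally show ?thesis by (simp add: nn_integral_completion)
qed

lemma borel_measurable_lebesgue_on:
  "f \<in> borel_measurable borel \<Longrightarrow> f \<in> borel_measurable (lebesgue_on S)"
  by (intro measurable_restrict_space1 measurable_completion) simp

lemma lp_mem_realI:
  assumes "f \<in> borel_measurable borel" "S \<in> sets lebesgue"
    "(\<integral>\<^sup>+ x. ennreal (\<bar>f x\<bar> powr \<rho>) \<partial>lborel) < \<infinity>"
  shows "lp_mem (ereal \<rho>) S f"
  using assms(1) le_less_trans[OF nn_integral_lebesgue_on_le[OF assms(2)] assms(3)]
  by (simp add: lp_mem_def lp_nrm_real enn_rpow_less_top borel_measurable_lebesgue_on)

lemma lp_nrm_inftyI: "(\<And>x. \<bar>f x\<bar> \<le> M) \<Longrightarrow> lp_nrm \<infinity> S f \<le> ennreal M"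
  unfolding lp_nrm_def by (auto intro!: Inf_lower ennreal_leI)

lemma lp_mem_inftyI:
  assumes "f \<in> borel_measurable borel" "\<And>x. \<bar>f x\<bar> \<le> M"
  shows "lp_mem \<infinity> S f"
  using assms(1) le_less_trans[OF lp_nrm_inftyI[of f M S, OF assms(2)] ennreal_less_top]
  by (simp add: lp_mem_def borel_measurable_lebesgue_on)

lemma lp_nrm_compact_le:
  assumes "\<And>x. \<bar>f x\<bar> \<le> M * indicator K x" "compact K" "0 < \<rho>" "0 \<le> M" "S \<in> sets lebesgue"
  shows "lp_nrm (ereal \<rho>) S f \<le> ennreal (M * measure lborel K powr (1 / \<rho>))"
proof -
  have K: "K \<in> sets lborel" using assms(2) by (simp add: borel_compact)
  have "(\<integral>\<^sup>+ x. ennreal (\<bar>f x\<bar> powr \<rho>) \<partial>lebesgue_on S) \<le> (\<integral>\<^sup>+ x. ennreal (\<bar>f x\<bar> powr \<rho>) \<partial>lborel)"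
    by (rule nn_integral_lebesgue_on_le[OF assms(5)])
  also have "\<dots> \<le> (\<integral>\<^sup>+ x. ennreal (M powr \<rho>) * indicator K x \<partial>lborel)"
  proof (intro nn_integral_mono)
    fix x
    show "ennreal (\<bar>f x\<bar> powr \<rho>) \<le> ennreal (M powr \<rho>) * indicator K x"
      using assms(1)[of x] assms(3) by (cases "x \<in> K") (auto intro!: ennreal_leI powr_mono2)
  qed
  also have "\<dots> = ennreal (M powr \<rho>) * emeasure lborel K"
    using K by (simp add: nn_integral_cmult_indicator)
  also have "\<dots> = ennreal (M powr \<rho> * measure lborel K)"
    using emeasure_compact_finite[OF assms(2)] by (simp add: emeasure_eq_ennreal_measure ennreal_mult less_top)
  finally have "lp_nrm (ereal \<rho>) S f \<le> enn_rpow (ennreal (M powr \<rho> * measure lborel K)) (1 / \<rho>)"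
    unfolding lp_nrm_real using assms(3) by (intro enn_rpow_mono) auto
  also have "\<dots> = ennreal (M * measure lborel K powr (1 / \<rho>))"
    using assms(3,4) by (simp add: enn_rpow_ennreal powr_mult powr_powr)
  finally show ?thesis .
qed

section \<open>Lacunary arrays of bumps\<close>

text \<open>Radii, amplitudes and level volumes are all geometric in the level index. Recording the
  binary logarithm of the ratio reduces products and powers to sums and multiples of
  exponents.\<close>

definition geo :: "real \<Rightarrow> real \<Rightarrow> nat \<Rightarrow> real" where
  "geo A \<alpha> j = A * 2 powr (\<alpha> * real j)"

lemma geo_mult: "geo A \<alpha> j * geo B \<beta> j = geo (A * B) (\<alpha> + \<beta>) j"
  by (simp add: geo_def powr_add algebra_simps)

lemma geo_powr: "0 \<le> A \<Longrightarrow> geo A \<alpha> j powr s = geo (A powr s) (\<alpha> * s) j"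
  by (simp add: geo_def powr_mult powr_powr algebra_simps)

lemma geo_eq_power: "geo A \<alpha> j = A * (2 powr \<alpha>) ^ j"
  by (simp add: geo_def powr_powr[symmetric] powr_realpow)

lemma geo_pos: "0 < A \<Longrightarrow> 0 < geo A \<alpha> j"
  by (simp add: geo_def)

lemma summable_geo: "\<alpha> < 0 \<Longrightarrow> summable (geo A \<alpha>)"
  unfolding geo_eq_power[abs_def] by (intro summable_mult summable_geometric) (simp add: powr_less_one)

lemma geo_le: "\<alpha> \<le> 0 \<Longrightarrow> \<bar>geo A \<alpha> j\<bar> \<le> \<bar>A\<bar>"
proof -
  assume "\<alpha> \<le> 0"
  then have "2 powr (\<alpha> * real j) \<le> 2 powr 0" by (intro powr_mono) (auto simp: mult_nonpos_nonneg)
  then show ?thesis unfolding geo_def abs_mult by (simp add: mult_left_le)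
qed

text \<open>Level \<open>j\<close> consists of bumps of radius \<open>r j\<close> at the points of \<open>P j\<close>; five-fold
  enlargements of the balls are disjoint, and \<open>card (P j)\<close> is such that level \<open>j\<close> has total
  volume comparable to \<open>2 powr (- d * j)\<close>, which decays much more slowly than \<open>r j ^ d\<close>.\<close>
locale bump_array =
  fixes P :: "nat \<Rightarrow> 'a::euclidean_space set" and K :: "'a set" and lam kap C :: real
  assumes finite_P: "finite (P j)"
    and sep: "z \<in> P j \<Longrightarrow> z' \<in> P k \<Longrightarrow> (j, z) \<noteq> (k, z') \<Longrightarrow>
      5 * geo lam (- C) j + 5 * geo lam (- C) k < dist z z'"
    and compact_K: "compact K"
    and cball_subset_K: "z \<in> P j \<Longrightarrow> cball z (5 * geo lam (- C) j) \<subseteq> K"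
    and card_P: "real (card (P j)) * geo lam (- C) j ^ DIM('a) = geo kap (- real DIM('a)) j"
    and lam: "0 < lam" and kap: "0 < kap" and C: "1 \<le> C"
begin

abbreviation "r \<equiv> geo lam (- C)"

lemma r_pos: "0 < r j" by (rule geo_pos[OF lam])

text \<open>Amplitudes and profile are separate arguments, so that \<open>u\<close>, the components
  of its gradient and flux, and \<open>f\<close> are instances of one construction. For a profile at
  most one term is nonzero at a given point, so convergence is never an issue.\<close>

definition bs :: "(nat \<Rightarrow> real) \<Rightarrow> ('a \<Rightarrow> real) \<Rightarrow> 'a \<Rightarrow> real" where
  "bs al \<Phi> x = (\<Sum>j. \<Sum>z\<in>P j. al j * \<Phi> ((x - z) /\<^sub>R r j))"

text \<open>Four enlargements matter: 1/2, where the bump is bounded below; 1, containing the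
  supports; 3, outside which second differences with steps up to \<open>r j\<close> do not meet
  level \<open>j\<close>; 5, on which no other bump is visible.\<close>

definition V :: "real \<Rightarrow> nat \<Rightarrow> 'a set" where
  "V k j = (\<Union>z\<in>P j. cball z (k * r j))"

lemma V_borel: "V k j \<in> sets borel"
  unfolding V_def using finite_P by (intro borel_closed closed_UN) auto

lemma V_subset: "k \<le> 5 \<Longrightarrow> V k j \<subseteq> K"
proof -
  assume k: "k \<le> 5"
  have "cball z (k * r j) \<subseteq> cball z (5 * r j)" for z :: 'a
    using mult_right_mono[OF k, of "r j"] r_pos[of j] by (simp add: subset_cball)
  then show ?thesis using cball_subset_K[of _ j] unfolding V_def by blast
qed

lemma profile_scaled_eq_0:
  assumes "profile \<Phi>" "r j < dist x z" shows "\<Phi> ((x - z) /\<^sub>R r j) = 0"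
proof (rule profile_eq_0[OF assms(1)])
  show "1 < norm ((x - z) /\<^sub>R r j)"
    using assms(2) r_pos[of j] by (simp add: dist_norm divide_inverse[symmetric] mult.commute less_divide_eq)
qed

text \<open>Any other centre, say of level \<open>k\<close>, is farther than 5 r j + 5 r k from
  \<open>z\<close>, hence farther than 5 r k from \<open>x\<close>. That a single term survives on
  the whole five-fold ball, and not just on the support, is what allows second differences to be
  evaluated.\<close>

lemma bs_near:
  assumes \<Phi>: "profile \<Phi>" and z: "z \<in> P j" "x \<in> cball z (5 * r j)"
  shows "bs al \<Phi> x = al j * \<Phi> ((x - z) /\<^sub>R r j)"
proof -
  have 0: "\<Phi> ((x - z') /\<^sub>R r k) = 0" if "z' \<in> P k" "(j, z) \<noteq> (k, z')" for z' k
  proof (rule profile_scaled_eq_0[OF \<Phi>])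
    have "5 * r j + 5 * r k < dist z z'" using sep[OF z(1) that] .
    also have "\<dots> \<le> dist z x + dist x z'" by (rule dist_triangle)
    finally show "r k < dist x z'" using z(2) r_pos[of k] by simp
  qed
  have "bs al \<Phi> x = (\<Sum>k\<in>{j}. \<Sum>z\<in>P k. al k * \<Phi> ((x - z) /\<^sub>R r k))"
    unfolding bs_def by (rule suminf_finite) (auto simp: 0 intro!: sum.neutral)
  also have "\<dots> = (\<Sum>z'\<in>P j. if z' = z then al j * \<Phi> ((x - z) /\<^sub>R r j) else 0)"
    by (auto simp: 0 intro!: sum.cong)
  also have "\<dots> = al j * \<Phi> ((x - z) /\<^sub>R r j)"
    using finite_P z(1) by simp
  finally show ?thesis .
qed

lemma bs_far:
  assumes "profile \<Phi>" "\<And>j. x \<notin> V 1 j" shows "bs al \<Phi> x = 0"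
proof -
  have "(\<Sum>z\<in>P j. al j * \<Phi> ((x - z) /\<^sub>R r j)) = 0" for j
    using assms(2)[of j] by (intro sum.neutral) (auto simp: V_def dist_commute intro!: profile_scaled_eq_0[OF assms(1)])
  then show ?thesis by (simp add: bs_def)
qed

lemma V_E: assumes "x \<in> V k j" "k \<le> 5"
  obtains z where "z \<in> P j" "x \<in> cball z (5 * r j)" "x \<in> cball z (k * r j)"
proof -
  obtain z where z: "z \<in> P j" "x \<in> cball z (k * r j)" using assms by (auto simp: V_def)
  moreover have "k * r j \<le> 5 * r j" using assms(2) r_pos[of j] by (intro mult_right_mono) auto
  ultimately show ?thesis by (intro that[of z]) auto
qed

text \<open>The distinction depends on the point alone and then serves all amplitudes and profiles.
  Several arrays can thus be evaluated at \<open>x\<close> at once, as is needed to compare the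
  gradient with the flux.\<close>

lemma bs_cases [consumes 1]:
  assumes "profile \<Phi>"
  obtains (near) j z where "z \<in> P j" "x \<in> cball z (5 * r j)" "x \<in> V 1 j" "\<And>al \<Phi>. profile \<Phi> \<Longrightarrow> bs al \<Phi> x = al j * \<Phi> ((x - z) /\<^sub>R r j)"
  | (far) "\<And>j. x \<notin> V 1 j" "\<And>al \<Phi>. profile \<Phi> \<Longrightarrow> bs al \<Phi> x = 0"
proof (cases "\<exists>j. x \<in> V 1 j")
  case True
  then obtain j where j: "x \<in> V 1 j" by blast
  then obtain z where z: "z \<in> P j" "x \<in> cball z (5 * r j)" by (rule V_E) auto
  show ?thesis by (rule near[OF z j bs_near[OF _ z]])
next
  case False
  show ?thesis by (rule far[OF _ bs_far]) (use False in auto)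
qed

lemma bs_outside: assumes "profile \<Phi>" "x \<notin> K" shows "bs al \<Phi> x = 0"
  using assms V_subset[of 1] by (intro bs_far) auto

lemma bs_trunc:
  "bs (\<lambda>j. if j < n then al j else 0) \<Phi> = (\<lambda>x. \<Sum>j<n. \<Sum>z\<in>P j. al j * \<Phi> ((x - z) /\<^sub>R r j))"
proof
  fix x
  show "bs (\<lambda>j. if j < n then al j else 0) \<Phi> x = (\<Sum>j<n. \<Sum>z\<in>P j. al j * \<Phi> ((x - z) /\<^sub>R r j))"
    unfolding bs_def by (subst suminf_finite[of "{..<n}"]) auto
qed

lemma bs_trunc_continuous:
  assumes "profile \<Phi>" shows "continuous_on UNIV (bs (\<lambda>j. if j < n then al j else 0) \<Phi>)"
proof -
  have c: "continuous_on UNIV \<Phi>" using assms by (simp add: profile_def)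
  have "continuous_on UNIV (\<lambda>x. \<Phi> ((x - z) /\<^sub>R \<rho>))" for z \<rho>
    by (rule continuous_on_compose2[OF c]) (intro continuous_intros subset_UNIV)+
  then show ?thesis
    unfolding bs_trunc by (intro continuous_on_sum continuous_on_mult continuous_on_const)
qed

lemma bs_measurable: assumes "profile \<Phi>" shows "bs al \<Phi> \<in> borel_measurable borel"
proof -
  note profile_measurable[OF assms, measurable]
  show ?thesis unfolding bs_def[abs_def] by measurable
qed

section \<open>Volumes of the levels and Lebesgue norms of arrays\<close>

lemma emeasure_V: assumes "0 \<le> k"
  shows "emeasure lborel (V k j) \<le> ennreal (unit_ball_vol (real DIM('a)) * k ^ DIM('a) * geo kap (- real DIM('a)) j)"
proof -
  have "emeasure lborel (V k j) \<le> (\<Sum>z\<in>P j. emeasure lborel (cball z (k * r j)))"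
    unfolding V_def using finite_P by (intro emeasure_subadditive_finite) auto
  also have "\<dots> = (\<Sum>z\<in>P j. ennreal (unit_ball_vol (real DIM('a)) * (k * r j) ^ DIM('a)))"
    using assms r_pos[of j] by (intro sum.cong) (auto simp: emeasure_cball)
  also have "\<dots> = ennreal (\<Sum>z\<in>P j. unit_ball_vol (real DIM('a)) * (k * r j) ^ DIM('a))"
    using assms r_pos[of j] by (intro sum_ennreal) auto
  also have "(\<Sum>z\<in>P j. unit_ball_vol (real DIM('a)) * (k * r j) ^ DIM('a))
      = unit_ball_vol (real DIM('a)) * k ^ DIM('a) * (real (card (P j)) * r j ^ DIM('a))"
    by (simp add: power_mult_distrib)
  finally show ?thesis by (simp add: card_P)
qed

definition vol :: "real \<Rightarrow> real" where
  "vol k = unit_ball_vol (real DIM('a)) * k ^ DIM('a) * kap"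

lemma vol_nonneg: "0 \<le> k \<Longrightarrow> 0 \<le> vol k" using kap by (simp add: vol_def)

text \<open>Integration level by level: \<open>c j\<close> is a height on level \<open>j\<close>,
  and the geometric factor bounds the volume of that level. The L_\<rho> bounds for arrays and for
  their second differences come from here.\<close>

lemma level_bound:
  assumes "\<And>x. F x \<le> (\<Sum>j. ennreal (c j) * indicator (V k j) x)" "\<And>j. 0 \<le> c j" "0 \<le> k"
  shows "(\<integral>\<^sup>+ x. F x \<partial>lborel) \<le> (\<Sum>j. ennreal (c j * geo (vol k) (- real DIM('a)) j))"
proof -
  have "(\<integral>\<^sup>+ x. F x \<partial>lborel) \<le> (\<integral>\<^sup>+ x. (\<Sum>j. ennreal (c j) * indicator (V k j) x) \<partial>lborel)"
    by (intro nn_integral_mono assms)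
  also have "\<dots> = (\<Sum>j. \<integral>\<^sup>+ x. ennreal (c j) * indicator (V k j) x \<partial>lborel)"
    using V_borel by (intro nn_integral_suminf) auto
  also have "\<dots> = (\<Sum>j. ennreal (c j) * emeasure lborel (V k j))"
    using V_borel by (simp add: nn_integral_cmult_indicator)
  also have "\<dots> \<le> (\<Sum>j. ennreal (c j * geo (vol k) (- real DIM('a)) j))"
  proof (intro suminf_le summableI)
    fix j
    have "ennreal (c j) * emeasure lborel (V k j) \<le> ennreal (c j) * ennreal (geo (vol k) (- real DIM('a)) j)"
      using emeasure_V[OF assms(3), of j] by (intro mult_left_mono) (auto simp: vol_def geo_def mult.assoc)
    then show "ennreal (c j) * emeasure lborel (V k j) \<le> ennreal (c j * geo (vol k) (- real DIM('a)) j)"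
      using assms(2) by (simp add: ennreal_mult')
  qed
  finally show ?thesis .
qed

lemma bs_level_le:
  assumes "profile \<Phi>" "\<And>y. \<bar>\<Phi> y\<bar> \<le> B" "0 < \<rho>"
  shows "ennreal (\<bar>bs al \<Phi> x\<bar> powr \<rho>) \<le> (\<Sum>j. ennreal ((\<bar>al j\<bar> * B) powr \<rho>) * indicator (V 1 j) x)"
  using assms(1)
proof (cases rule: bs_cases[of \<Phi> x])
  case (near j z)
  have "ennreal (\<bar>bs al \<Phi> x\<bar> powr \<rho>) \<le> ennreal ((\<bar>al j\<bar> * B) powr \<rho>) * indicator (V 1 j) x"
    using near assms by (auto simp: abs_mult intro!: ennreal_leI powr_mono2 mult_left_mono)
  also have "\<dots> = (\<Sum>i\<in>{j}. ennreal ((\<bar>al i\<bar> * B) powr \<rho>) * indicator (V 1 i) x)"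
    by (simp only: sum.insert sum.empty finite.emptyI empty_iff not_False_eq_True add_0_right)
  also have "\<dots> \<le> (\<Sum>i. ennreal ((\<bar>al i\<bar> * B) powr \<rho>) * indicator (V 1 i) x)"
    by (intro sum_le_suminf summableI) auto
  finally show ?thesis .
next
  case far
  then show ?thesis using assms by simp
qed

lemma suminf_geo_finite:
  assumes "\<alpha> < 0" "0 \<le> A" shows "(\<Sum>j. ennreal (geo A \<alpha> j)) < \<infinity>"
  using assms summable_geo[of \<alpha> A]
  by (subst suminf_ennreal2) (auto simp: geo_def)

text \<open>Heights contribute 2^(\<alpha> \<rho> j) and volumes 2^(-d j), so the hypothesis makes a
  geometric series converge. With \<alpha> = d / \<mu> it is the condition \<rho> < \<mu>.\<close>

lemma nn_integral_bs_finite: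
  assumes \<Phi>: "profile \<Phi>" and "0 < \<rho>" "\<alpha> * \<rho> < real DIM('a)"
  shows "(\<integral>\<^sup>+ x. ennreal (\<bar>bs (geo A \<alpha>) \<Phi> x\<bar> powr \<rho>) \<partial>lborel) < \<infinity>"
proof -
  obtain B where B: "0 \<le> B" "\<And>y. \<bar>\<Phi> y\<bar> \<le> B" using profile_bounded[OF \<Phi>] by blast
  have "(\<integral>\<^sup>+ x. ennreal (\<bar>bs (geo A \<alpha>) \<Phi> x\<bar> powr \<rho>) \<partial>lborel)
     \<le> (\<Sum>j. ennreal ((\<bar>geo A \<alpha> j\<bar> * B) powr \<rho> * geo (vol 1) (- real DIM('a)) j))"
    by (rule level_bound[OF bs_level_le[OF \<Phi> B(2) assms(2)]]) auto
  also have "(\<lambda>j. (\<bar>geo A \<alpha> j\<bar> * B) powr \<rho> * geo (vol 1) (- real DIM('a)) j)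
      = geo ((\<bar>A\<bar> * B) powr \<rho> * vol 1) (\<alpha> * \<rho> + - real DIM('a))"
  proof
    fix j
    have "\<bar>geo A \<alpha> j\<bar> * B = geo (\<bar>A\<bar> * B) \<alpha> j" by (simp add: geo_def abs_mult)
    then show "(\<bar>geo A \<alpha> j\<bar> * B) powr \<rho> * geo (vol 1) (- real DIM('a)) j
      = geo ((\<bar>A\<bar> * B) powr \<rho> * vol 1) (\<alpha> * \<rho> + - real DIM('a)) j"
      using B by (simp add: geo_powr geo_mult)
  qed
  also have "(\<Sum>j. ennreal (geo ((\<bar>A\<bar> * B) powr \<rho> * vol 1) (\<alpha> * \<rho> + - real DIM('a)) j)) < \<infinity>"
    using assms(3) vol_nonneg[of 1] by (intro suminf_geo_finite) auto
  finally show ?thesis .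
qed

lemma bs_le:
  assumes "profile \<Phi>" "\<And>y. \<bar>\<Phi> y\<bar> \<le> B" "\<And>j. \<bar>al j\<bar> \<le> M"
  shows "\<bar>bs al \<Phi> x\<bar> \<le> M * B"
  using assms(1)
proof (cases rule: bs_cases[of \<Phi> x])
  case (near j z)
  then show ?thesis using assms by (auto simp: abs_mult intro!: mult_mono order_trans[OF abs_ge_zero assms(3)])
next
  case far
  have "0 \<le> B" "0 \<le> M" using assms(2)[of 0] assms(3)[of 0] by linarith+
  then show ?thesis using assms(1) far by simp
qed

lemma lp_mem_bs:
  assumes \<Phi>: "profile \<Phi>" and "0 < \<rho>" "\<alpha> * \<rho> < real DIM('a)" "\<Omega> \<in> sets lebesgue"
  shows "lp_mem (ereal \<rho>) \<Omega> (bs (geo A \<alpha>) \<Phi>)"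
  using assms by (intro lp_mem_realI bs_measurable nn_integral_bs_finite)

lemma lp_mem_bs_infty:
  assumes \<Phi>: "profile \<Phi>" and "\<alpha> \<le> 0"
  shows "lp_mem \<infinity> \<Omega> (bs (geo A \<alpha>) \<Phi>)"
proof -
  obtain B where B: "0 \<le> B" "\<And>y. \<bar>\<Phi> y\<bar> \<le> B" using profile_bounded[OF \<Phi>] by blast
  show ?thesis by (rule lp_mem_inftyI[OF bs_measurable[OF \<Phi>] bs_le[OF \<Phi> B(2) geo_le[OF assms(2)]]])
qed

lemma integrable_bs:
  assumes \<Phi>: "profile \<Phi>" and "\<alpha> < real DIM('a)"
  shows "integrable lborel (bs (geo A \<alpha>) \<Phi>)"
  using bs_measurable[OF \<Phi>] nn_integral_bs_finite[OF \<Phi>, of 1 \<alpha> A] assms(2)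
  by (intro integrableI_bounded) auto

end

section \<open>Weak derivatives of bump arrays\<close>

abbreviation trunc :: "nat \<Rightarrow> (nat \<Rightarrow> real) \<Rightarrow> nat \<Rightarrow> real" where
  "trunc n al \<equiv> (\<lambda>j. if j < n then al j else 0)"

context bump_array
begin

text \<open>The index \<open>j\<close> is the same for all \<open>n\<close>. Truncations therefore
  become stationary at every point and are dominated by the absolute value of the full
  array.\<close>

lemma bs_trunc_cases:
  assumes "profile \<Phi>"
  shows "\<exists>j. \<forall>n. bs (trunc n al) \<Phi> x = (if j < n then bs al \<Phi> x else 0)"
  using assms
proof (cases rule: bs_cases[of \<Phi> x])
  case (near j z)
  then show ?thesis using assms by (intro exI[of _ j]) simp
next
  case far
  then show ?thesis using assms by simp
qed

lemma bs_trunc_pd: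
  assumes "\<And>y. \<Phi> differentiable (at y)"
  shows "bs (trunc n al) \<Phi> differentiable (at x)"
    and "pd (bs (trunc n al) \<Phi>) i x = bs (trunc n (\<lambda>j. al j / r j)) (pd \<Phi> i) x"
proof -
  have s: "((\<lambda>x. \<Phi> ((x - z) /\<^sub>R r j)) has_derivative (\<lambda>v. frechet_derivative \<Phi> (at ((x - z) /\<^sub>R r j)) (v /\<^sub>R r j))) (at x)" for z j
    by (rule has_derivative_compose[OF _ frechet_derivative_works[THEN iffD1, OF assms]])
       (auto intro!: derivative_eq_intros)
  have *: "frechet_derivative \<Phi> (at y) (v /\<^sub>R c) = frechet_derivative \<Phi> (at y) v / c" for y v c
    using linear_cmul[OF linear_frechet_derivative[OF assms], of y "inverse c" v] by (simp add: divide_inverse_commute)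
  have d: "((\<lambda>x. \<Sum>j<n. \<Sum>z\<in>P j. al j * \<Phi> ((x - z) /\<^sub>R r j)) has_derivative
     (\<lambda>v. \<Sum>j<n. \<Sum>z\<in>P j. al j * (frechet_derivative \<Phi> (at ((x - z) /\<^sub>R r j)) v / r j))) (at x)"
    using s unfolding * by (intro has_derivative_sum has_derivative_mult_right)
  show "bs (trunc n al) \<Phi> differentiable (at x)"
    unfolding bs_trunc using d by (auto simp: differentiable_def)
  show "pd (bs (trunc n al) \<Phi>) i x = bs (trunc n (\<lambda>j. al j / r j)) (pd \<Phi> i) x"
    unfolding bs_trunc pd_eqI[OF d] by (simp add: pd_def)
qed

lemma set_integral_bs:
  assumes "profile \<Phi>" "K \<subseteq> \<Omega>" "\<psi> \<in> borel_measurable borel"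
  shows "(\<integral>x\<in>\<Omega>. bs al \<Phi> x * \<psi> x \<partial>lebesgue) = (\<integral>x. bs al \<Phi> x * \<psi> x \<partial>lborel)"
proof -
  have "(\<integral>x\<in>\<Omega>. bs al \<Phi> x * \<psi> x \<partial>lebesgue) = (\<integral>x. bs al \<Phi> x * \<psi> x \<partial>lebesgue)"
    unfolding set_lebesgue_integral_def using bs_outside[OF assms(1)] assms(2)
    by (intro Bochner_Integration.integral_cong) (auto simp: indicator_def subset_iff)
  also have "\<dots> = (\<integral>x. bs al \<Phi> x * \<psi> x \<partial>lborel)"
    using bs_measurable[OF assms(1)] assms(3) by (intro integral_completion) simp
  finally show ?thesis .
qed

lemma bs_trunc_integral_tendsto:
  assumes \<Phi>: "profile \<Phi>" and int: "integrable lborel (bs al \<Phi>)"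
    and \<psi>: "\<psi> \<in> borel_measurable borel" "\<And>x. \<bar>\<psi> x\<bar> \<le> B"
  shows "(\<lambda>n. \<integral>x. bs (trunc n al) \<Phi> x * \<psi> x \<partial>lborel) \<longlonglongrightarrow> (\<integral>x. bs al \<Phi> x * \<psi> x \<partial>lborel)"
proof (rule integral_dominated_convergence)
  show "integrable lborel (\<lambda>x. \<bar>bs al \<Phi> x\<bar> * B)" using int by auto
  show "(\<lambda>x. bs al \<Phi> x * \<psi> x) \<in> borel_measurable lborel" "(\<lambda>x. bs (trunc n al) \<Phi> x * \<psi> x) \<in> borel_measurable lborel" for n
    using bs_measurable[OF \<Phi>] \<psi>(1) by (auto intro!: borel_measurable_times)
  show "AE x in lborel. (\<lambda>n. bs (trunc n al) \<Phi> x * \<psi> x) \<longlonglongrightarrow> bs al \<Phi> x * \<psi> x"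
  proof (rule AE_I2)
    fix x
    obtain j where j: "\<And>n. bs (trunc n al) \<Phi> x = (if j < n then bs al \<Phi> x else 0)"
      using bs_trunc_cases[OF \<Phi>] by blast
    show "(\<lambda>n. bs (trunc n al) \<Phi> x * \<psi> x) \<longlonglongrightarrow> bs al \<Phi> x * \<psi> x"
      by (rule tendsto_eventually) (rule eventually_mono[OF eventually_gt_at_top[of j]], simp add: j)
  qed
  show "AE x in lborel. norm (bs (trunc n al) \<Phi> x * \<psi> x) \<le> \<bar>bs al \<Phi> x\<bar> * B" for n
  proof (rule AE_I2)
    fix x
    obtain j where j: "\<And>n. bs (trunc n al) \<Phi> x = (if j < n then bs al \<Phi> x else 0)"
      using bs_trunc_cases[OF \<Phi>] by blast
    have "0 \<le> B" using \<psi>(2)[of x] by linarith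
    then show "norm (bs (trunc n al) \<Phi> x * \<psi> x) \<le> \<bar>bs al \<Phi> x\<bar> * B"
      using \<psi>(2)[of x] by (auto simp: j abs_mult intro: mult_left_mono)
  qed
qed

lemma geo_div_r: "geo A \<alpha> j / r j = geo (A / lam) (\<alpha> + C) j"
  using lam by (simp add: geo_def powr_add powr_minus field_simps)

lemma loc_int_bs:
  assumes "profile \<Phi>" "\<alpha> < real DIM('a)"
  shows "loc_int \<Omega> (bs (geo A \<alpha>) \<Phi>)"
proof -
  have "integrable lebesgue (bs (geo A \<alpha>) \<Phi>)"
    using integrable_bs[OF assms] bs_measurable[OF assms(1)] by (simp add: integrable_completion)
  moreover have "K' \<in> sets lebesgue" if "compact K'" for K' :: "'a set"
    using that by (simp add: borel_compact sets_completionI_sets)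
  ultimately show ?thesis unfolding loc_int_def set_integrable_def
    using integrable_mult_indicator by blast
qed

text \<open>The full array may fail to be differentiable where bumps accumulate, so integration by
  parts is done for truncations. The condition \<alpha> + C < d makes the derivative array
  integrable, and dominated convergence removes the truncation.\<close>

lemma weak_deriv_bs:
  assumes \<Phi>: "profile \<Phi>" "profile (pd \<Phi> i)" "\<And>y. \<Phi> differentiable (at y)"
    and \<alpha>: "\<alpha> + C < real DIM('a)" and i: "i \<in> Basis" and \<Omega>: "K \<subseteq> \<Omega>"
  shows "weak_deriv \<Omega> i (bs (geo A \<alpha>) \<Phi>) (bs (geo (A / lam) (\<alpha> + C)) (pd \<Phi> i))"
  unfolding weak_deriv_def
proof (intro conjI allI impI)
  have \<alpha>': "\<alpha> < real DIM('a)" using \<alpha> C by linarith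
  show "loc_int \<Omega> (bs (geo A \<alpha>) \<Phi>)" "loc_int \<Omega> (bs (geo (A / lam) (\<alpha> + C)) (pd \<Phi> i))"
    by (rule loc_int_bs; use \<Phi> \<alpha> \<alpha>' in simp)+
  fix \<phi> :: "'a \<Rightarrow> real" assume "test_fn \<Omega> \<phi>"
  then obtain K' B where \<phi>: "compact K'" "\<And>x. x \<notin> K' \<Longrightarrow> \<phi> x = 0"
    "\<And>x. \<bar>\<phi> x\<bar> \<le> B" "\<And>x i. i \<in> Basis \<Longrightarrow> \<bar>pd \<phi> i x\<bar> \<le> B"
    "\<And>x. \<phi> differentiable (at x)" "\<phi> \<in> borel_measurable borel" "\<And>i. pd \<phi> i \<in> borel_measurable borel"
    by (rule test_fnE) blast
  let ?a = "geo A \<alpha>" and ?b = "geo (A / lam) (\<alpha> + C)"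
  have parts: "(\<integral>x. bs (trunc n ?a) \<Phi> x * pd \<phi> i x \<partial>lborel)
     = - (\<integral>x. bs (trunc n ?b) (pd \<Phi> i) x * \<phi> x \<partial>lborel)" for n
  proof -
    let ?g = "bs (trunc n ?a) \<Phi>"
    have e: "pd ?g i = bs (trunc n ?b) (pd \<Phi> i)"
      using bs_trunc_pd(2)[OF \<Phi>(3)] by (auto simp: geo_div_r fun_eq_iff cong: if_cong)
    obtain B1 where B1: "\<And>x. \<bar>?g x\<bar> \<le> B1"
      using continuous_compact_bounded[OF bs_trunc_continuous[OF \<Phi>(1)] compact_K bs_outside[OF \<Phi>(1)]] by blast
    obtain B2 where B2: "\<And>x. \<bar>pd ?g i x\<bar> \<le> B2"
      unfolding e using continuous_compact_bounded[OF bs_trunc_continuous[OF \<Phi>(2)] compact_K bs_outside[OF \<Phi>(2)]] by blast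
    have "pd ?g i \<in> borel_measurable borel" unfolding e by (rule bs_measurable[OF \<Phi>(2)])
    from integral_by_parts_pd[OF bs_trunc_pd(1)[OF \<Phi>(3)] B1 B2 this \<phi>(5,3) \<phi>(4)[OF i] \<phi>(7,1,2) i]
    show ?thesis unfolding e .
  qed
  have "(\<lambda>n. \<integral>x. bs (trunc n ?a) \<Phi> x * pd \<phi> i x \<partial>lborel) \<longlonglongrightarrow> (\<integral>x. bs ?a \<Phi> x * pd \<phi> i x \<partial>lborel)"
    by (rule bs_trunc_integral_tendsto[OF \<Phi>(1) integrable_bs[OF \<Phi>(1) \<alpha>'] \<phi>(7) \<phi>(4)[OF i]])
  moreover have "(\<lambda>n. \<integral>x. bs (trunc n ?b) (pd \<Phi> i) x * \<phi> x \<partial>lborel) \<longlonglongrightarrow> (\<integral>x. bs ?b (pd \<Phi> i) x * \<phi> x \<partial>lborel)"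
    by (rule bs_trunc_integral_tendsto[OF \<Phi>(2) integrable_bs[OF \<Phi>(2) \<alpha>] \<phi>(6,3)])
  ultimately have "(\<integral>x. bs ?a \<Phi> x * pd \<phi> i x \<partial>lborel) = - (\<integral>x. bs ?b (pd \<Phi> i) x * \<phi> x \<partial>lborel)"
    unfolding parts using LIMSEQ_unique tendsto_minus by blast
  then show "(\<integral>x\<in>\<Omega>. bs ?a \<Phi> x * pd \<phi> i x \<partial>lebesgue) = - (\<integral>x\<in>\<Omega>. bs ?b (pd \<Phi> i) x * \<phi> x \<partial>lebesgue)"
    by (simp add: set_integral_bs \<Phi> \<Omega> \<phi>)
qed

text \<open>Supplies the approximating sequence in \<open>sobolev1_0\<close>: a finite sum of scaled
  bumps stays in the generated class of smooth functions.\<close>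

lemma test_fn_bs_trunc:
  assumes "K \<subseteq> \<Omega>" shows "test_fn \<Omega> (bs (trunc n al) bump)"
  unfolding test_fn_def
proof (intro conjI exI[of _ K] allI impI)
  show "smooth_fn (bs (trunc n al) bump)"
    unfolding bs_trunc using finite_P
    by (intro flat_gen_smooth_fn flat_gen_sum flat_gen_mult flat_gen_const flat_gen_bump_scaled) auto
qed (use assms compact_K bs_outside[OF profile_bump] in auto)

text \<open>The remainder lives on the levels from \<open>n\<close> on, where the amplitudes are at
  most those of level \<open>n\<close>. It tends to 0 uniformly on a fixed compact set, hence in
  L_\<rho>.\<close>

lemma lp_nrm_bs_trunc_tendsto_0:
  assumes \<Phi>: "profile \<Phi>" and "\<alpha> < 0" "0 < \<rho>" "\<Omega> \<in> sets lebesgue"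
  shows "(\<lambda>n. lp_nrm (ereal \<rho>) \<Omega> (\<lambda>x. bs (geo A \<alpha>) \<Phi> x - bs (trunc n (geo A \<alpha>)) \<Phi> x)) \<longlonglongrightarrow> 0"
proof -
  obtain B where B: "0 \<le> B" "\<And>y. \<bar>\<Phi> y\<bar> \<le> B" using profile_bounded[OF \<Phi>] by blast
  let ?a = "geo A \<alpha>"
  have bd: "\<bar>bs ?a \<Phi> x - bs (trunc n ?a) \<Phi> x\<bar> \<le> geo (\<bar>A\<bar> * B) \<alpha> n * indicator K x" for n x
    using \<Phi>
  proof (cases rule: bs_cases[of \<Phi> x])
    case (near j z)
    have "x \<in> K" using near(3) V_subset[of 1 j] by auto
    moreover have "\<bar>geo A \<alpha> j\<bar> * \<bar>\<Phi> ((x - z) /\<^sub>R r j)\<bar> \<le> geo (\<bar>A\<bar> * B) \<alpha> n" if "n \<le> j"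
    proof -
      have "\<bar>geo A \<alpha> j\<bar> \<le> geo \<bar>A\<bar> \<alpha> n"
        unfolding geo_def abs_mult using that assms(2)
        by (intro mult_mono) (auto intro!: powr_mono mult_left_mono_neg)
      then have "\<bar>geo A \<alpha> j\<bar> * \<bar>\<Phi> ((x - z) /\<^sub>R r j)\<bar> \<le> geo \<bar>A\<bar> \<alpha> n * B"
        using B by (intro mult_mono) (auto simp: geo_def)
      then show ?thesis by (simp add: geo_def mult_ac)
    qed
    moreover have "0 \<le> geo (\<bar>A\<bar> * B) \<alpha> n" using B by (simp add: geo_def)
    ultimately show ?thesis using near(4)[OF \<Phi>] by (auto simp: abs_mult)
  next
    case far
    then show ?thesis using \<Phi> B by (simp add: geo_def indicator_def)
  qed
  have le: "lp_nrm (ereal \<rho>) \<Omega> (\<lambda>x. bs ?a \<Phi> x - bs (trunc n ?a) \<Phi> x)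
     \<le> ennreal (geo (\<bar>A\<bar> * B) \<alpha> n * measure lborel K powr (1 / \<rho>))" for n
    using B by (intro lp_nrm_compact_le bd compact_K assms) (auto simp: geo_def)
  have "geo (\<bar>A\<bar> * B) \<alpha> \<longlonglongrightarrow> 0" by (rule summable_LIMSEQ_zero[OF summable_geo[OF assms(2)]])
  then have "(\<lambda>n. ennreal (geo (\<bar>A\<bar> * B) \<alpha> n * measure lborel K powr (1 / \<rho>))) \<longlonglongrightarrow> ennreal (0 * measure lborel K powr (1 / \<rho>))"
    by (intro tendsto_ennrealI tendsto_mult tendsto_const)
  then have lim: "(\<lambda>n. ennreal (geo (\<bar>A\<bar> * B) \<alpha> n * measure lborel K powr (1 / \<rho>))) \<longlonglongrightarrow> 0" by simp
  show ?thesis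
    by (rule tendsto_sandwich[OF _ _ tendsto_const lim]) (auto intro!: always_eventually le)
qed

end

text \<open>Instead of Hoelder's inequality: \<open>t \<le> 1 + t powr p\<close> for \<open>t = \<bar>g\<bar> / N\<close>, integrated over \<open>K\<close>.\<close>
lemma integral_abs_le_lp_nrm:
  fixes g :: "'a::euclidean_space \<Rightarrow> real"
  assumes g: "g \<in> borel_measurable borel" "\<And>x. \<bar>g x\<bar> \<le> B" "compact K'" "K' \<subseteq> \<Omega>" "\<And>x. x \<notin> K' \<Longrightarrow> g x = 0"
    and K: "compact K" and p: "1 \<le> p" and \<Omega>: "\<Omega> \<in> sets lebesgue"
  shows "(\<integral>x. \<bar>g x\<bar> * indicator K x \<partial>lborel) \<le> (measure lborel K + 1) * enn2real (lp_nrm (ereal p) \<Omega> g)"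
proof -
  have B0: "0 \<le> B" using g(2)[of undefined] by linarith
  have ip: "integrable lborel (\<lambda>x. \<bar>g x\<bar> powr p)"
  proof (rule integrable_bounded_compact[of _ "B powr p" K'])
    show "(\<lambda>x. \<bar>g x\<bar> powr p) \<in> borel_measurable borel" using g(1) by simp
    show "\<bar>\<bar>g x\<bar> powr p\<bar> \<le> B powr p" for x using g(2)[of x] p by (simp add: powr_mono2)
  qed (use g p in auto)
  define I where "I = (\<integral>x. \<bar>g x\<bar> powr p \<partial>lborel)"
  have I0: "0 \<le> I" unfolding I_def by (rule Bochner_Integration.integral_nonneg) auto
  have "(\<integral>\<^sup>+x. ennreal (\<bar>g x\<bar> powr p) \<partial>lebesgue_on \<Omega>) = (\<integral>\<^sup>+x. ennreal (\<bar>g x\<bar> powr p) * indicator \<Omega> x \<partial>lebesgue)"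
    using \<Omega> by (intro nn_integral_restrict_space) auto
  also have "\<dots> = (\<integral>\<^sup>+x. ennreal (\<bar>g x\<bar> powr p) \<partial>lebesgue)"
    using g(4,5) p by (intro nn_integral_cong) (auto simp: indicator_def subset_iff)
  also have "\<dots> = ennreal I"
    unfolding nn_integral_completion I_def using ip by (intro nn_integral_eq_integral) auto
  finally have nrm: "enn2real (lp_nrm (ereal p) \<Omega> g) = I powr (1 / p)"
    using I0 by (simp add: lp_nrm_real enn_rpow_ennreal)
  define N where "N = I powr (1 / p)"
  \<comment> \<open>\<open>N\<close> itself may be 0, so the estimate is proved for every larger
    \<open>M\<close>; the excess is removed at the end by letting it tend to 0.\<close>
  have *: "(\<integral>x. \<bar>g x\<bar> * indicator K x \<partial>lborel) \<le> M * (measure lborel K + 1)" if "N < M" for M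
  proof -
    have M: "0 < M" using that unfolding N_def by (meson le_less_trans powr_ge_zero)
    have "I = N powr p" using I0 p unfolding N_def by (simp add: powr_powr)
    also have "\<dots> \<le> M powr p" using that p by (intro powr_mono2) (auto simp: N_def)
    finally have IM: "I / M powr p \<le> 1" using M by simp
    have t: "t \<le> 1 + t powr p" if "0 \<le> t" for t :: real
    proof (cases "t \<le> 1")
      case True then show ?thesis using powr_ge_zero[of t p] by linarith
    next
      case False
      then show ?thesis using powr_mono[of 1 p t] p by auto
    qed
    have iK: "integrable lborel (indicator K :: 'a \<Rightarrow> real)"
      using K emeasure_compact_finite[OF K] by (intro integrable_real_indicator) (auto simp: borel_compact)
    have "(\<integral>x. \<bar>g x\<bar> * indicator K x \<partial>lborel) \<le> (\<integral>x. M * (indicator K x + \<bar>g x\<bar> powr p / M powr p) \<partial>lborel)"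
    proof (rule integral_mono)
      show "integrable lborel (\<lambda>x. \<bar>g x\<bar> * indicator K x)"
      proof (rule integrable_bounded_compact[of _ B K])
        show "(\<lambda>x. \<bar>g x\<bar> * indicator K x) \<in> borel_measurable borel"
          using g(1) borel_compact[OF K] by simp
      qed (use g(2) B0 K in \<open>auto simp: indicator_def\<close>)
      show "integrable lborel (\<lambda>x. M * (indicator K x + \<bar>g x\<bar> powr p / M powr p))"
        using iK ip by (intro integrable_mult_right Bochner_Integration.integrable_add) auto
      fix x
      have "\<bar>g x\<bar> = M * (\<bar>g x\<bar> / M)" using M by simp
      also have "\<dots> \<le> M * (1 + \<bar>g x\<bar> powr p / M powr p)"
        using t[of "\<bar>g x\<bar> / M"] M by (intro mult_left_mono) (auto simp: powr_divide)
      finally show "\<bar>g x\<bar> * indicator K x \<le> M * (indicator K x + \<bar>g x\<bar> powr p / M powr p)"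
        using M by (auto simp: indicator_def)
    qed
    also have "\<dots> = M * (measure lborel K + I / M powr p)"
      using iK ip K by (simp add: I_def borel_compact)
    also have "\<dots> \<le> M * (measure lborel K + 1)" using M IM by simp
    finally show ?thesis .
  qed
  have "(\<integral>x. \<bar>g x\<bar> * indicator K x \<partial>lborel) \<le> (measure lborel K + 1) * N + e" if "0 < e" for e
  proof -
    have m: "0 < measure lborel K + 1" by (smt (verit) measure_nonneg)
    have "(\<integral>x. \<bar>g x\<bar> * indicator K x \<partial>lborel) \<le> (N + e / (measure lborel K + 1)) * (measure lborel K + 1)"
      using that m by (intro *) simp
    also have "\<dots> = (measure lborel K + 1) * N + e" using m by (subst distrib_right) (simp add: mult.commute)
    finally show ?thesis .
  qed
  then show ?thesis unfolding nrm N_def[symmetric] by (rule field_le_epsilon)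
qed

section \<open>The weak solution\<close>

text \<open>\<open>\<alpha>\<close> is the growth exponent of the height of \<open>f\<close>, later
  d / \<mu>. The condition \<alpha> < d makes \<open>f\<close> integrable, and \<alpha> < C makes
  the amplitudes of flux and gradient decay.\<close>

locale plap_array = bump_array P K lam kap C
  for P :: "nat \<Rightarrow> 'a::euclidean_space set" and K lam kap C +
  fixes p \<alpha> :: real and \<Omega> :: "'a set"
  assumes p: "2 < p" and \<alpha>: "0 \<le> \<alpha>" "\<alpha> < real DIM('a)" "\<alpha> < C"
    and K_sub: "K \<subseteq> \<Omega>" and \<Omega>_meas: "\<Omega> \<in> sets lebesgue"
begin

definition "\<sigma> = 1 / (p - 1)"

text \<open>The gradient has exponent (\<alpha> - C) \<sigma>, so that its (p - 1)-th power has the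
  exponent \<alpha> - C of the flux; \<open>u\<close> carries one more factor of the radius, which
  subtracts \<open>C\<close>.\<close>

abbreviation "\<kappa> \<equiv> (\<alpha> - C) * \<sigma> - C"

definition u :: "'a \<Rightarrow> real" where
  "u = bs (geo (lam powr \<sigma> * lam) \<kappa>) bump"

definition G :: "'a \<Rightarrow> 'a" where
  "G x = (\<Sum>i\<in>Basis. bs (geo (lam powr \<sigma>) ((\<alpha> - C) * \<sigma>)) (pd bump i) x *\<^sub>R i)"

definition f :: "'a \<Rightarrow> real" where
  "f = bs (geo 1 \<alpha>) (\<lambda>y. - (\<Sum>i\<in>Basis. pd (flux p i) i y))"

lemma \<sigma>_pos: "0 < \<sigma>" using p by (simp add: \<sigma>_def)

lemma \<sigma>_less_1: "\<sigma> < 1" using p by (simp add: \<sigma>_def)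

lemma exponent_neg: "(\<alpha> - C) * \<sigma> < 0" using \<alpha> \<sigma>_pos by (simp add: mult_neg_pos)

lemma G_inner: "i \<in> Basis \<Longrightarrow> G x \<bullet> i = bs (geo (lam powr \<sigma>) ((\<alpha> - C) * \<sigma>)) (pd bump i) x"
  by (simp add: G_def inner_sum_left inner_Basis if_distrib cong: if_cong)

lemma profile_f: "profile (\<lambda>y::'a. - (\<Sum>i\<in>Basis. pd (flux p i) i y))"
  by (intro profile_uminus profile_sum profile_pd_flux p)

lemma weak_gradient_G: "weak_gradient \<Omega> u G"
  unfolding weak_gradient_def
proof
  fix i :: 'a assume i: "i \<in> Basis"
  have "\<kappa> + C < real DIM('a)" using exponent_neg by simp
  from weak_deriv_bs[OF profile_bump profile_pd_bump flat_gen_differentiable[OF flat_gen_bump] this i K_sub,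
      of "lam powr \<sigma> * lam"]
  show "weak_deriv \<Omega> i u (\<lambda>x. G x \<bullet> i)"
    using i lam by (simp add: G_inner u_def)
qed

text \<open>One bump at most is visible at \<open>x\<close>, and A is homogeneous of degree p - 1.
  Since \<sigma> (p - 1) = 1, the gradient amplitude raised to the power p - 1 is
  \<open>geo lam (\<alpha> - C)\<close>.\<close>

lemma pA_G: "pA p (G x) \<bullet> i = bs (geo lam (\<alpha> - C)) (flux p i) x"
  using profile_bump
proof (cases rule: bs_cases[of bump x])
  case (near j z)
  let ?b = "geo (lam powr \<sigma>) ((\<alpha> - C) * \<sigma>) j"
  have b: "0 < ?b" using lam by (intro geo_pos) auto
  have G: "G x = ?b *\<^sub>R grad_bump ((x - z) /\<^sub>R r j)"
    unfolding G_def grad_bump_def near(4)[OF profile_pd_bump] by (simp add: scaleR_sum_right)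
  have s: "\<sigma> * (p - 1) = 1" using p by (simp add: \<sigma>_def)
  have "pA p (G x) \<bullet> i = ?b powr (p - 2) * ?b * flux p i ((x - z) /\<^sub>R r j)"
    unfolding G flux_def pA_def using b by (simp add: powr_mult)
  also have "?b powr (p - 2) * ?b = ?b powr (p - 1)"
    using b powr_add[of ?b "p - 2" 1] by simp
  also have "\<dots> = geo lam (\<alpha> - C) j"
    using lam s by (simp add: geo_powr powr_powr mult.assoc)
  finally show ?thesis using near(4)[OF profile_flux[OF p]] by simp
next
  case far
  then show ?thesis
    by (simp add: G_def pA_def far(2)[OF profile_pd_bump] far(2)[OF profile_flux[OF p]])
qed

text \<open>The constant \<open>lam\<close> and the shift by \<open>C\<close> cancel against the
  radius, which leaves the amplitude \<open>geo 1 \<alpha>\<close> of \<open>f\<close>.\<close>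

lemma weak_deriv_flux:
  assumes "i \<in> Basis" "k \<in> Basis"
  shows "weak_deriv \<Omega> k (\<lambda>x. pA p (G x) \<bullet> i) (bs (geo 1 \<alpha>) (pd (flux p i) k))"
  using weak_deriv_bs[OF profile_flux[OF p] profile_pd_flux[OF p assms(1)] flux_differentiable[OF p assms(1)] _ assms(2) K_sub,
      of "\<alpha> - C" lam] \<alpha> lam by (simp add: pA_G)

lemma f_eq_sum: "f x = - (\<Sum>i\<in>Basis. bs (geo 1 \<alpha>) (pd (flux p i) i) x)"
  using profile_bump
proof (cases rule: bs_cases[of bump x])
  case (near j z)
  then show ?thesis unfolding f_def
    by (simp add: near(4)[OF profile_f] near(4)[OF profile_pd_flux[OF p]] sum_distrib_left)
next
  case far
  then show ?thesis unfolding f_def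
    by (simp add: far(2)[OF profile_f] far(2)[OF profile_pd_flux[OF p]])
qed

lemma integrable_bs_times:
  assumes "profile \<Phi>" "\<beta> < real DIM('a)" "\<psi> \<in> borel_measurable borel" "\<And>x. \<bar>\<psi> x\<bar> \<le> B"
  shows "integrable lborel (\<lambda>x. bs (geo A \<beta>) \<Phi> x * \<psi> x)"
proof (rule Bochner_Integration.integrable_bound)
  show "integrable lborel (\<lambda>x. bs (geo A \<beta>) \<Phi> x * B)"
    using integrable_bs[OF assms(1,2)] by auto
  show "AE x in lborel. norm (bs (geo A \<beta>) \<Phi> x * \<psi> x) \<le> norm (bs (geo A \<beta>) \<Phi> x * B)"
    using assms(4) by (intro AE_I2) (auto simp: abs_mult intro!: mult_left_mono intro: order_trans[OF _ abs_ge_self])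
qed (use bs_measurable[OF assms(1)] assms(3) in \<open>auto intro!: borel_measurable_times\<close>)

text \<open>The second identity moves the derivative onto the test function. It expresses a possibly
  unbounded \<open>f\<close> through the bounded flux and is the starting point of the dual norm
  estimate.\<close>

lemma weak_equation:
  assumes "test_fn \<Omega> \<psi>"
  shows "(\<integral>x\<in>\<Omega>. (\<Sum>i\<in>Basis. (pA p (G x) \<bullet> i) * pd \<psi> i x) \<partial>lebesgue) = (\<integral>x\<in>\<Omega>. f x * \<psi> x \<partial>lebesgue)"
    and "(\<integral>x\<in>\<Omega>. f x * \<psi> x \<partial>lebesgue) = (\<Sum>i\<in>Basis. \<integral>x. bs (geo lam (\<alpha> - C)) (flux p i) x * pd \<psi> i x \<partial>lborel)"
proof -
  obtain B where \<psi>: "\<And>x. \<bar>\<psi> x\<bar> \<le> B" "\<And>x i. i \<in> Basis \<Longrightarrow> \<bar>pd \<psi> i x\<bar> \<le> B"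
    "\<psi> \<in> borel_measurable borel" "\<And>i. pd \<psi> i \<in> borel_measurable borel"
    using assms by (rule test_fnE) blast
  have \<alpha>C: "\<alpha> - C < real DIM('a)" using \<alpha> by simp
  let ?F = "\<lambda>i. bs (geo lam (\<alpha> - C)) (flux p i)" and ?g = "\<lambda>i. bs (geo 1 \<alpha>) (pd (flux p i) i)"
  have wd: "(\<integral>x. ?F i x * pd \<psi> i x \<partial>lborel) = - (\<integral>x. ?g i x * \<psi> x \<partial>lborel)" if "i \<in> Basis" for i
  proof -
    have "(\<integral>x\<in>\<Omega>. ?F i x * pd \<psi> i x \<partial>lebesgue) = - (\<integral>x\<in>\<Omega>. ?g i x * \<psi> x \<partial>lebesgue)"
      using weak_deriv_flux[OF that that] assms unfolding weak_deriv_def pA_G by blast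
    then show ?thesis
      unfolding set_integral_bs[OF profile_flux[OF p] K_sub \<psi>(4)]
        set_integral_bs[OF profile_pd_flux[OF p that] K_sub \<psi>(3)] .
  qed
  have ce: "(\<integral>x\<in>\<Omega>. h x \<partial>lebesgue) = (\<integral>x. h x \<partial>lborel)"
    if "\<And>x. x \<notin> K \<Longrightarrow> h x = 0" "h \<in> borel_measurable borel" for h :: "'a \<Rightarrow> real"
  proof -
    have "(\<integral>x\<in>\<Omega>. h x \<partial>lebesgue) = (\<integral>x. h x \<partial>lebesgue)"
      unfolding set_lebesgue_integral_def using that(1) K_sub
      by (intro Bochner_Integration.integral_cong) (auto simp: indicator_def subset_iff)
    then show ?thesis using that(2) by (simp add: integral_completion)
  qed
  have m: "?F i \<in> borel_measurable borel" "f \<in> borel_measurable borel" for i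
    unfolding f_def by (intro bs_measurable profile_flux[OF p] profile_f)+
  have "(\<integral>x\<in>\<Omega>. (\<Sum>i\<in>Basis. (pA p (G x) \<bullet> i) * pd \<psi> i x) \<partial>lebesgue) = (\<integral>x. (\<Sum>i\<in>Basis. ?F i x * pd \<psi> i x) \<partial>lborel)"
    unfolding pA_G using m \<psi> by (intro ce borel_measurable_sum borel_measurable_times)
      (auto simp: bs_outside profile_flux[OF p])
  also have "\<dots> = (\<Sum>i\<in>Basis. \<integral>x. ?F i x * pd \<psi> i x \<partial>lborel)"
    by (intro Bochner_Integration.integral_sum integrable_bs_times[OF profile_flux[OF p] \<alpha>C \<psi>(4,2)])
  finally have 1: "(\<integral>x\<in>\<Omega>. (\<Sum>i\<in>Basis. (pA p (G x) \<bullet> i) * pd \<psi> i x) \<partial>lebesgue) = (\<Sum>i\<in>Basis. \<integral>x. ?F i x * pd \<psi> i x \<partial>lborel)" .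
  have "(\<integral>x\<in>\<Omega>. f x * \<psi> x \<partial>lebesgue) = (\<integral>x. f x * \<psi> x \<partial>lborel)"
    unfolding f_def by (rule set_integral_bs[OF profile_f K_sub \<psi>(3)])
  also have "\<dots> = (\<integral>x. - (\<Sum>i\<in>Basis. ?g i x * \<psi> x) \<partial>lborel)"
    by (simp add: f_eq_sum sum_distrib_right)
  also have "\<dots> = - (\<integral>x. (\<Sum>i\<in>Basis. ?g i x * \<psi> x) \<partial>lborel)" by simp
  also have "(\<integral>x. (\<Sum>i\<in>Basis. ?g i x * \<psi> x) \<partial>lborel) = (\<Sum>i\<in>Basis. \<integral>x. ?g i x * \<psi> x \<partial>lborel)"
    by (intro Bochner_Integration.integral_sum integrable_bs_times[OF profile_pd_flux[OF p] \<alpha>(2) \<psi>(3,1)])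
  also have "- \<dots> = (\<Sum>i\<in>Basis. \<integral>x. ?F i x * pd \<psi> i x \<partial>lborel)"
    by (simp add: wd sum_negf)
  finally show 2: "(\<integral>x\<in>\<Omega>. f x * \<psi> x \<partial>lebesgue) = (\<Sum>i\<in>Basis. \<integral>x. ?F i x * pd \<psi> i x \<partial>lborel)" .
  show "(\<integral>x\<in>\<Omega>. (\<Sum>i\<in>Basis. (pA p (G x) \<bullet> i) * pd \<psi> i x) \<partial>lebesgue) = (\<integral>x\<in>\<Omega>. f x * \<psi> x \<partial>lebesgue)"
    unfolding 1 2 ..
qed

lemma DIM_pos_real: "0 < real DIM('a)" by simp

lemma lp_mem_bs_nonpos:
  assumes "profile \<Phi>" "\<beta> \<le> 0" "0 < \<rho>" shows "lp_mem (ereal \<rho>) \<Omega> (bs (geo A \<beta>) \<Phi>)"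
proof (rule lp_mem_bs[OF assms(1,3) _ \<Omega>_meas])
  have "\<beta> * \<rho> \<le> 0" using assms by (simp add: mult_nonpos_nonneg)
  then show "\<beta> * \<rho> < real DIM('a)" using DIM_pos_real by linarith
qed

lemma sobolev1_0_u: "sobolev1_0 (ereal p) \<Omega> u"
  unfolding sobolev1_0_def
proof (intro conjI exI[of _ G] exI[of _ "\<lambda>n. bs (trunc n (geo (lam powr \<sigma> * lam) \<kappa>)) bump"] ballI allI)
  have n1: "\<kappa> < 0" using exponent_neg C by linarith
  show "lp_mem (ereal p) \<Omega> u" unfolding u_def using n1 p by (intro lp_mem_bs_nonpos profile_bump) auto
  show "weak_gradient \<Omega> u G" by (rule weak_gradient_G)
  show "lp_mem (ereal p) \<Omega> (\<lambda>x. G x \<bullet> i)" if "i \<in> Basis" for i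
    using that exponent_neg p lp_mem_bs_nonpos[OF profile_pd_bump] by (simp add: G_inner)
  show "test_fn \<Omega> (bs (trunc n (geo (lam powr \<sigma> * lam) \<kappa>)) bump)" for n
    by (rule test_fn_bs_trunc[OF K_sub])
  show "(\<lambda>n. lp_nrm (ereal p) \<Omega> (\<lambda>x. u x - bs (trunc n (geo (lam powr \<sigma> * lam) \<kappa>)) bump x)) \<longlonglongrightarrow> 0"
    unfolding u_def using n1 p by (intro lp_nrm_bs_trunc_tendsto_0 profile_bump \<Omega>_meas) auto
  fix i :: 'a assume i: "i \<in> Basis"
  have e: "pd (bs (trunc n (geo (lam powr \<sigma> * lam) \<kappa>)) bump) i
     = bs (trunc n (geo (lam powr \<sigma>) ((\<alpha> - C) * \<sigma>))) (pd bump i)" for n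
    using bs_trunc_pd(2)[OF flat_gen_differentiable[OF flat_gen_bump]] lam
    by (auto simp: geo_div_r fun_eq_iff cong: if_cong)
  show "(\<lambda>n. lp_nrm (ereal p) \<Omega> (\<lambda>x. G x \<bullet> i - pd (bs (trunc n (geo (lam powr \<sigma> * lam) \<kappa>)) bump) i x)) \<longlonglongrightarrow> 0"
    unfolding e G_inner[OF i] using exponent_neg p by (intro lp_nrm_bs_trunc_tendsto_0 profile_pd_bump \<Omega>_meas) auto
qed

lemma weak_sol: "weak_sol_plap p \<Omega> u G f"
  unfolding weak_sol_plap_def using sobolev1_0_u weak_gradient_G weak_equation(1) by blast

lemma compact_supp: "compact_supp_in \<Omega> u" "compact_supp_in \<Omega> f"
  unfolding compact_supp_in_def u_def f_def
  using compact_K K_sub bs_outside[OF profile_bump] bs_outside[OF profile_f] by blast+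

text \<open>Since \<alpha> < C, the flux is bounded. Testing \<open>f\<close> thus costs only the
  L_1 norm of the gradient of \<psi> over the compact set \<open>K\<close>, which
  \<open>integral_abs_le_lp_nrm\<close> controls by the L_p norm.\<close>

lemma dual_sobolev_f: "dual_sobolev (ereal p) \<Omega> f"
  unfolding dual_sobolev_def
proof (intro conjI)
  show "loc_int \<Omega> f" unfolding f_def by (rule loc_int_bs[OF profile_f \<alpha>(2)])
  have "\<exists>M. \<forall>x. \<bar>bs (geo lam (\<alpha> - C)) (flux p i) x\<bar> \<le> M" for i
  proof -
    obtain B where B: "0 \<le> B" "\<And>y. \<bar>flux p i y\<bar> \<le> B" using profile_bounded[OF profile_flux[OF p]] by blast
    have "\<alpha> - C \<le> 0" using \<alpha>(3) by simp
    then show ?thesis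
      using bs_le[where al="geo lam (\<alpha> - C)", OF profile_flux[OF p] B(2) geo_le] by blast
  qed
  then obtain M where M: "\<And>i x. \<bar>bs (geo lam (\<alpha> - C)) (flux p i) x\<bar> \<le> M i" by metis
  define M' where "M' = (\<Sum>i\<in>Basis. M i)"
  have M0: "0 \<le> M i" for i using M[of i undefined] by linarith
  have M': "M i \<le> M'" if "i \<in> Basis" for i using that M0 unfolding M'_def by (intro member_le_sum) auto
  have M'0: "0 \<le> M'" unfolding M'_def by (intro sum_nonneg M0)
  show "\<exists>c. \<forall>\<psi>. test_fn \<Omega> \<psi> \<longrightarrow> \<bar>\<integral>x\<in>\<Omega>. f x * \<psi> x \<partial>lebesgue\<bar> \<le> c * w1_norm (ereal p) \<Omega> \<psi>"
  proof (intro exI allI impI)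
    fix \<psi> :: "'a \<Rightarrow> real" assume t: "test_fn \<Omega> \<psi>"
    then obtain B K' where \<psi>: "\<And>x i. i \<in> Basis \<Longrightarrow> \<bar>pd \<psi> i x\<bar> \<le> B"
      "\<And>i. pd \<psi> i \<in> borel_measurable borel" "compact K'" "K' \<subseteq> \<Omega>" "\<And>i x. x \<notin> K' \<Longrightarrow> pd \<psi> i x = 0"
      by (rule test_fnE) blast
    have B0: "0 \<le> B" using \<psi>(1)[OF SOME_Basis, of undefined] by linarith
    have one: "\<bar>\<integral>x. bs (geo lam (\<alpha> - C)) (flux p i) x * pd \<psi> i x \<partial>lborel\<bar>
        \<le> M' * ((measure lborel K + 1) * enn2real (lp_nrm (ereal p) \<Omega> (pd \<psi> i)))" if i: "i \<in> Basis" for i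
    proof -
      have iK: "integrable lborel (\<lambda>x. M' * (\<bar>pd \<psi> i x\<bar> * indicator K x))"
      proof (rule integrable_mult_right, rule integrable_bounded_compact[of _ B K])
        show "(\<lambda>x. \<bar>pd \<psi> i x\<bar> * indicator K x) \<in> borel_measurable borel"
          using \<psi>(2)[of i] borel_compact[OF compact_K] by simp
      qed (use \<psi>(1)[OF i] B0 compact_K in \<open>auto simp: indicator_def\<close>)
      have "\<bar>\<integral>x. bs (geo lam (\<alpha> - C)) (flux p i) x * pd \<psi> i x \<partial>lborel\<bar>
        \<le> (\<integral>x. M' * (\<bar>pd \<psi> i x\<bar> * indicator K x) \<partial>lborel)"
        unfolding real_norm_def[symmetric]
      proof (rule Bochner_Integration.integral_norm_bound_integral)
        show "integrable lborel (\<lambda>x. bs (geo lam (\<alpha> - C)) (flux p i) x * pd \<psi> i x)"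
          using \<alpha> by (intro integrable_bs_times[OF profile_flux[OF p] _ \<psi>(2) \<psi>(1)[OF i]]) auto
        show "integrable lborel (\<lambda>x. M' * (norm (pd \<psi> i x) * indicator K x))" using iK by simp
        fix x
        show "norm (bs (geo lam (\<alpha> - C)) (flux p i) x * pd \<psi> i x) \<le> M' * (norm (pd \<psi> i x) * indicator K x)"
          using order_trans[OF M M'[OF i], of x] bs_outside[OF profile_flux[OF p], of x]
          by (cases "x \<in> K") (auto simp: abs_mult intro: mult_right_mono)
      qed
      also have "\<dots> = M' * (\<integral>x. \<bar>pd \<psi> i x\<bar> * indicator K x \<partial>lborel)" by simp
      also have "\<dots> \<le> M' * ((measure lborel K + 1) * enn2real (lp_nrm (ereal p) \<Omega> (pd \<psi> i)))"
        using p by (intro mult_left_mono M'0 integral_abs_le_lp_nrm[OF \<psi>(2) \<psi>(1)[OF i] \<psi>(3,4) \<psi>(5) compact_K _ \<Omega>_meas]) auto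
      finally show ?thesis .
    qed
    have "\<bar>\<integral>x\<in>\<Omega>. f x * \<psi> x \<partial>lebesgue\<bar> \<le> (\<Sum>i\<in>Basis. M' * ((measure lborel K + 1) * enn2real (lp_nrm (ereal p) \<Omega> (pd \<psi> i))))"
      unfolding weak_equation(2)[OF t] by (rule order_trans[OF sum_abs sum_mono[OF one]])
    also have "\<dots> = M' * (measure lborel K + 1) * (\<Sum>i\<in>Basis. enn2real (lp_nrm (ereal p) \<Omega> (pd \<psi> i)))"
      by (simp add: sum_distrib_left mult.assoc)
    also have "\<dots> \<le> M' * (measure lborel K + 1) * w1_norm (ereal p) \<Omega> \<psi>"
      unfolding w1_norm_def using M'0 by (intro mult_left_mono) auto
    finally show "\<bar>\<integral>x\<in>\<Omega>. f x * \<psi> x \<partial>lebesgue\<bar> \<le> M' * (measure lborel K + 1) * w1_norm (ereal p) \<Omega> \<psi>" .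
  qed
qed

text \<open>The first derivatives of the flux have amplitude 2^(\<alpha> j), and \<alpha> \<rho> < d
  is the summability condition for their \<rho>-th powers; the flux itself has decaying
  amplitudes.\<close>

lemma sobolev1_flux:
  assumes \<rho>: "1 < \<rho>" "\<alpha> * \<rho> < real DIM('a)" and i: "i \<in> Basis"
  shows "sobolev1 (ereal \<rho>) \<Omega> (\<lambda>x. pA p (G x) \<bullet> i)"
  unfolding sobolev1_def
proof (intro conjI exI)
  show "lp_mem (ereal \<rho>) \<Omega> (\<lambda>x. pA p (G x) \<bullet> i)"
    unfolding pA_G using \<rho> \<alpha> by (intro lp_mem_bs_nonpos profile_flux p) auto
  let ?H = "\<lambda>x. \<Sum>k\<in>Basis. bs (geo 1 \<alpha>) (pd (flux p i) k) x *\<^sub>R k"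
  have H: "?H x \<bullet> k = bs (geo 1 \<alpha>) (pd (flux p i) k) x" if "k \<in> Basis" for k x
    using that by (simp add: inner_sum_left inner_Basis if_distrib cong: if_cong)
  show "weak_gradient \<Omega> (\<lambda>x. pA p (G x) \<bullet> i) ?H"
    unfolding weak_gradient_def using weak_deriv_flux[OF i] by (simp only: H cong: ball_cong) blast
  show "\<forall>k\<in>Basis. lp_mem (ereal \<rho>) \<Omega> (\<lambda>x. ?H x \<bullet> k)"
    using lp_mem_bs[OF profile_pd_flux[OF p i] _ \<rho>(2) \<Omega>_meas] \<rho> by (simp only: H cong: ball_cong) auto
qed

end

section \<open>Besov regularity\<close>

lemma fdiff_2: "fdiff 2 h f x = f x - 2 * f (x + h) + f (x + 2 *\<^sub>R h)"
  by (simp add: fdiff_def numeral_2_eq_2)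

text \<open>With g(s) the value of the bump at y + s h, the second difference is g(2) - 2 g(1) +
  g(0). The mean value theorem, applied to g(s + 1) - g(s) and then to g', turns it into a value of
  g'', which is quadratic in \<open>h\<close>.\<close>

lemma fdiff_2_bump_le:
  "\<exists>D\<ge>0. \<forall>h y::'a::euclidean_space. \<bar>fdiff 2 h bump y\<bar> \<le> D * norm h ^ 2"
proof -
  have "\<exists>B. \<forall>y::'a. \<bar>pd (pd bump i) k y\<bar> \<le> B" for i k :: 'a
    using profile_bounded[OF profile_pd_pd_bump[of i k]] by metis
  then obtain B where B: "\<And>i k y::'a. \<bar>pd (pd bump i) k y\<bar> \<le> B i k" by metis
  have B0: "0 \<le> B i k" for i k using B[of i k undefined] by linarith
  define D where "D = (\<Sum>i\<in>Basis. \<Sum>k\<in>Basis. B i k)"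
  have D0: "0 \<le> D" unfolding D_def by (intro sum_nonneg B0)
  have "\<bar>fdiff 2 h bump y\<bar> \<le> D * norm h ^ 2" for h y :: 'a
  proof -
    let ?g = "\<lambda>s. bump (y + s *\<^sub>R h)"
    let ?g' = "\<lambda>s. \<Sum>i\<in>Basis. (h \<bullet> i) * pd bump i (y + s *\<^sub>R h)"
    let ?g'' = "\<lambda>s. \<Sum>i\<in>Basis. (h \<bullet> i) * (\<Sum>k\<in>Basis. (h \<bullet> k) * pd (pd bump i) k (y + s *\<^sub>R h))"
    have g: "(?g has_real_derivative ?g' s) (at s)" for s
      by (rule has_real_derivative_line[OF flat_gen_differentiable[OF flat_gen_bump]])
    have g': "(?g' has_real_derivative ?g'' s) (at s)" for s
      by (intro DERIV_sum DERIV_cmult has_real_derivative_line flat_gen_differentiable flat_gen_pd flat_gen_bump)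
    have sh: "((\<lambda>s. ?g (s + 1)) has_real_derivative ?g' (s + 1)) (at s)" for s
      using DERIV_shift[of ?g "?g' (s + 1)" s 1] g[of "s + 1"] by simp
    have "((\<lambda>s. ?g (s + 1) - ?g s) has_real_derivative ?g' (s + 1) - ?g' s) (at s)" for s
      by (rule DERIV_diff[OF sh g])
    from MVT2[where a="0::real" and b=1, OF _ this] obtain \<xi> where
      1: "(?g (1 + 1) - ?g 1) - (?g (0 + 1) - ?g 0) = (1 - 0) * (?g' (\<xi> + 1) - ?g' \<xi>)" by auto
    from MVT2[where a=\<xi> and b="\<xi> + 1", OF _ g'] obtain \<eta> where
      2: "?g' (\<xi> + 1) - ?g' \<xi> = (\<xi> + 1 - \<xi>) * ?g'' \<eta>" by auto
    have "fdiff 2 h bump y = ?g'' \<eta>"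
      using 1 2 by (simp add: fdiff_2)
    also have "\<bar>\<dots>\<bar> \<le> (\<Sum>i\<in>Basis. norm h * (\<Sum>k\<in>Basis. norm h * B i k))"
    proof (rule order_trans[OF sum_abs sum_mono])
      fix i :: 'a assume i: "i \<in> Basis"
      have "\<bar>\<Sum>k\<in>Basis. (h \<bullet> k) * pd (pd bump i) k (y + \<eta> *\<^sub>R h)\<bar> \<le> (\<Sum>k\<in>Basis. norm h * B i k)"
        using B by (intro order_trans[OF sum_abs sum_mono]) (auto simp: abs_mult Basis_le_norm intro!: mult_mono)
      then show "\<bar>(h \<bullet> i) * (\<Sum>k\<in>Basis. (h \<bullet> k) * pd (pd bump i) k (y + \<eta> *\<^sub>R h))\<bar> \<le> norm h * (\<Sum>k\<in>Basis. norm h * B i k)"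
        using i unfolding abs_mult by (intro mult_mono) (auto simp: Basis_le_norm)
    qed
    also have "\<dots> = D * norm h ^ 2"
      by (simp add: D_def sum_distrib_left sum_distrib_right power2_eq_square mult_ac)
    finally show ?thesis .
  qed
  then show ?thesis using D0 by blast
qed

text \<open>The weights 1 + 1 + 2 + 1 add up to 5, so the sum is at most five times the maximum.
  Comparison with the maximum treats \<rho> < 1 and \<rho> \<ge> 1 alike.\<close>

lemma powr_sum4_le:
  fixes a b c d :: real
  assumes "0 \<le> a" "0 \<le> b" "0 \<le> c" "0 \<le> d" "0 < \<rho>"
  shows "(a + b + 2 * c + d) powr \<rho> \<le> 5 powr \<rho> * (a powr \<rho> + b powr \<rho> + c powr \<rho> + d powr \<rho>)"
proof -
  define m where "m = Max {a, b, c, d}"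
  have m: "a \<le> m" "b \<le> m" "c \<le> m" "d \<le> m" "m \<in> {a, b, c, d}"
    unfolding m_def by (auto intro: Max_in)
  have "(a + b + 2 * c + d) powr \<rho> \<le> (5 * m) powr \<rho>"
    using assms m by (intro powr_mono2) auto
  also have "\<dots> = 5 powr \<rho> * m powr \<rho>" using assms m by (intro powr_mult)
  also have "m powr \<rho> \<le> a powr \<rho> + b powr \<rho> + c powr \<rho> + d powr \<rho>"
    using m(5) by (auto intro: add_nonneg_nonneg)
  finally show ?thesis by simp
qed

text \<open>The reciprocal with 1 / \<infinity> = 0, so that exponents containing 1 / \<rho> remain
  uniform up to the endpoint.\<close>

definition rinv :: "ereal \<Rightarrow> real" where
  "rinv \<rho> = (if \<rho> = \<infinity> then 0 else 1 / real_of_ereal \<rho>)"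

context bump_array
begin

lemma r_le_half: "r (Suc j) \<le> r j / 2"
proof -
  have "2 powr (- C * real (Suc j)) = 2 powr (- C * real j) * 2 powr (- C)"
    by (simp add: powr_add[symmetric] algebra_simps)
  also have "\<dots> \<le> 2 powr (- C * real j) * 2 powr (- 1)"
    using C by (intro mult_left_mono powr_mono) auto
  finally show ?thesis using lam by (simp add: geo_def powr_minus)
qed

lemma r_Suc: "r (Suc j) = r j * 2 powr (- C)"
  by (simp add: geo_def powr_add[symmetric] algebra_simps)

text \<open>Telescoping sums: \<open>r j powr a\<close> is a fixed multiple of the increment of \<open>r j powr a\<close>.\<close>
lemma sum_small_radii:
  assumes a: "0 < a" and t: "0 < t"
  shows "(\<Sum>j. ennreal (if t \<le> r j then 0 else r j powr a)) \<le> ennreal (1 / (1 - 2 powr (- C * a)) * t powr a)"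
proof (rule suminf_le_const[OF summableI])
  fix n
  define q where "q = 2 powr (- C * a)"
  have q: "0 < q" "q < 1" using a C by (auto simp: q_def powr_less_one)
  \<comment> \<open>Cutting the radii at \<open>t\<close> keeps the increments of all levels with
    radius below \<open>t\<close> and bounds the telescoped total by
    \<open>t powr a\<close>.\<close>
  define m where "m j = min (r j) t powr a" for j
  have rs: "r (Suc j) powr a = q * r j powr a" for j
    unfolding r_Suc q_def using r_pos[of j] by (simp add: powr_mult powr_powr)
  have "(if t \<le> r j then 0 else r j powr a) \<le> 1 / (1 - q) * (m j - m (Suc j))" for j
  proof (cases "t \<le> r j")
    case True
    have "min (r (Suc j)) t \<le> min (r j) t"
      using r_le_half[of j] r_pos[of j] by linarith
    then have "m (Suc j) \<le> m j"
      unfolding m_def using a t r_pos[of "Suc j"] by (intro powr_mono2) auto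
    then show ?thesis using True q by simp
  next
    case False
    then have "r (Suc j) < t" using r_le_half[of j] r_pos[of j] by linarith
    then have "m j - m (Suc j) = (1 - q) * r j powr a"
      using False rs[of j] by (simp add: m_def min_def left_diff_distrib)
    then show ?thesis using False q by simp
  qed
  then have "(\<Sum>j<n. (if t \<le> r j then 0 else r j powr a)) \<le> (\<Sum>j<n. 1 / (1 - q) * (m j - m (Suc j)))"
    by (rule sum_mono)
  also have "\<dots> = 1 / (1 - q) * (m 0 - m n)"
    unfolding sum_distrib_left[symmetric] sum_lessThan_telescope' ..
  also have "\<dots> \<le> 1 / (1 - q) * t powr a"
  proof (rule mult_left_mono)
    have "m 0 \<le> t powr a" unfolding m_def using a t r_pos[of 0] by (intro powr_mono2) auto
    moreover have "0 \<le> m n" by (simp add: m_def)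
    ultimately show "m 0 - m n \<le> t powr a" by linarith
  qed (use q in auto)
  finally show "(\<Sum>j<n. ennreal (if t \<le> r j then 0 else r j powr a)) \<le> ennreal (1 / (1 - 2 powr (- C * a)) * t powr a)"
    unfolding q_def by (subst sum_ennreal) (auto intro: ennreal_leI)
qed

lemma sum_large_radii:
  assumes a: "0 < a" and t: "0 < t"
  shows "(\<Sum>j. ennreal (if t \<le> r j then r j powr (- a) else 0)) \<le> ennreal (1 / (1 - 2 powr (- C * a)) * t powr (- a))"
proof (rule suminf_le_const[OF summableI])
  fix n
  define q where "q = 2 powr (- C * a)"
  have q: "0 < q" "q < 1" using a C by (auto simp: q_def powr_less_one)
  \<comment> \<open>\<open>r j * 2 powr C\<close> is the radius one level earlier. The shift makes
    the increment from \<open>j\<close> to \<open>Suc j\<close> a multiple of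
    \<open>r j powr (- a)\<close> even at the last level with \<open>t \<le> r j\<close>.\<close>
  define m where "m j = max (r j * 2 powr C) t powr (- a)" for j
  have one: "1 \<le> 2 powr C" using C by (simp add: ge_one_powr_ge_zero)
  have rm: "r (Suc j) * 2 powr C = r j" for j
    by (simp add: r_Suc mult.assoc powr_add[symmetric])
  have le: "r j \<le> r j * 2 powr C" for j
    using mult_left_mono[OF one less_imp_le[OF r_pos[of j]]] by simp
  have "(if t \<le> r j then r j powr (- a) else 0) \<le> 1 / (1 - q) * (m (Suc j) - m j)" for j
  proof (cases "t \<le> r j")
    case False
    have "m j \<le> m (Suc j)" unfolding m_def rm
      using a t le[of j] by (intro powr_mono2') auto
    then show ?thesis using False q by simp
  next
    case True
    have "m j = (r j * 2 powr C) powr (- a)" unfolding m_def using True le[of j] by simp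
    also have "\<dots> = q * r j powr (- a)" using r_pos[of j] by (simp add: powr_mult powr_powr q_def)
    finally have "m (Suc j) - m j = (1 - q) * r j powr (- a)"
      using True by (simp add: m_def rm left_diff_distrib)
    then show ?thesis using True q by simp
  qed
  then have "(\<Sum>j<n. (if t \<le> r j then r j powr (- a) else 0)) \<le> (\<Sum>j<n. 1 / (1 - q) * (m (Suc j) - m j))"
    by (rule sum_mono)
  also have "\<dots> = 1 / (1 - q) * (m n - m 0)"
    unfolding sum_distrib_left[symmetric] sum_lessThan_telescope ..
  also have "\<dots> \<le> 1 / (1 - q) * t powr (- a)"
  proof (rule mult_left_mono)
    have "m n \<le> t powr (- a)" unfolding m_def using a t by (intro powr_mono2') auto
    moreover have "0 \<le> m 0" by (simp add: m_def)
    ultimately show "m n - m 0 \<le> t powr (- a)" by linarith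
  qed (use q in auto)
  finally show "(\<Sum>j<n. ennreal (if t \<le> r j then r j powr (- a) else 0)) \<le> ennreal (1 / (1 - 2 powr (- C * a)) * t powr (- a))"
    unfolding q_def by (subst sum_ennreal) (auto intro: ennreal_leI)
qed

text \<open>Bumps of radius at least \<open>t\<close> are smooth at scale \<open>t\<close>; the remaining ones are bounded trivially.\<close>
lemma fdiff_2_bs_split:
  assumes D: "\<And>h y. \<bar>fdiff 2 h bump y\<bar> \<le> D * norm (h::'a) ^ 2" "0 \<le> D" and h: "h \<in> cball 0 t" and t: "0 < t"
  obtains l where "0 \<le> l" "\<bar>fdiff 2 h (bs al bump) x\<bar> \<le> l
      + \<bar>bs (\<lambda>j. if t \<le> r j then 0 else al j) bump x\<bar> + 2 * \<bar>bs (\<lambda>j. if t \<le> r j then 0 else al j) bump (x + h)\<bar>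
      + \<bar>bs (\<lambda>j. if t \<le> r j then 0 else al j) bump (x + 2 *\<^sub>R h)\<bar>"
    "l = 0 \<or> (\<exists>j. t \<le> r j \<and> x \<in> V 3 j \<and> l = D * \<bar>al j\<bar> * (t / r j) ^ 2)"
proof -
  let ?S = "bs (\<lambda>j. if t \<le> r j then 0 else al j) bump" and ?L = "bs (\<lambda>j. if t \<le> r j then al j else 0) bump"
  have split: "bs al bump y = ?L y + ?S y" for y
    using profile_bump
  proof (cases rule: bs_cases[of bump y])
    case (near j z)
    show ?thesis by (simp add: near(4)[OF profile_bump])
  qed (simp add: profile_bump)
  have nh: "norm h \<le> t" "norm (2 *\<^sub>R h) \<le> 2 * t" using h by auto
  define l where "l = \<bar>fdiff 2 h ?L x\<bar>"
  have 1: "\<bar>fdiff 2 h (bs al bump) x\<bar> \<le> l + \<bar>?S x\<bar> + 2 * \<bar>?S (x + h)\<bar> + \<bar>?S (x + 2 *\<^sub>R h)\<bar>"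
  proof -
    have "\<bar>a + a' - 2 * (b + b') + (c + c')\<bar> \<le> \<bar>a - 2 * b + c\<bar> + \<bar>a'\<bar> + 2 * \<bar>b'\<bar> + \<bar>c'\<bar>"
      for a a' b b' c c' :: real by (smt (verit))
    then show ?thesis unfolding l_def fdiff_2 split .
  qed
  show ?thesis
  proof (cases "\<exists>j. t \<le> r j \<and> x \<in> V 3 j")
    case True
    then obtain j where j: "t \<le> r j" "x \<in> V 3 j" by blast
    obtain z where z: "z \<in> P j" "x \<in> cball z (3 * r j)" using j(2) by (rule V_E) auto
    \<comment> \<open>The points x + h and x + 2 h lie within 2 t \<le> 2 r j of \<open>x\<close>,
      and 3 + 2 = 5: all three points see the same single bump.\<close>
    have near: "y \<in> cball z (5 * r j)" if "dist x y \<le> 2 * t" for y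
      using dist_triangle[of z y x] z(2) that j(1) by simp
    have i: "x \<in> cball z (5 * r j)" "x + h \<in> cball z (5 * r j)" "x + 2 *\<^sub>R h \<in> cball z (5 * r j)"
      by (rule near; use nh t in \<open>simp add: dist_norm\<close>)+
    have e: "(x + h - z) /\<^sub>R r j = (x - z) /\<^sub>R r j + h /\<^sub>R r j"
      "(x + 2 *\<^sub>R h - z) /\<^sub>R r j = (x - z) /\<^sub>R r j + 2 *\<^sub>R (h /\<^sub>R r j)"
      by (simp_all add: algebra_simps)
    have "fdiff 2 h ?L x = al j * fdiff 2 (h /\<^sub>R r j) bump ((x - z) /\<^sub>R r j)"
      unfolding fdiff_2 bs_near[OF profile_bump z(1) i(1)] bs_near[OF profile_bump z(1) i(2)]
          bs_near[OF profile_bump z(1) i(3)] e using j(1)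
      by (simp add: right_diff_distrib distrib_left)
    then have "l = \<bar>al j\<bar> * \<bar>fdiff 2 (h /\<^sub>R r j) bump ((x - z) /\<^sub>R r j)\<bar>" by (simp add: l_def abs_mult)
    also have "\<dots> \<le> \<bar>al j\<bar> * (D * (t / r j) ^ 2)"
    proof (rule mult_left_mono[OF order_trans[OF D(1)]])
      have "norm (h /\<^sub>R r j) \<le> t / r j"
        using nh(1) r_pos[of j] by (simp add: divide_inverse mult.commute mult_left_mono)
      then show "D * norm (h /\<^sub>R r j) ^ 2 \<le> D * (t / r j) ^ 2"
        by (intro mult_left_mono[OF _ D(2)] power_mono) auto
    qed auto
    finally have "l \<le> D * \<bar>al j\<bar> * (t / r j) ^ 2" by (simp add: mult_ac)
    then show ?thesis using 1 j D(2) by (intro that[of "D * \<bar>al j\<bar> * (t / r j) ^ 2"]) auto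
  next
    case False
    \<comment> \<open>A bump of radius at least \<open>t\<close> whose support meets the
      2t-neighbourhood of \<open>x\<close> would put \<open>x\<close> into \<open>V 3 j\<close>, as
      1 + 2 = 3.\<close>
    have "?L y = 0" if y: "dist x y \<le> 2 * t" for y
      using profile_bump
    proof (cases rule: bs_cases[of bump y])
      case (near j z)
      obtain z' where z': "z' \<in> P j" "y \<in> cball z' (1 * r j)" using near(3) by (rule V_E) auto
      have "x \<in> V 3 j" if "t \<le> r j"
      proof -
        have "x \<in> cball z' (3 * r j)" using dist_triangle[of z' x y] z'(2) y that by (simp add: dist_commute)
        then show ?thesis using z'(1) by (auto simp: V_def)
      qed
      then show ?thesis using False near(4)[OF profile_bump] by auto
    qed (simp add: profile_bump)
    then have "?L x = 0" "?L (x + h) = 0" "?L (x + 2 *\<^sub>R h) = 0"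
      using nh t by (auto simp: dist_norm)
    then have "l = 0" unfolding l_def fdiff_2 by simp
    then show ?thesis using 1 by (intro that[of 0]) auto
  qed
qed

end

section \<open>Upper bounds for the modulus of smoothness of the solution\<close>

context plap_array
begin

text \<open>Hypothesis \<open>e\<close> bounds the \<rho>-th power mass of level \<open>j\<close> by
  a multiple of r^(s \<rho>). Radii below \<open>t\<close> contribute the sum of r^(s \<rho>), the
  others t^(2 \<rho>) times the sum of r^(-(2 - s) \<rho>). As 0 < s < 2, both contributions are at
  most of order t^(s \<rho>).\<close>

lemma lp_nrm_fdiff_u_le:
  assumes s: "0 < s" "s < 2" and \<rho>: "0 < \<rho>"
    and e: "C * s + \<kappa> - real DIM('a) * (1 / \<rho>) \<le> 0"
  shows "\<exists>M\<ge>0. \<forall>t>0. \<forall>h\<in>cball 0 t. lp_nrm (ereal \<rho>) UNIV (fdiff 2 h u) \<le> ennreal (M * t powr s)"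
proof -
  define b where "b = \<kappa>"
  define A where "A = lam powr \<sigma> * lam"
  define \<beta> where "\<beta> = geo A b"
  let ?d = "real DIM('a)"
  have ub: "u = bs \<beta> bump" by (simp add: u_def \<beta>_def A_def b_def)
  have A: "0 < A" using lam by (simp add: A_def)
  have \<beta>0: "0 < \<beta> j" for j unfolding \<beta>_def by (rule geo_pos[OF A])
  obtain D where D: "0 \<le> D" "\<And>(h::'a) y. \<bar>fdiff 2 h bump y\<bar> \<le> D * norm h ^ 2"
    using fdiff_2_bump_le by metis
  obtain B where B: "0 \<le> B" "\<And>y::'a. \<bar>bump y\<bar> \<le> B" using profile_bounded[OF profile_bump] by metis
  define Z where "Z = (A / lam powr s) powr \<rho>"
  have Z0: "0 \<le> Z" by (simp add: Z_def)
  have exp: "b * \<rho> - ?d \<le> - C * (s * \<rho>)"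
  proof -
    have "(C * s + b - ?d * (1 / \<rho>)) * \<rho> \<le> 0" using e \<rho> unfolding b_def by (simp add: mult_nonpos_nonneg)
    then show ?thesis using \<rho> by (simp add: algebra_simps)
  qed
  \<comment> \<open>Amplitude is balanced against level volume here; \<open>v\<close> will be
    \<open>vol 1\<close> for the small radii and \<open>vol 3\<close> for the large ones.\<close>
  have key: "\<beta> j powr \<rho> * geo v (- ?d) j \<le> v * Z * r j powr (s * \<rho>)" if "0 \<le> v" for v j
  proof -
    have "\<beta> j powr \<rho> * geo v (- ?d) j = v * A powr \<rho> * 2 powr ((b * \<rho> - ?d) * real j)"
      using A unfolding \<beta>_def by (simp add: geo_powr geo_mult) (simp add: geo_def)
    also have "\<dots> \<le> v * A powr \<rho> * 2 powr (- C * (s * \<rho>) * real j)"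
      using that A exp by (intro mult_left_mono powr_mono mult_right_mono) auto
    also have "\<dots> = v * Z * r j powr (s * \<rho>)"
      using A lam by (simp add: Z_def geo_def powr_mult powr_divide powr_powr mult_ac)
    finally show ?thesis .
  qed
  define c1 where "c1 = 1 / (1 - 2 powr (- C * (s * \<rho>)))"
  define c2 where "c2 = 1 / (1 - 2 powr (- C * ((2 - s) * \<rho>)))"
  have c1: "0 \<le> c1" unfolding c1_def using C s \<rho> by (simp add: powr_less_one less_imp_le)
  have c2: "0 \<le> c2" unfolding c2_def using C s \<rho> by (simp add: powr_less_one less_imp_le)
  define Q1 where "Q1 = B powr \<rho> * (vol 1 * Z) * c1"
  define Q2 where "Q2 = D powr \<rho> * (vol 3 * Z) * c2"
  have v: "0 \<le> vol 1" "0 \<le> vol 3" by (auto intro: vol_nonneg)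
  have Q: "0 \<le> Q1" "0 \<le> Q2" using c1 c2 Z0 v by (auto simp: Q1_def Q2_def)
  have main: "lp_nrm (ereal \<rho>) UNIV (fdiff 2 h u) \<le> ennreal ((5 powr \<rho> * (Q2 + 3 * Q1)) powr (1 / \<rho>) * t powr s)"
    if t: "0 < t" and h: "h \<in> cball 0 t" for t h
  proof -
    define S where "S = bs (\<lambda>j. if t \<le> r j then 0 else \<beta> j) bump"
    define cL where "cL j = (if t \<le> r j then D * \<beta> j * (t / r j) ^ 2 else 0)" for j
    have cL0: "0 \<le> cL j" for j using D(1) less_imp_le[OF \<beta>0] by (simp add: cL_def)
    have Sm: "S \<in> borel_measurable borel" unfolding S_def by (rule bs_measurable[OF profile_bump])
    define FS where "FS x = ennreal (\<bar>S x\<bar> powr \<rho>)" for x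
    define FL where "FL x = (\<Sum>j. ennreal (cL j powr \<rho>) * indicator (V 3 j) x)" for x
    have FSm: "FS \<in> borel_measurable borel" unfolding FS_def[abs_def] using Sm by simp
    have FLm: "FL \<in> borel_measurable borel" unfolding FL_def[abs_def] using V_borel by auto
    let ?aS = "ennreal (B powr \<rho> * (vol 1 * Z))" and ?aL = "ennreal (D powr \<rho> * (vol 3 * Z) * t powr (2 * \<rho>))"
    let ?rS = "\<lambda>j. ennreal (if t \<le> r j then 0 else r j powr (s * \<rho>))"
    let ?rL = "\<lambda>j. ennreal (if t \<le> r j then r j powr (- ((2 - s) * \<rho>)) else 0)"
    have "(\<integral>\<^sup>+x. FS x \<partial>lborel) \<le> (\<Sum>j. ennreal ((\<bar>if t \<le> r j then 0 else \<beta> j\<bar> * B) powr \<rho> * geo (vol 1) (- ?d) j))"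
      unfolding FS_def S_def by (rule level_bound[OF bs_level_le[OF profile_bump B(2) \<rho>]]) auto
    also have "\<dots> \<le> (\<Sum>j. ?aS * ?rS j)"
    proof (intro suminf_le summableI)
      fix j
      show "ennreal ((\<bar>if t \<le> r j then 0 else \<beta> j\<bar> * B) powr \<rho> * geo (vol 1) (- ?d) j)
        \<le> ?aS * ?rS j"
      proof (cases "t \<le> r j")
        case False
        have "(\<beta> j * B) powr \<rho> * geo (vol 1) (- ?d) j = B powr \<rho> * (\<beta> j powr \<rho> * geo (vol 1) (- ?d) j)"
          using \<beta>0[of j] B by (simp add: powr_mult)
        also have "\<dots> \<le> B powr \<rho> * (vol 1 * Z * r j powr (s * \<rho>))"
          by (intro mult_left_mono key v) auto
        finally have "ennreal ((\<beta> j * B) powr \<rho> * geo (vol 1) (- ?d) j) \<le> ennreal (B powr \<rho> * (vol 1 * Z) * r j powr (s * \<rho>))"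
          by (intro ennreal_leI) (simp add: mult_ac)
        then show ?thesis using False \<beta>0[of j] v Z0 by (simp add: ennreal_mult[symmetric])
      qed simp
    qed
    also have "\<dots> = ?aS * (\<Sum>j. ?rS j)"
      by (rule ennreal_suminf_cmult)
    also have "\<dots> \<le> ?aS * ennreal (c1 * t powr (s * \<rho>))"
      unfolding c1_def using s \<rho> t by (intro mult_left_mono sum_small_radii) auto
    also have "\<dots> = ennreal (Q1 * t powr (s * \<rho>))"
      using v Z0 c1 by (simp add: Q1_def ennreal_mult[symmetric] mult.assoc)
    finally have FS: "(\<integral>\<^sup>+x. FS x \<partial>lborel) \<le> ennreal (Q1 * t powr (s * \<rho>))" .
    have "(\<integral>\<^sup>+x. FL x \<partial>lborel) \<le> (\<Sum>j. ennreal (cL j powr \<rho> * geo (vol 3) (- ?d) j))"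
      unfolding FL_def by (rule level_bound) auto
    also have "\<dots> \<le> (\<Sum>j. ?aL * ?rL j)"
    proof (intro suminf_le summableI)
      fix j
      show "ennreal (cL j powr \<rho> * geo (vol 3) (- ?d) j)
        \<le> ?aL * ?rL j"
      proof (cases "t \<le> r j")
        case True
        have "((t / r j) ^ 2) powr \<rho> = t powr (2 * \<rho>) * r j powr (- (2 * \<rho>))"
        proof -
          have "(t / r j) ^ 2 = (t / r j) powr 2" using t r_pos[of j] by simp
          then have "((t / r j) ^ 2) powr \<rho> = (t / r j) powr (2 * \<rho>)" by (simp only: powr_powr)
          also have "\<dots> = t powr (2 * \<rho>) * r j powr (- (2 * \<rho>))"
            by (simp add: powr_divide powr_minus_divide)
          finally show ?thesis .
        qed
        then have "cL j powr \<rho> * geo (vol 3) (- ?d) j = D powr \<rho> * (t powr (2 * \<rho>) * r j powr (- (2 * \<rho>))) * (\<beta> j powr \<rho> * geo (vol 3) (- ?d) j)"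
          using True D(1) \<beta>0[of j] by (simp add: cL_def powr_mult)
        also have "\<dots> \<le> D powr \<rho> * (t powr (2 * \<rho>) * r j powr (- (2 * \<rho>))) * (vol 3 * Z * r j powr (s * \<rho>))"
          by (intro mult_left_mono key v) auto
        also have "\<dots> = D powr \<rho> * (vol 3 * Z) * t powr (2 * \<rho>) * (r j powr (- (2 * \<rho>)) * r j powr (s * \<rho>))" by simp
        also have "r j powr (- (2 * \<rho>)) * r j powr (s * \<rho>) = r j powr (- ((2 - s) * \<rho>))"
          unfolding powr_add[symmetric] by (simp add: algebra_simps)
        finally show ?thesis using True v Z0 by (simp add: ennreal_mult[symmetric] ennreal_leI)
      qed (simp add: cL_def)
    qed
    also have "\<dots> = ?aL * (\<Sum>j. ?rL j)"
      by (rule ennreal_suminf_cmult)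
    also have "\<dots> \<le> ?aL * ennreal (c2 * t powr (- ((2 - s) * \<rho>)))"
      unfolding c2_def using s \<rho> t by (intro mult_left_mono sum_large_radii) auto
    also have "\<dots> = ennreal (Q2 * (t powr (2 * \<rho>) * t powr (- ((2 - s) * \<rho>))))"
      using v Z0 c2 by (simp add: Q2_def ennreal_mult[symmetric] mult_ac)
    also have "t powr (2 * \<rho>) * t powr (- ((2 - s) * \<rho>)) = t powr (s * \<rho>)"
      unfolding powr_add[symmetric] by (simp add: algebra_simps)
    finally have FL: "(\<integral>\<^sup>+x. FL x \<partial>lborel) \<le> ennreal (Q2 * t powr (s * \<rho>))" .
    have pt: "ennreal (\<bar>fdiff 2 h u x\<bar> powr \<rho>) \<le> ennreal (5 powr \<rho>) * (FL x + FS x + FS (x + h) + FS (x + 2 *\<^sub>R h))" for x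
    proof -
      obtain l where l: "0 \<le> l" "\<bar>fdiff 2 h u x\<bar> \<le> l + \<bar>S x\<bar> + 2 * \<bar>S (x + h)\<bar> + \<bar>S (x + 2 *\<^sub>R h)\<bar>"
        "l = 0 \<or> (\<exists>j. t \<le> r j \<and> x \<in> V 3 j \<and> l = D * \<bar>\<beta> j\<bar> * (t / r j) ^ 2)"
        by (rule fdiff_2_bs_split[where al=\<beta> and x=x, OF D(2,1) h t, folded S_def ub]) (rule that)
      have lF: "ennreal (l powr \<rho>) \<le> FL x"
      proof (cases "l = 0")
        case False
        then obtain j where j: "t \<le> r j" "x \<in> V 3 j" "l = cL j"
          using l(3) \<beta>0 by (auto simp: cL_def less_imp_le)
        have "ennreal (l powr \<rho>) = (\<Sum>j\<in>{j}. ennreal (cL j powr \<rho>) * indicator (V 3 j) x)"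
          using j by simp
        also have "\<dots> \<le> FL x" unfolding FL_def by (intro sum_le_suminf summableI) auto
        finally show ?thesis .
      qed simp
      have "\<bar>fdiff 2 h u x\<bar> powr \<rho> \<le> (l + \<bar>S x\<bar> + 2 * \<bar>S (x + h)\<bar> + \<bar>S (x + 2 *\<^sub>R h)\<bar>) powr \<rho>"
        using l(2) \<rho> by (intro powr_mono2) auto
      also have "\<dots> \<le> 5 powr \<rho> * (l powr \<rho> + \<bar>S x\<bar> powr \<rho> + \<bar>S (x + h)\<bar> powr \<rho> + \<bar>S (x + 2 *\<^sub>R h)\<bar> powr \<rho>)"
        using l(1) \<rho> by (intro powr_sum4_le) auto
      finally have "ennreal (\<bar>fdiff 2 h u x\<bar> powr \<rho>) \<le> ennreal (5 powr \<rho>) * (ennreal (l powr \<rho>) + FS x + FS (x + h) + FS (x + 2 *\<^sub>R h))"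
        unfolding FS_def by (simp add: ennreal_leI ennreal_plus[symmetric] ennreal_mult[symmetric] del: ennreal_plus)
      also have "\<dots> \<le> ennreal (5 powr \<rho>) * (FL x + FS x + FS (x + h) + FS (x + 2 *\<^sub>R h))"
        by (intro mult_left_mono add_right_mono lF) auto
      finally show ?thesis .
    qed
    have shm: "(\<lambda>x. FS (x + k)) \<in> borel_measurable borel" for k
      by (rule measurable_compose[OF _ FSm]) simp
    have "(\<integral>\<^sup>+x. ennreal (\<bar>fdiff 2 h u x\<bar> powr \<rho>) \<partial>lborel) \<le> (\<integral>\<^sup>+x. ennreal (5 powr \<rho>) * (FL x + FS x + FS (x + h) + FS (x + 2 *\<^sub>R h)) \<partial>lborel)"
      by (intro nn_integral_mono pt)
    also have "\<dots> = ennreal (5 powr \<rho>) * ((\<integral>\<^sup>+x. FL x \<partial>lborel) + (\<integral>\<^sup>+x. FS x \<partial>lborel) + (\<integral>\<^sup>+x. FS (x + h) \<partial>lborel) + (\<integral>\<^sup>+x. FS (x + 2 *\<^sub>R h) \<partial>lborel))"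
      using FLm FSm shm by (simp add: nn_integral_cmult nn_integral_add borel_measurable_add)
    also have "\<dots> \<le> ennreal (5 powr \<rho>) * (ennreal (Q2 * t powr (s * \<rho>)) + ennreal (Q1 * t powr (s * \<rho>)) + ennreal (Q1 * t powr (s * \<rho>)) + ennreal (Q1 * t powr (s * \<rho>)))"
      unfolding nn_integral_lborel_translate[OF FSm] by (intro mult_left_mono add_mono FL FS) auto
    also have "\<dots> = ennreal (5 powr \<rho> * (Q2 + 3 * Q1) * t powr (s * \<rho>))"
      using Q by (simp add: ennreal_plus[symmetric] ennreal_mult[symmetric] algebra_simps del: ennreal_plus)
    finally have "(\<integral>\<^sup>+x. ennreal (\<bar>fdiff 2 h u x\<bar> powr \<rho>) \<partial>lebesgue_on UNIV) \<le> ennreal (5 powr \<rho> * (Q2 + 3 * Q1) * t powr (s * \<rho>))"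
      by (rule order_trans[OF nn_integral_lebesgue_on_le, rotated]) simp
    then have "lp_nrm (ereal \<rho>) UNIV (fdiff 2 h u) \<le> enn_rpow (ennreal (5 powr \<rho> * (Q2 + 3 * Q1) * t powr (s * \<rho>))) (1 / \<rho>)"
      unfolding lp_nrm_real using \<rho> by (intro enn_rpow_mono) auto
    also have "\<dots> = ennreal ((5 powr \<rho> * (Q2 + 3 * Q1)) powr (1 / \<rho>) * t powr s)"
      using Q \<rho> by (simp add: enn_rpow_ennreal powr_mult powr_powr)
    finally show ?thesis .
  qed
  show ?thesis
    by (rule exI[of _ "(5 powr \<rho> * (Q2 + 3 * Q1)) powr (1 / \<rho>)"]) (use main in auto)
qed

text \<open>The sums over levels become suprema: small radii are estimated by their amplitudes,
  large ones through (t / r)^2 \<le> (t / r)^s, valid because t \<le> r and s < 2.\<close>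

lemma lp_nrm_infty_fdiff_u_le:
  assumes s: "0 < s" "s < 2" and e: "C * s + \<kappa> \<le> 0"
  shows "\<exists>M\<ge>0. \<forall>t>0. \<forall>h\<in>cball 0 t. lp_nrm \<infinity> UNIV (fdiff 2 h u) \<le> ennreal (M * t powr s)"
proof -
  define b where "b = \<kappa>"
  define A where "A = lam powr \<sigma> * lam"
  define \<beta> where "\<beta> = geo A b"
  have ub: "u = bs \<beta> bump" by (simp add: u_def \<beta>_def A_def b_def)
  have A: "0 < A" using lam by (simp add: A_def)
  have \<beta>0: "0 < \<beta> j" for j unfolding \<beta>_def by (rule geo_pos[OF A])
  obtain D where D: "0 \<le> D" "\<And>(h::'a) y. \<bar>fdiff 2 h bump y\<bar> \<le> D * norm h ^ 2"
    using fdiff_2_bump_le by metis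
  obtain B where B: "0 \<le> B" "\<And>y::'a. \<bar>bump y\<bar> \<le> B" using profile_bounded[OF profile_bump] by metis
  define Z where "Z = A / lam powr s"
  have Z0: "0 \<le> Z" using A by (simp add: Z_def)
  have key: "\<beta> j \<le> Z * r j powr s" for j
  proof -
    have "b * real j \<le> - C * s * real j" using e unfolding b_def by (intro mult_right_mono) auto
    then have "\<beta> j \<le> A * 2 powr (- C * s * real j)"
      unfolding \<beta>_def geo_def using A by (intro mult_left_mono powr_mono) auto
    also have "\<dots> = Z * r j powr s"
      using lam by (simp add: Z_def geo_def powr_mult powr_powr mult_ac)
    finally show ?thesis .
  qed
  have main: "lp_nrm \<infinity> UNIV (fdiff 2 h u) \<le> ennreal ((D * Z + 4 * (Z * B)) * t powr s)"
    if t: "0 < t" and h: "h \<in> cball 0 t" for t h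
  proof (rule lp_nrm_inftyI)
    fix x
    define S where "S = bs (\<lambda>j. if t \<le> r j then 0 else \<beta> j) bump"
    obtain l where l: "0 \<le> l" "\<bar>fdiff 2 h u x\<bar> \<le> l + \<bar>S x\<bar> + 2 * \<bar>S (x + h)\<bar> + \<bar>S (x + 2 *\<^sub>R h)\<bar>"
      "l = 0 \<or> (\<exists>j. t \<le> r j \<and> x \<in> V 3 j \<and> l = D * \<bar>\<beta> j\<bar> * (t / r j) ^ 2)"
      by (rule fdiff_2_bs_split[where al=\<beta> and x=x, OF D(2,1) h t, folded S_def ub]) (rule that)
    have Sb: "\<bar>S y\<bar> \<le> Z * t powr s * B" for y
      unfolding S_def
    proof (rule bs_le[OF profile_bump B(2)])
      fix j
      have "\<beta> j \<le> Z * t powr s" if "r j < t"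
        using that r_pos[of j] s Z0 by (intro order_trans[OF key] mult_left_mono powr_mono2) auto
      then show "\<bar>if t \<le> r j then 0 else \<beta> j\<bar> \<le> Z * t powr s"
        using Z0 \<beta>0[of j] by auto
    qed
    have lb: "l \<le> D * Z * t powr s"
    proof (cases "l = 0")
      case False
      then obtain j where j: "t \<le> r j" "l = D * \<beta> j * (t / r j) ^ 2"
        using l(3) \<beta>0 by (auto simp: less_imp_le)
      have q: "0 < t / r j" "t / r j \<le> 1" using t r_pos[of j] j(1) by auto
      have "(t / r j) ^ 2 = (t / r j) powr 2" using q by simp
      also have "\<dots> \<le> (t / r j) powr s" using q s by (intro powr_mono') auto
      also have "\<dots> = t powr s / r j powr s" using t r_pos[of j] by (simp add: powr_divide)
      finally have "l \<le> D * (Z * r j powr s) * (t powr s / r j powr s)"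
        unfolding j(2) using D(1) key[of j] \<beta>0[of j] Z0 by (intro mult_mono) auto
      then show ?thesis using r_pos[of j] by simp
    qed (use D(1) Z0 in simp)
    show "\<bar>fdiff 2 h u x\<bar> \<le> (D * Z + 4 * (Z * B)) * t powr s"
      using l(2) lb Sb[of x] Sb[of "x + h"] Sb[of "x + 2 *\<^sub>R h"] by (simp add: algebra_simps)
  qed
  show ?thesis by (rule exI[of _ "D * Z + 4 * (Z * B)"]) (use main D(1) Z0 B(1) in auto)
qed

lemma modsmooth_u_le:
  assumes s: "0 < s" "s < 2" and \<rho>: "0 < \<rho>"
    and e: "C * s + \<kappa> - real DIM('a) * rinv \<rho> \<le> 0"
  shows "\<exists>M\<ge>0. \<forall>t>0. modsmooth 2 \<rho> u t \<le> ennreal (M * t powr s)"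
proof -
  have "\<exists>M\<ge>0. \<forall>t>0. \<forall>h\<in>cball 0 t. lp_nrm \<rho> UNIV (fdiff 2 h u) \<le> ennreal (M * t powr s)"
  proof (cases \<rho>)
    case (real x)
    then show ?thesis using lp_nrm_fdiff_u_le[OF s, of x] \<rho> e by (simp add: rinv_def)
  next
    case PInf
    then show ?thesis using lp_nrm_infty_fdiff_u_le[OF s] e by (simp add: rinv_def)
  qed (use \<rho> in auto)
  then obtain M where "0 \<le> M" and M: "\<And>t h. 0 < t \<Longrightarrow> h \<in> cball 0 t \<Longrightarrow> lp_nrm \<rho> UNIV (fdiff 2 h u) \<le> ennreal (M * t powr s)"
    by blast
  moreover have "modsmooth 2 \<rho> u t \<le> ennreal (M * t powr s)" if "0 < t" for t
    unfolding modsmooth_def by (rule SUP_least) (rule M[OF that])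
  ultimately show ?thesis by blast
qed

lemma lp_mem_u: "0 < \<rho> \<Longrightarrow> lp_mem \<rho> UNIV u"
proof (cases \<rho>)
  case (real x)
  assume "0 < \<rho>"
  moreover have n: "\<kappa> \<le> 0" using exponent_neg C by linarith
  ultimately show ?thesis
    unfolding u_def real using real DIM_pos_real by (intro lp_mem_bs profile_bump)
      (auto intro: le_less_trans[OF mult_nonpos_nonneg])
next
  case PInf
  have "\<kappa> \<le> 0" using exponent_neg C by linarith
  then show ?thesis unfolding u_def PInf by (intro lp_mem_bs_infty profile_bump)
qed auto

end

section \<open>Besov membership from power bounds on the modulus\<close>

abbreviation "wmod s \<rho> g t \<equiv> ennreal (t powr (- s)) * modsmooth 2 \<rho> g t"

text \<open>The theorem involves only the smoothness 1 + \<sigma> and its shifts by \<epsilon>, all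
  strictly between 1 and 2, so the order of the differences is 2 throughout.\<close>

lemma besov_iff:
  assumes "1 < s" "s < 2"
  shows "besov s \<rho> q f \<longleftrightarrow> lp_mem \<rho> UNIV f \<and>
     (if q = \<infinity> then (SUP t \<in> {0<..}. ennreal (t powr (- s)) * modsmooth 2 \<rho> f t) < \<infinity>
      else (\<integral>\<^sup>+ t. indicator {0<..} t *
               enn_rpow (ennreal (t powr (- s)) * modsmooth 2 \<rho> f t) (real_of_ereal q)
               / ennreal t \<partial>lborel) < \<infinity>)"
proof -
  have "\<lfloor>s\<rfloor> = 1" using assms by (intro floor_unique) auto
  then have "nat \<lfloor>s\<rfloor> + 1 = 2" by simp
  then show ?thesis unfolding besov_def Let_def by presburger
qed

lemma nn_integral_powr_0_1:
  assumes "-1 < a" "0 \<le> c" shows "(\<integral>\<^sup>+t. ennreal (indicator {0..1} t * (c * t powr a)) \<partial>lborel) < \<infinity>"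
proof -
  have "((\<lambda>t. c * t powr a) has_integral c * (1 powr (a + 1) / (a + 1))) {0..1}"
    by (intro has_integral_mult_right has_integral_powr_from_0 assms) auto
  then have "integral\<^sup>N lborel (\<lambda>t. indicator {0..1} t * (c * t powr a)) = c * (1 powr (a + 1) / (a + 1))"
    using assms(2) by (intro nn_integral_has_integral_lebesgue) auto
  then show ?thesis by simp
qed

lemma nn_integral_powr_1_inf:
  assumes "a < -1" "0 \<le> c" shows "(\<integral>\<^sup>+t. ennreal (indicator {1..} t * (c * t powr a)) \<partial>lborel) < \<infinity>"
proof -
  have "((\<lambda>t. c * t powr a) has_integral c * (- (1 powr (a + 1)) / (a + 1))) {1..}"
    by (intro has_integral_mult_right has_integral_powr_to_inf assms) auto
  then have "integral\<^sup>N lborel (\<lambda>t. indicator {1..} t * (c * t powr a)) = c * (- (1 powr (a + 1)) / (a + 1))"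
    using assms(2) by (intro nn_integral_has_integral_lebesgue) auto
  then show ?thesis by simp
qed

lemma besov_inftyI:
  assumes s: "1 < s" "s < 2" and "lp_mem \<rho> UNIV g"
    and M: "0 \<le> M" "\<And>t. 0 < t \<Longrightarrow> modsmooth 2 \<rho> g t \<le> ennreal (M * t powr s)"
  shows "besov s \<rho> \<infinity> g"
proof -
  have "(SUP t\<in>{0<..}. wmod s \<rho> g t) \<le> ennreal M"
  proof (rule SUP_least)
    fix t :: real assume "t \<in> {0<..}"
    then have "wmod s \<rho> g t \<le> ennreal (t powr (- s)) * ennreal (M * t powr s)"
      using M by (intro mult_left_mono) auto
    also have "\<dots> = ennreal (M * (t powr (- s) * t powr s))"
      using M by (simp add: ennreal_mult[symmetric] mult_ac)
    also have "t powr (- s) * t powr s = 1" using \<open>t \<in> {0<..}\<close> by (simp add: powr_add[symmetric])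
    finally show "wmod s \<rho> g t \<le> ennreal M" by simp
  qed
  also have "\<dots> < \<infinity>" by simp
  finally show ?thesis using s assms(3) by (simp add: besov_iff)
qed

text \<open>A power above \<open>s\<close> gives convergence of the integral at 0, a power below
  \<open>s\<close> gives it at infinity; the two ranges are joined at t = 1.\<close>

lemma besov_finiteI:
  assumes s: "1 < s" "s < 2" and q: "0 < q" and "lp_mem \<rho> UNIV g"
    and M0: "0 \<le> M0" "\<And>t. 0 < t \<Longrightarrow> modsmooth 2 \<rho> g t \<le> ennreal (M0 * t powr s0)" "s0 < s"
    and M1: "0 \<le> M1" "\<And>t. 0 < t \<Longrightarrow> modsmooth 2 \<rho> g t \<le> ennreal (M1 * t powr s1)" "s < s1"
  shows "besov s \<rho> (ereal q) g"
proof -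
  let ?I = "\<lambda>t. indicator {0<..} t * enn_rpow (wmod s \<rho> g t) q / ennreal t"
  have bd: "?I t \<le> ennreal (M powr q * t powr ((s' - s) * q - 1))"
    if M: "0 \<le> M" "modsmooth 2 \<rho> g t \<le> ennreal (M * t powr s')" and t: "0 < t" for M s' t
  proof -
    have "wmod s \<rho> g t \<le> ennreal (t powr (- s)) * ennreal (M * t powr s')"
      using M by (intro mult_left_mono) auto
    also have "\<dots> = ennreal (M * (t powr s' * t powr (- s)))"
      using M by (simp add: ennreal_mult[symmetric] mult_ac)
    also have "t powr s' * t powr (- s) = t powr (s' - s)" by (simp add: powr_add[symmetric])
    finally have "enn_rpow (wmod s \<rho> g t) q \<le> ennreal ((M * t powr (s' - s)) powr q)"
      using q M enn_rpow_mono[of _ "ennreal (M * t powr (s' - s))" q] by (simp add: enn_rpow_ennreal)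
    then have "?I t \<le> ennreal ((M * t powr (s' - s)) powr q) / ennreal t"
      using t by (simp add: divide_right_mono_ennreal)
    also have "\<dots> = ennreal ((M * t powr (s' - s)) powr q / t)"
      using t by (simp add: divide_ennreal)
    also have "(M * t powr (s' - s)) powr q / t = M powr q * t powr ((s' - s) * q - 1)"
      using t M powr_diff[of t "(s' - s) * q" 1] by (simp add: powr_mult powr_powr)
    finally show ?thesis .
  qed
  have "(\<integral>\<^sup>+t. ?I t \<partial>lborel) \<le> (\<integral>\<^sup>+t. ennreal (indicator {0..1} t * (M1 powr q * t powr ((s1 - s) * q - 1)))
      + ennreal (indicator {1..} t * (M0 powr q * t powr ((s0 - s) * q - 1))) \<partial>lborel)"
  proof (rule nn_integral_mono)
    fix t :: real
    consider "t \<le> 0" | "0 < t" "t \<le> 1" | "1 < t" by linarith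
    then show "?I t \<le> ennreal (indicator {0..1} t * (M1 powr q * t powr ((s1 - s) * q - 1)))
      + ennreal (indicator {1..} t * (M0 powr q * t powr ((s0 - s) * q - 1)))"
    proof cases
      case 2
      then have "?I t \<le> ennreal (indicator {0..1} t * (M1 powr q * t powr ((s1 - s) * q - 1)))"
        using bd[OF M1(1) M1(2)] by simp
      then show ?thesis by (rule order_trans) simp
    next
      case 3
      then have "?I t \<le> ennreal (indicator {1..} t * (M0 powr q * t powr ((s0 - s) * q - 1)))"
        using bd[OF M0(1) M0(2)] by simp
      then show ?thesis by (rule order_trans) simp
    qed simp
  qed
  also have "\<dots> = (\<integral>\<^sup>+t. ennreal (indicator {0..1} t * (M1 powr q * t powr ((s1 - s) * q - 1))) \<partial>lborel)
      + (\<integral>\<^sup>+t. ennreal (indicator {1..} t * (M0 powr q * t powr ((s0 - s) * q - 1))) \<partial>lborel)"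
    by (rule nn_integral_add) auto
  also have "\<dots> < \<infinity>"
  proof -
    have "-1 < (s1 - s) * q - 1" "(s0 - s) * q - 1 < -1" using M0(3) M1(3) q by (auto simp: mult_neg_pos)
    then show ?thesis
      using nn_integral_powr_0_1[of "(s1 - s) * q - 1" "M1 powr q"] nn_integral_powr_1_inf[of "(s0 - s) * q - 1" "M0 powr q"]
      by simp
  qed
  finally show ?thesis using s q assms(4) by (simp add: besov_iff)
qed

context plap_array
begin

text \<open>The weight of level \<open>j\<close> in \<open>B^s_{\<rho>,q}\<close> is comparable to \<open>2 powr (besov_exp s i * j)\<close>, where \<open>i = 1 / \<rho>\<close>.\<close>
definition besov_exp :: "real \<Rightarrow> real \<Rightarrow> real" where
  "besov_exp s i = C * s + \<kappa> - real DIM('a) * i"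

text \<open>A vanishing exponent is still admissible, as only a supremum over scales is taken; this
  covers the critical \<rho>.\<close>

lemma besov_u_infty:
  assumes "1 < s" "s < 2" "0 < \<rho>" "besov_exp s (rinv \<rho>) \<le> 0"
  shows "besov s \<rho> \<infinity> u"
proof -
  obtain M where "0 \<le> M" "\<And>t. 0 < t \<Longrightarrow> modsmooth 2 \<rho> u t \<le> ennreal (M * t powr s)"
    using modsmooth_u_le[of s \<rho>] assms by (auto simp: besov_exp_def)
  then show ?thesis using assms by (intro besov_inftyI[of s \<rho> u M] lp_mem_u)
qed

lemma besov_u:
  assumes s: "1 < s" "s < 2" and \<rho>: "0 < \<rho>" and q: "0 < q" and e: "besov_exp s (rinv \<rho>) < 0"
  shows "besov s \<rho> q u"
proof (cases q)
  case PInf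
  then show ?thesis using besov_u_infty[OF s \<rho>] e by simp
next
  case (real q')
  \<comment> \<open>The exponent grows in \<open>s\<close> with slope \<open>C\<close>. The two
    entries keep \<open>s + \<delta>\<close> below 2 and the exponent at \<open>s + \<delta>\<close>
    nonpositive, which yields the larger power needed for small \<open>t\<close>.\<close>
  define \<delta> where "\<delta> = min ((2 - s) / 2) (- besov_exp s (rinv \<rho>) / C)"
  have "0 < - besov_exp s (rinv \<rho>) / C" using e C by (intro divide_pos_pos) auto
  then have \<delta>: "0 < \<delta>" using s by (simp add: \<delta>_def)
  have "\<delta> \<le> (2 - s) / 2" unfolding \<delta>_def by (rule min.cobounded1)
  also have "\<dots> < 2 - s" using s by simp
  finally have \<delta>2: "s + \<delta> < 2" by simp
  have C\<delta>: "C * \<delta> \<le> - besov_exp s (rinv \<rho>)"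
    proof -
    have "\<delta> \<le> - besov_exp s (rinv \<rho>) / C" unfolding \<delta>_def by (rule min.cobounded2)
    then have "C * \<delta> \<le> C * (- besov_exp s (rinv \<rho>) / C)" using C by (intro mult_left_mono) auto
    then show ?thesis using C by simp
  qed
  have "besov_exp (s + \<delta>) (rinv \<rho>) = besov_exp s (rinv \<rho>) + C * \<delta>" by (simp add: besov_exp_def algebra_simps)
  with C\<delta> have e1: "besov_exp (s + \<delta>) (rinv \<rho>) \<le> 0" by simp
  \<comment> \<open>The exponent at smoothness 1 is smaller than at \<open>s\<close>, so a bound
    linear in \<open>t\<close> is available for large \<open>t\<close>.\<close>
  have "C * 1 \<le> C * s" using s C by (intro mult_left_mono) auto
  then have e0: "besov_exp 1 (rinv \<rho>) \<le> 0" using e by (simp add: besov_exp_def)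
  obtain M1 where M1: "0 \<le> M1" "\<And>t. 0 < t \<Longrightarrow> modsmooth 2 \<rho> u t \<le> ennreal (M1 * t powr (s + \<delta>))"
    using modsmooth_u_le[of "s + \<delta>" \<rho>] e1 s \<delta> \<delta>2 \<rho> by (auto simp: besov_exp_def)
  obtain M0 where M0: "0 \<le> M0" "\<And>t. 0 < t \<Longrightarrow> modsmooth 2 \<rho> u t \<le> ennreal (M0 * t powr 1)"
    using modsmooth_u_le[of 1 \<rho>] e0 s \<rho> unfolding besov_exp_def by auto
  show ?thesis unfolding real
    using q real s \<delta> by (intro besov_finiteI[OF s _ lp_mem_u[OF \<rho>] M0 _ M1]) auto
qed (use q in auto)

end

section \<open>Failure of Besov regularity\<close>

lemma AE_lborel_translate:
  assumes "AE x in lborel. Q (x::'a::euclidean_space)"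
  shows "AE x in lborel. Q (x + c)"
proof -
  obtain N where N: "N \<in> null_sets lborel" "{x. \<not> Q x} \<subseteq> N"
    using assms by (auto simp: eventually_ae_filter)
  have "{x. x - (- c) \<in> N} \<in> null_sets lborel" by (rule null_sets_translation[OF N(1)])
  moreover have "{x. \<not> Q (x + c)} \<subseteq> {x. x - (- c) \<in> N}" using N(2) by auto
  ultimately show ?thesis by (auto simp: eventually_ae_filter)
qed

text \<open>A Chebyshev-type bound. For \<rho> = \<infinity> the factor
  \<open>m powr rinv \<rho>\<close> is 1, and positivity of \<open>m\<close> says that
  \<open>S\<close> is not a null set.\<close>

lemma lp_nrm_ge:
  assumes ae: "AE x in lborel. x \<in> S \<longrightarrow> c \<le> \<bar>F x\<bar>" and S: "S \<in> sets borel" and c: "0 \<le> c"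
    and m: "0 < m" "ennreal m \<le> emeasure lborel S" and \<rho>: "0 < \<rho>"
  shows "ennreal (c * m powr rinv \<rho>) \<le> lp_nrm \<rho> UNIV (F :: 'a::euclidean_space \<Rightarrow> real)"
proof (cases \<rho>)
  case (real x)
  with \<rho> have x: "0 < x" by simp
  have "ennreal (c powr x * m) \<le> ennreal (c powr x) * emeasure lborel S"
    using m c by (simp add: ennreal_mult mult_left_mono)
  also have "\<dots> = (\<integral>\<^sup>+y. ennreal (c powr x) * indicator S y \<partial>lborel)"
    using S by (simp add: nn_integral_cmult_indicator)
  also have "\<dots> \<le> (\<integral>\<^sup>+y. ennreal (\<bar>F y\<bar> powr x) \<partial>lborel)"
  proof (rule nn_integral_mono_AE)
    show "AE y in lborel. ennreal (c powr x) * indicator S y \<le> ennreal (\<bar>F y\<bar> powr x)"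
      using ae by eventually_elim (use c x in \<open>auto simp: indicator_def intro!: ennreal_leI powr_mono2\<close>)
  qed
  also have "\<dots> = (\<integral>\<^sup>+y. ennreal (\<bar>F y\<bar> powr x) \<partial>lebesgue_on UNIV)"
    by (simp add: lebesgue_on_UNIV_eq nn_integral_completion)
  finally have "enn_rpow (ennreal (c powr x * m)) (1 / x) \<le> lp_nrm \<rho> UNIV F"
    unfolding real lp_nrm_real using x by (intro enn_rpow_mono) auto
  moreover have "enn_rpow (ennreal (c powr x * m)) (1 / x) = ennreal (c * m powr rinv \<rho>)"
    using c m x real by (simp add: enn_rpow_ennreal powr_mult powr_powr rinv_def)
  ultimately show ?thesis by simp
next
  case PInf
  show ?thesis unfolding PInf lp_nrm_def
  proof (simp add: rinv_def m less_imp_neq[symmetric], rule Inf_greatest)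
    fix D assume "D \<in> {D. AE x in lebesgue_on UNIV. ennreal \<bar>F x\<bar> \<le> D}"
    then have D: "AE x in lborel. ennreal \<bar>F x\<bar> \<le> D"
      unfolding mem_Collect_eq lebesgue_on_UNIV_eq AE_completion_iff .
    show "ennreal c \<le> D"
    proof (rule ccontr)
      assume n: "\<not> ennreal c \<le> D"
      have "AE x in lborel. x \<notin> S"
        using D ae by eventually_elim (use n in \<open>meson ennreal_leI order_trans\<close>)
      then have "emeasure lborel S = 0" using S by (subst (asm) AE_iff_null) (auto simp: null_sets_def)
      then show False using m by simp
    qed
  qed
qed (use \<rho> in auto)

lemma lp_nrm_fdiff_le_modsmooth: "norm h \<le> t \<Longrightarrow> lp_nrm \<rho> UNIV (fdiff r h g) \<le> modsmooth r \<rho> g t"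
  unfolding modsmooth_def by (rule SUP_upper) simp

context bump_array
begin

text \<open>The separation makes the balls disjoint, so the subadditive estimate behind
  \<open>emeasure_V\<close> becomes an equality.\<close>

lemma emeasure_V_ge:
  "ennreal (geo (vol (1/2)) (- real DIM('a)) j) \<le> emeasure lborel (V (1/2) j)"
proof -
  have "disjoint_family_on (\<lambda>z. cball z (1/2 * r j)) (P j)"
    unfolding disjoint_family_on_def
  proof (intro ballI impI)
    fix z z' assume z: "z \<in> P j" "z' \<in> P j" "z \<noteq> z'"
    then have "5 * r j + 5 * r j < dist z z'" by (intro sep) auto
    then show "cball z (1/2 * r j) \<inter> cball z' (1/2 * r j) = {}"
      using r_pos[of j] by (intro disjoint_cballI) simp
  qed
  then have "emeasure lborel (V (1/2) j) = (\<Sum>z\<in>P j. emeasure lborel (cball z (1/2 * r j)))"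
    unfolding V_def using finite_P by (intro sum_emeasure[symmetric]) auto
  also have "\<dots> = (\<Sum>z\<in>P j. ennreal (unit_ball_vol (real DIM('a)) * (1/2 * r j) ^ DIM('a)))"
    using r_pos[of j] by (intro sum.cong) (auto simp: emeasure_cball)
  also have "\<dots> = ennreal (\<Sum>z\<in>P j. unit_ball_vol (real DIM('a)) * (1/2 * r j) ^ DIM('a))"
    using r_pos[of j] by (intro sum_ennreal) auto
  also have "(\<Sum>z\<in>P j. unit_ball_vol (real DIM('a)) * (1/2 * r j) ^ DIM('a))
      = unit_ball_vol (real DIM('a)) * (1/2) ^ DIM('a) * (real (card (P j)) * r j ^ DIM('a))"
    by (simp add: power_mult_distrib power_divide)
  also have "\<dots> = geo (vol (1/2)) (- real DIM('a)) j"
    unfolding card_P by (simp add: vol_def geo_def)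
  finally show ?thesis by simp
qed

end

context plap_array
begin

text \<open>From the inner half of a ball, shifts of length 2 r j and 4 r j leave the support of the
  bump, so the second difference reduces to the value at \<open>x\<close>. They end at most 4.5 r j
  from the centre, within the five-fold ball: away from other bumps and still in \<Omega>.\<close>

lemma fdiff_u_ge:
  assumes x: "x \<in> V (1/2) j" and e: "norm e = 1"
  shows "geo (lam powr \<sigma> * lam * exp (- (4/3))) \<kappa> j \<le> fdiff 2 ((2 * r j) *\<^sub>R e) u x"
    and "x \<in> \<Omega> \<and> x + (2 * r j) *\<^sub>R e \<in> \<Omega> \<and> x + 2 *\<^sub>R ((2 * r j) *\<^sub>R e) \<in> \<Omega>"
proof -
  let ?h = "(2 * r j) *\<^sub>R e"
  obtain z where z: "z \<in> P j" "x \<in> cball z (5 * r j)" "x \<in> cball z (1/2 * r j)" using x by (rule V_E) auto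
  have rj: "0 < r j" by (rule r_pos)
  have xz: "norm (x - z) \<le> r j / 2" using z(3) by (simp add: dist_norm norm_minus_commute)
  have nh: "norm ?h = 2 * r j" "norm (2 *\<^sub>R ?h) = 4 * r j" using e rj by auto
  have up: "norm (x + v - z) \<le> norm v + r j / 2" for v
    using norm_triangle_ineq[of v "x - z"] xz by (simp add: algebra_simps)
  have lo: "norm v - r j / 2 \<le> norm (x + v - z)" for v
    using norm_triangle_ineq4[of "x + v - z" "x - z"] xz by (simp add: algebra_simps)
  have i: "x + ?h \<in> cball z (5 * r j)" "x + 2 *\<^sub>R ?h \<in> cball z (5 * r j)"
    using up[of ?h] up[of "2 *\<^sub>R ?h"] nh rj by (auto simp: dist_norm norm_minus_commute)
  have sc: "norm (v /\<^sub>R r j) = norm v / r j" for v :: 'a using rj by (simp add: divide_inverse mult.commute)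
  have b0: "bump ((x + v - z) /\<^sub>R r j) = 0" if "2 * r j \<le> norm v" for v
  proof (rule bump_eq_0)
    have "r j \<le> norm (x + v - z)" using lo[of v] that rj by linarith
    then show "1 \<le> norm ((x + v - z) /\<^sub>R r j)" unfolding sc using rj by simp
  qed
  have b1: "exp (- (4/3)) \<le> bump ((x - z) /\<^sub>R r j)"
    by (rule bump_ge, unfold sc) (use xz rj in \<open>simp add: divide_le_eq\<close>)
  have "fdiff 2 ?h u x = geo (lam powr \<sigma> * lam) \<kappa> j * bump ((x - z) /\<^sub>R r j)"
    unfolding fdiff_2 u_def bs_near[OF profile_bump z(1,2)] bs_near[OF profile_bump z(1) i(1)]
      bs_near[OF profile_bump z(1) i(2)]
    using b0[of ?h] b0[of "2 *\<^sub>R ?h"] nh rj by simp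
  also have "\<dots> \<ge> geo (lam powr \<sigma> * lam) \<kappa> j * exp (- (4/3))"
    using b1 lam by (intro mult_left_mono) (auto simp: geo_def)
  finally show "geo (lam powr \<sigma> * lam * exp (- (4/3))) \<kappa> j \<le> fdiff 2 ?h u x"
    by (simp add: geo_def mult_ac)
  show "x \<in> \<Omega> \<and> x + ?h \<in> \<Omega> \<and> x + 2 *\<^sub>R ?h \<in> \<Omega>"
    using z i cball_subset_K[OF z(1)] K_sub by blast
qed

text \<open>The differences involved use points of \<Omega> only. Up to translates of a null set
  they agree for \<open>g\<close> and \<open>u\<close>, so the estimate holds for every extension of
  \<open>u\<close>.\<close>

lemma modsmooth_ge:
  assumes ae: "AE x in lebesgue. x \<in> \<Omega> \<longrightarrow> g x = u x" and \<rho>: "0 < \<rho>"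
  shows "\<exists>c>0. \<forall>j t. 2 * r j \<le> t \<longrightarrow> ennreal (geo c (\<kappa> - real DIM('a) * rinv \<rho>) j) \<le> modsmooth 2 \<rho> g t"
proof -
  define c0 where "c0 = lam powr \<sigma> * lam * exp (- (4/3))"
  have c0: "0 < c0" using lam by (simp add: c0_def)
  have v: "0 < vol (1/2)" using kap by (simp add: vol_def)
  obtain e :: 'a where "e \<in> Basis" using nonempty_Basis by blast
  then have e: "norm e = 1" by simp
  have "ennreal (geo (c0 * vol (1/2) powr rinv \<rho>) (\<kappa> - real DIM('a) * rinv \<rho>) j) \<le> modsmooth 2 \<rho> g t"
    if t: "2 * r j \<le> t" for j t
  proof -
    let ?h = "(2 * r j) *\<^sub>R e"
    have ae': "AE x in lborel. x \<in> \<Omega> \<longrightarrow> g x = u x" using ae by (simp add: AE_completion_iff)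
    have "AE x in lborel. x \<in> V (1/2) j \<longrightarrow> geo c0 \<kappa> j \<le> \<bar>fdiff 2 ?h g x\<bar>"
      using ae' AE_lborel_translate[OF ae', of ?h] AE_lborel_translate[OF ae', of "2 *\<^sub>R ?h"]
    proof eventually_elim
      case (elim x)
      show ?case
      proof
        assume x: "x \<in> V (1/2) j"
        have "fdiff 2 ?h g x = fdiff 2 ?h u x" using elim fdiff_u_ge(2)[OF x e] by (simp add: fdiff_2)
        then show "geo c0 \<kappa> j \<le> \<bar>fdiff 2 ?h g x\<bar>"
          using fdiff_u_ge(1)[OF x e] unfolding c0_def by linarith
      qed
    qed
    from lp_nrm_ge[OF this V_borel _ _ emeasure_V_ge \<rho>]
    have "ennreal (geo c0 \<kappa> j * geo (vol (1/2)) (- real DIM('a)) j powr rinv \<rho>) \<le> lp_nrm \<rho> UNIV (fdiff 2 ?h g)"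
      using c0 v by (simp add: geo_pos less_imp_le)
    also have "geo c0 \<kappa> j * geo (vol (1/2)) (- real DIM('a)) j powr rinv \<rho>
       = geo (c0 * vol (1/2) powr rinv \<rho>) (\<kappa> - real DIM('a) * rinv \<rho>) j"
      using v by (simp add: geo_powr geo_mult)
    also have "lp_nrm \<rho> UNIV (fdiff 2 ?h g) \<le> modsmooth 2 \<rho> g t"
      using t e r_pos[of j] by (intro lp_nrm_fdiff_le_modsmooth) simp
    finally show ?thesis .
  qed
  then show ?thesis using c0 v by (intro exI[of _ "c0 * vol (1/2) powr rinv \<rho>"]) auto
qed

text \<open>For t between 2 r j and 4 r j the weight t^(-s) is comparable to r^(-s), which turns the
  exponent of the modulus into \<open>besov_exp\<close>.\<close>

lemma weighted_modsmooth_ge: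
  assumes ae: "AE x in lebesgue. x \<in> \<Omega> \<longrightarrow> g x = u x" and \<rho>: "0 < \<rho>" and s: "0 < s"
  shows "\<exists>c>0. \<forall>j t. 2 * r j \<le> t \<longrightarrow> t \<le> 4 * r j \<longrightarrow>
    ennreal (geo c (besov_exp s (rinv \<rho>)) j) \<le> wmod s \<rho> g t"
proof -
  obtain c where c: "0 < c" and le: "\<And>j t. 2 * r j \<le> t \<Longrightarrow> ennreal (geo c (\<kappa> - real DIM('a) * rinv \<rho>) j) \<le> modsmooth 2 \<rho> g t"
    using modsmooth_ge[OF ae \<rho>] by blast
  have "ennreal (geo ((4 * lam) powr (- s) * c) (besov_exp s (rinv \<rho>)) j) \<le> wmod s \<rho> g t"
    if t: "2 * r j \<le> t" "t \<le> 4 * r j" for j t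
  proof -
    have t0: "0 < t" using t r_pos[of j] by linarith
    have "geo ((4 * lam) powr (- s) * c) (besov_exp s (rinv \<rho>)) j
       = (4 * r j) powr (- s) * geo c (\<kappa> - real DIM('a) * rinv \<rho>) j"
      using lam by (simp add: geo_def powr_mult powr_powr powr_add[symmetric] besov_exp_def algebra_simps)
    also have "\<dots> \<le> t powr (- s) * geo c (\<kappa> - real DIM('a) * rinv \<rho>) j"
      using t t0 s c by (intro mult_right_mono powr_mono2') (auto simp: geo_def)
    finally have "ennreal (geo ((4 * lam) powr (- s) * c) (besov_exp s (rinv \<rho>)) j)
      \<le> ennreal (t powr (- s)) * ennreal (geo c (\<kappa> - real DIM('a) * rinv \<rho>) j)"
      using c by (subst ennreal_mult[symmetric]) (auto simp: geo_def intro: ennreal_leI)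
    also have "\<dots> \<le> wmod s \<rho> g t" by (intro mult_left_mono le t) auto
    finally show ?thesis .
  qed
  then show ?thesis using c lam by (intro exI[of _ "(4 * lam) powr (- s) * c"]) auto
qed

lemma not_besov_infty:
  assumes s: "1 < s" "s < 2" and \<rho>: "0 < \<rho>" and e: "0 < besov_exp s (rinv \<rho>)"
  shows "\<not> besov_on \<Omega> s \<rho> \<infinity> u"
proof
  assume "besov_on \<Omega> s \<rho> \<infinity> u"
  then obtain g where g: "besov s \<rho> \<infinity> g" "AE x in lebesgue. x \<in> \<Omega> \<longrightarrow> g x = u x"
    by (auto simp: besov_on_def)
  obtain c where c: "0 < c" "\<And>j t. 2 * r j \<le> t \<Longrightarrow> t \<le> 4 * r j \<Longrightarrow>
    ennreal (geo c (besov_exp s (rinv \<rho>)) j) \<le> wmod s \<rho> g t"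
    using weighted_modsmooth_ge[OF g(2) \<rho>, of s] s by auto
  define Z where "Z = (SUP t\<in>{0<..}. wmod s \<rho> g t)"
  have "Z < \<infinity>" using g(1) s by (simp add: besov_iff Z_def)
  then obtain z where z: "Z = ennreal z" "0 \<le> z" by (cases Z) auto
  have "geo c (besov_exp s (rinv \<rho>)) j \<le> z" for j
  proof -
    have "ennreal (geo c (besov_exp s (rinv \<rho>)) j) \<le> ennreal ((2 * r j) powr (- s)) * modsmooth 2 \<rho> g (2 * r j)"
      using r_pos[of j] by (intro c(2)) auto
    also have "\<dots> \<le> Z" unfolding Z_def using r_pos[of j] by (intro SUP_upper) auto
    finally show ?thesis using z by simp
  qed
  then have "(2 powr besov_exp s (rinv \<rho>)) ^ j \<le> z / c" for j
    using c(1) by (simp add: geo_eq_power field_simps)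
  moreover have "1 < 2 powr besov_exp s (rinv \<rho>)" using e by simp
  ultimately show False using real_arch_pow[of "2 powr besov_exp s (rinv \<rho>)" "z / c"] by (meson not_less)
qed

text \<open>Even with exponent zero each level contributes at least \<open>c powr q / 2\<close>
  through the integral over the interval from 2 r j to 4 r j, and infinitely many such contributions
  diverge. This is where finite \<open>q\<close> matters.\<close>

lemma not_besov_finite:
  assumes s: "1 < s" "s < 2" and \<rho>: "0 < \<rho>" and e: "0 \<le> besov_exp s (rinv \<rho>)" and q: "0 < q"
  shows "\<not> besov_on \<Omega> s \<rho> (ereal q) u"
proof
  assume "besov_on \<Omega> s \<rho> (ereal q) u"
  then obtain g where g: "besov s \<rho> (ereal q) g" "AE x in lebesgue. x \<in> \<Omega> \<longrightarrow> g x = u x"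
    by (auto simp: besov_on_def)
  obtain c where c: "0 < c" "\<And>j t. 2 * r j \<le> t \<Longrightarrow> t \<le> 4 * r j \<Longrightarrow>
    ennreal (geo c (besov_exp s (rinv \<rho>)) j) \<le> wmod s \<rho> g t"
    using weighted_modsmooth_ge[OF g(2) \<rho>, of s] s by auto
  have ge: "c \<le> geo c (besov_exp s (rinv \<rho>)) j" for j
  proof -
    have "2 powr 0 \<le> 2 powr (besov_exp s (rinv \<rho>) * real j)" using e by (intro powr_mono) auto
    then show ?thesis using c(1) by (simp add: geo_def)
  qed
  let ?I = "\<lambda>t. indicator {0<..} t * enn_rpow (wmod s \<rho> g t) q / ennreal t"
  have "(\<integral>\<^sup>+t. ?I t \<partial>lborel) < \<infinity>" using g(1) s q by (simp add: besov_iff)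
  then obtain z where z: "(\<integral>\<^sup>+t. ?I t \<partial>lborel) = ennreal z" "0 \<le> z" by (cases "\<integral>\<^sup>+t. ?I t \<partial>lborel") auto
  let ?J = "\<lambda>j. {2 * r j<..4 * r j}"
  \<comment> \<open>Radii drop at least by the factor 2 per level, so neighbouring intervals may
    have the common endpoint 4 r (j + 1) = 2 r j; half-open intervals exclude it.\<close>
  have disj: "t \<notin> ?J k" if "t \<in> ?J j" "j < k" for t j k
  proof -
    have "r k \<le> r (Suc j)"
      by (rule lift_Suc_antimono_le[of r]) (use that r_le_half r_pos in \<open>auto intro: order_trans[OF r_le_half] simp: less_imp_le\<close>)
    then show ?thesis using r_le_half[of j] that(1) by auto
  qed
  have pt: "ennreal (c powr q / (4 * r j)) \<le> ?I t" if "t \<in> ?J j" for t j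
  proof -
    have t: "0 < t" "t \<le> 4 * r j" "2 * r j \<le> t" using that r_pos[of j] by auto
    have "ennreal c \<le> wmod s \<rho> g t"
      using c(2)[OF t(3,2)] ge[of j] by (meson ennreal_leI order_trans)
    then have 1: "ennreal (c powr q) \<le> enn_rpow (wmod s \<rho> g t) q"
      using enn_rpow_mono[of "ennreal c" _ q] q c(1) by (simp add: enn_rpow_ennreal)
    have "ennreal (c powr q / (4 * r j)) \<le> ennreal (c powr q / t)"
      using t by (intro ennreal_leI divide_left_mono) auto
    also have "\<dots> = ennreal (c powr q) / ennreal t" using t by (simp add: divide_ennreal)
    also have "\<dots> \<le> ?I t" using t 1 by (simp add: divide_right_mono_ennreal)
    finally show ?thesis .
  qed
  have "real n * (c powr q / 2) \<le> z" for n
  proof -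
    have sum_le: "(\<Sum>j<n. ennreal (c powr q / (4 * r j)) * indicator (?J j) t) \<le> ?I t" for t
    proof (cases "\<exists>j<n. t \<in> ?J j")
      case True
      then obtain j where j: "j < n" "t \<in> ?J j" by blast
      then have "t \<notin> ?J k" if "k \<noteq> j" for k using disj that by (metis linorder_neqE_nat)
      then have "(\<Sum>k<n. ennreal (c powr q / (4 * r k)) * indicator (?J k) t)
         = (\<Sum>k<n. if k = j then ennreal (c powr q / (4 * r j)) else 0)"
        using j(2) by (intro sum.cong) (auto simp: indicator_def)
      also have "\<dots> = ennreal (c powr q / (4 * r j))" using j(1) by simp
      finally show ?thesis using pt[OF j(2)] by simp
    next
      case False
      then have 0: "(\<Sum>j<n. ennreal (c powr q / (4 * r j)) * indicator (?J j) t) = 0"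
        by (intro sum.neutral) (auto simp: indicator_def)
      show ?thesis unfolding 0 by (rule zero_le)
    qed
    have "ennreal (real n * (c powr q / 2)) = (\<Sum>j<n. ennreal (c powr q / 2))"
      using c(1) by (subst sum_ennreal) auto
    also have "\<dots> = (\<Sum>j<n. ennreal (c powr q / (4 * r j)) * emeasure lborel (?J j))"
    proof (rule sum.cong)
      fix j
      have "ennreal (c powr q / (4 * r j)) * emeasure lborel (?J j) = ennreal (c powr q / (4 * r j)) * ennreal (2 * r j)"
        using r_pos[of j] by (simp add: emeasure_lborel_Ioc)
      also have "\<dots> = ennreal (c powr q / (4 * r j) * (2 * r j))"
        using r_pos[of j] by (subst ennreal_mult) auto
      also have "c powr q / (4 * r j) * (2 * r j) = c powr q / 2" using r_pos[of j] by simp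
      finally show "ennreal (c powr q / 2) = ennreal (c powr q / (4 * r j)) * emeasure lborel (?J j)" ..
    qed simp
    also have "\<dots> = (\<Sum>j<n. \<integral>\<^sup>+t. ennreal (c powr q / (4 * r j)) * indicator (?J j) t \<partial>lborel)"
      by (simp add: nn_integral_cmult_indicator)
    also have "\<dots> = (\<integral>\<^sup>+t. (\<Sum>j<n. ennreal (c powr q / (4 * r j)) * indicator (?J j) t) \<partial>lborel)"
      by (intro nn_integral_sum[symmetric]) auto
    also have "\<dots> \<le> ennreal z" unfolding z(1)[symmetric] by (intro nn_integral_mono sum_le)
    finally show ?thesis using z(2) by simp
  qed
  moreover have "0 < c powr q / 2" using c(1) by simp
  ultimately show False using reals_Archimedean3[of "c powr q / 2"] by (meson not_less)
qed

lemma not_besov: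
  assumes "1 < s" "s < 2" "0 < \<rho>" "0 < q" "0 < besov_exp s (rinv \<rho>)"
  shows "\<not> besov_on \<Omega> s \<rho> q u"
  using assms not_besov_infty[of s \<rho>] not_besov_finite[of s \<rho>] by (cases q) auto

lemma besov_on_u: "besov s \<rho> q u \<Longrightarrow> besov_on \<Omega> s \<rho> q u"
  unfolding besov_on_def by auto

end

section \<open>Failure of Sobolev regularity of the flux\<close>

text \<open>Above \<open>t0\<close> the left side is at most t^\<rho>, below it at most t0^\<rho>.
  Integrated over a ball with \<open>t0\<close> of the order of the mean, this replaces Jensen's
  inequality.\<close>

lemma powr_ge_linear:
  fixes t :: real
  assumes "0 < t0" "1 \<le> \<rho>" "0 \<le> t"
  shows "t * t0 powr (\<rho> - 1) \<le> t powr \<rho> + t0 powr \<rho>"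
proof (cases "t \<le> t0")
  case True
  then have "t * t0 powr (\<rho> - 1) \<le> t0 * t0 powr (\<rho> - 1)" by (intro mult_right_mono) auto
  also have "\<dots> = t0 powr \<rho>" using assms powr_add[of t0 1 "\<rho> - 1"] by simp
  also have "\<dots> \<le> t powr \<rho> + t0 powr \<rho>" by simp
  finally show ?thesis .
next
  case False
  then have "t * t0 powr (\<rho> - 1) \<le> t * t powr (\<rho> - 1)" using assms by (intro mult_left_mono powr_mono2) auto
  also have "\<dots> = t powr \<rho>" using assms False powr_add[of t 1 "\<rho> - 1"] by simp
  also have "\<dots> \<le> t powr \<rho> + t0 powr \<rho>" by simp
  finally show ?thesis .
qed

text \<open>The product equals |\<nabla>\<psi>|^(p - 2) times the square of the i-th partial
  derivative of the bump \<psi>.\<close>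

lemma flux_times_pd_nonneg: "i \<in> Basis \<Longrightarrow> 0 \<le> flux p i y * pd bump i y"
  by (simp add: flux_def pA_def grad_bump_inner mult.assoc)

text \<open>If all partial derivatives vanished, the bump would be constant along a coordinate line,
  although it is positive at 0 and zero at distance 1. Continuity extends positivity from a point to
  a ball.\<close>

lemma flux_times_pd_pos:
  assumes p: "2 < p"
  shows "\<exists>i\<in>Basis. \<exists>y0::'a::euclidean_space. \<exists>\<eta> \<delta>. 0 < \<eta> \<and> 0 < \<delta> \<and> (\<forall>y\<in>ball y0 \<eta>. \<delta> \<le> flux p i y * pd bump i y)"
proof -
  have "\<exists>i\<in>Basis. \<exists>y0::'a. pd bump i y0 \<noteq> 0"
  proof (rule ccontr)
    assume "\<not> ?thesis"
    then have z: "pd bump i y = 0" if "i \<in> Basis" for i y :: 'a using that by blast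
    obtain e :: 'a where "e \<in> Basis" using nonempty_Basis by blast
    have "((\<lambda>s. bump (0 + s *\<^sub>R e)) has_real_derivative 0) (at s)" for s
      using has_real_derivative_line_pd[OF flat_gen_differentiable[OF flat_gen_bump] \<open>e \<in> Basis\<close>, of 0 s] z[OF \<open>e \<in> Basis\<close>] by simp
    then have "bump (0 + (0::real) *\<^sub>R e) = bump (0 + (1::real) *\<^sub>R e)"
      by (intro DERIV_isconst_all[of "\<lambda>s. bump (0 + s *\<^sub>R e)" 0 1]) blast
    then show False using bump_pos[of "0::'a"] bump_eq_0[of e] \<open>e \<in> Basis\<close> by simp
  qed
  then obtain i y0 where i: "i \<in> Basis" and y0: "pd bump i (y0::'a) \<noteq> 0" by blast
  let ?w = "\<lambda>y. flux p i y * pd bump i y"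
  have g0: "grad_bump y0 \<noteq> 0" using grad_bump_inner[OF i, of y0] y0 by auto
  have "?w y0 = norm (grad_bump y0) powr (p - 2) * (pd bump i y0)\<^sup>2"
    using i by (simp add: flux_def pA_def grad_bump_inner power2_eq_square)
  then have w0: "0 < ?w y0" using y0 g0 by simp
  have "continuous_on UNIV ?w"
    using profile_flux[OF p, of i] profile_pd_bump[of i] by (auto simp: profile_def intro: continuous_on_mult)
  then have "isCont ?w y0" by (simp add: continuous_on_eq_continuous_at)
  then obtain \<eta> where \<eta>: "0 < \<eta>" "\<And>y. dist y y0 < \<eta> \<Longrightarrow> dist (?w y) (?w y0) < ?w y0 / 2"
    using w0 unfolding continuous_at_eps_delta by (meson half_gt_zero)
  have "?w y0 / 2 \<le> ?w y" if "y \<in> ball y0 \<eta>" for y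
  proof -
    have half: "b / 2 \<le> a" if "dist a b < b / 2" for a b :: real
      using that abs_ge_minus_self[of "a - b"] unfolding dist_real_def by linarith
    show ?thesis by (rule half, rule \<eta>(2)) (use that in \<open>simp add: dist_commute\<close>)
  qed
  then show ?thesis using i \<eta>(1) w0 by (intro bexI[OF _ i] exI[of _ y0] exI[of _ \<eta>] exI[of _ "?w y0 / 2"]) auto
qed

lemma integral_ge_on_set:
  assumes K': "S \<in> sets borel" "ennreal m \<le> emeasure lborel S" "0 \<le> m" and int: "integrable lborel F"
    and F: "\<And>x. 0 \<le> F x" "\<And>x. x \<in> S \<Longrightarrow> (c::real) \<le> F x" and c: "0 \<le> c"
  shows "c * m \<le> integral\<^sup>L lborel (F :: 'a::euclidean_space \<Rightarrow> real)"
proof -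
  have "ennreal (c * m) \<le> ennreal c * emeasure lborel S"
    using K' c by (simp add: ennreal_mult mult_left_mono)
  also have "\<dots> = (\<integral>\<^sup>+x. ennreal c * indicator S x \<partial>lborel)"
    using K' by (simp add: nn_integral_cmult_indicator)
  also have "\<dots> \<le> (\<integral>\<^sup>+x. ennreal (F x) \<partial>lborel)"
    by (intro nn_integral_mono) (auto simp: indicator_def F ennreal_leI)
  also have "\<dots> = ennreal (integral\<^sup>L lborel F)" using int F by (intro nn_integral_eq_integral) auto
  finally show ?thesis using Bochner_Integration.integral_nonneg[of lborel F] F(1) by simp
qed

context plap_array
begin

text \<open>Testing a weak derivative of the flux with the bump at \<open>z\<close> bounds its mean value there from below.\<close>
lemma not_sobolev1_flux:
  assumes \<rho>: "1 < \<rho>" "real DIM('a) \<le> \<alpha> * \<rho>"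
  shows "\<exists>i\<in>Basis. \<not> sobolev1 (ereal \<rho>) \<Omega> (\<lambda>x. pA p (G x) \<bullet> i)"
proof -
  obtain i and y0 :: 'a and \<eta> \<delta> where i: "i \<in> Basis" and \<eta>: "0 < \<eta>" and \<delta>: "0 < \<delta>"
    and w: "\<And>y. y \<in> ball y0 \<eta> \<Longrightarrow> \<delta> \<le> flux p i y * pd bump i y"
    using flux_times_pd_pos[OF p] by blast
  let ?F = "bs (geo lam (\<alpha> - C)) (flux p i)"
  let ?d = "real DIM('a)" and ?\<omega> = "unit_ball_vol (real DIM('a))"
  have \<omega>: "0 < ?\<omega>" by simp
  obtain B where B: "0 \<le> B" "\<And>y::'a. \<bar>bump y\<bar> \<le> B" using profile_bounded[OF profile_bump] by metis
  define B1 where "B1 = B + 1"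
  have B1: "0 < B1" "\<And>y::'a. \<bar>bump y\<bar> \<le> B1" using B unfolding B1_def by (auto intro: order_trans[OF B(2)])
  show ?thesis
  proof (rule bexI[OF notI i])
    assume "sobolev1 (ereal \<rho>) \<Omega> (\<lambda>x. pA p (G x) \<bullet> i)"
    then obtain H where H: "weak_gradient \<Omega> (\<lambda>x. pA p (G x) \<bullet> i) H" "\<And>k. k \<in> Basis \<Longrightarrow> lp_mem (ereal \<rho>) \<Omega> (\<lambda>x. H x \<bullet> k)"
      unfolding sobolev1_def by blast
    \<comment> \<open>The weak derivative carries information on \<Omega> only; extension by zero
      allows integration over the whole space.\<close>
    define g where "g x = indicator \<Omega> x * (H x \<bullet> i)" for x
    have wd: "weak_deriv \<Omega> i ?F (\<lambda>x. H x \<bullet> i)" using H(1) i unfolding weak_gradient_def pA_G by blast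
    have gm: "g \<in> borel_measurable lebesgue"
      using H(2)[OF i] \<Omega>_meas unfolding lp_mem_def g_def
      by (subst (asm) borel_measurable_restrict_space_iff) (auto simp: mult.commute)
    have gfin: "(\<integral>\<^sup>+x. ennreal (\<bar>g x\<bar> powr \<rho>) \<partial>lebesgue) < \<infinity>"
    proof -
      have "(\<integral>\<^sup>+x. ennreal (\<bar>H x \<bullet> i\<bar> powr \<rho>) \<partial>lebesgue_on \<Omega>) < \<infinity>"
        using H(2)[OF i] by (simp add: lp_mem_def lp_nrm_real enn_rpow_less_top)
      also have "(\<integral>\<^sup>+x. ennreal (\<bar>H x \<bullet> i\<bar> powr \<rho>) \<partial>lebesgue_on \<Omega>) = (\<integral>\<^sup>+x. ennreal (\<bar>H x \<bullet> i\<bar> powr \<rho>) * indicator \<Omega> x \<partial>lebesgue)"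
        using \<Omega>_meas by (intro nn_integral_restrict_space) auto
      also have "\<dots> = (\<integral>\<^sup>+x. ennreal (\<bar>g x\<bar> powr \<rho>) \<partial>lebesgue)"
        unfolding g_def using \<rho> by (intro nn_integral_cong) (auto simp: indicator_def)
      finally show ?thesis .
    qed
    \<comment> \<open>Testing with the bump will show that the integral of |g| over the ball of
      radius \<open>r j\<close> is at least \<open>c1 * a j * r j ^ DIM('a)\<close>;
      \<open>B1\<close> bounds the test function.\<close>
    define c1 where "c1 = \<delta> * ?\<omega> * \<eta> ^ DIM('a) / B1"
    have c1: "0 < c1" unfolding c1_def using \<delta> \<omega> \<eta> B1 by simp
    \<comment> \<open>The threshold in \<open>powr_ge_linear\<close> will be \<open>T * a j\<close>.
      With this \<open>T\<close> the correction term consumes exactly half of the gain, so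
      \<open>c2\<close> stays positive.\<close>
    define T where "T = c1 / (2 * ?\<omega>)"
    have T: "0 < T" unfolding T_def using c1 \<omega> by simp
    define a where "a = geo 1 \<alpha>"
    have a: "0 < a j" for j unfolding a_def by (rule geo_pos) simp
    define c2 where "c2 = c1 * T powr (\<rho> - 1) - ?\<omega> * T powr \<rho>"
    have c2: "0 < c2"
    proof -
      have "T powr \<rho> = T * T powr (\<rho> - 1)" using T powr_add[of T 1 "\<rho> - 1"] by simp
      then have "?\<omega> * T powr \<rho> = c1 / 2 * T powr (\<rho> - 1)" using \<omega> by (simp add: T_def)
      moreover have "0 < c1 * T powr (\<rho> - 1)" using c1 T by simp
      ultimately show ?thesis unfolding c2_def by linarith
    qed
    let ?E = "\<lambda>j z x. ennreal (\<bar>g x\<bar> powr \<rho>) * indicator (cball z (r j)) x"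
    have ball_lower: "ennreal (c2 * (a j powr \<rho> * r j ^ DIM('a))) \<le> (\<integral>\<^sup>+x. ?E j z x \<partial>lebesgue)"
      if z: "z \<in> P j" for j z
    proof -
      define \<psi> where "\<psi> x = bump ((x - z) /\<^sub>R r j)" for x
      have rj: "0 < r j" by (rule r_pos)
      have zK: "cball z (r j) \<subseteq> K" using cball_subset_K[OF z] rj by (auto simp: subset_iff)
      have \<psi>0: "\<psi> x = 0" if "x \<notin> cball z (r j)" for x
        unfolding \<psi>_def using that by (intro profile_scaled_eq_0[OF profile_bump]) (simp add: dist_commute)
      have t: "test_fn \<Omega> \<psi>" unfolding test_fn_def
      proof (intro conjI exI[of _ "cball z (r j)"])
        show "smooth_fn \<psi>" unfolding \<psi>_def by (intro flat_gen_smooth_fn flat_gen_bump_scaled)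
      qed (use zK K_sub \<psi>0 in auto)
      have pd\<psi>: "pd \<psi> i x = pd bump i ((x - z) /\<^sub>R r j) / r j" for x
      proof -
        have "((\<lambda>x. bump ((x - z) /\<^sub>R r j)) has_derivative (\<lambda>v. frechet_derivative bump (at ((x - z) /\<^sub>R r j)) (v /\<^sub>R r j))) (at x)"
          by (rule has_derivative_compose[OF _ frechet_derivative_works[THEN iffD1, OF flat_gen_differentiable[OF flat_gen_bump]]])
             (auto intro!: derivative_eq_intros)
        then have "pd \<psi> i x = frechet_derivative bump (at ((x - z) /\<^sub>R r j)) (i /\<^sub>R r j)"
          unfolding \<psi>_def[abs_def] by (rule pd_eqI)
        also have "\<dots> = pd bump i ((x - z) /\<^sub>R r j) / r j"
          unfolding pd_def using linear_cmul[OF linear_frechet_derivative[OF flat_gen_differentiable[OF flat_gen_bump]]]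
          by (simp add: divide_inverse_commute)
        finally show ?thesis .
      qed
      obtain Bt where \<psi>b: "\<And>x. \<bar>\<psi> x\<bar> \<le> Bt" "\<And>x i. i \<in> Basis \<Longrightarrow> \<bar>pd \<psi> i x\<bar> \<le> Bt"
        "\<psi> \<in> borel_measurable borel" "\<And>i. pd \<psi> i \<in> borel_measurable borel"
        using t by (rule test_fnE) blast
      \<comment> \<open>Inside the five-fold ball the flux has amplitude \<open>a j * r j\<close>,
        and the derivative of \<psi> brings the factor 1 / r j; outside, that derivative
        vanishes.\<close>
      have val: "?F x * pd \<psi> i x = a j * (flux p i ((x - z) /\<^sub>R r j) * pd bump i ((x - z) /\<^sub>R r j))" for x
      proof (cases "x \<in> cball z (5 * r j)")
        case True
        have e: "a j = geo lam (\<alpha> - C) j / r j" unfolding geo_div_r a_def using lam by simp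
        then show ?thesis unfolding bs_near[OF profile_flux[OF p] z True] pd\<psi> e by simp
      next
        case False
        then have "pd bump i ((x - z) /\<^sub>R r j) = 0"
          using rj by (intro profile_scaled_eq_0[OF profile_pd_bump]) (simp add: dist_commute)
        then show ?thesis unfolding pd\<psi> by simp
      qed
      \<comment> \<open>Rescaling about \<open>z\<close> maps this ball onto
        \<open>ball y0 \<eta>\<close>, where the product of the profiles is at least
        \<delta>.\<close>
      have Sm: "ennreal (?\<omega> * (r j * \<eta>) ^ DIM('a)) \<le> emeasure lborel (ball (z + r j *\<^sub>R y0) (r j * \<eta>))"
        using rj \<eta> by (simp add: emeasure_ball)
      have "a j * \<delta> * (?\<omega> * (r j * \<eta>) ^ DIM('a)) \<le> (\<integral>x. ?F x * pd \<psi> i x \<partial>lborel)"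
      proof (rule integral_ge_on_set[OF _ Sm])
        show "integrable lborel (\<lambda>x. ?F x * pd \<psi> i x)"
          using \<alpha> i by (intro integrable_bs_times[OF profile_flux[OF p] _ \<psi>b(4) \<psi>b(2)]) auto
        show "0 \<le> ?F x * pd \<psi> i x" for x
          unfolding val by (rule mult_nonneg_nonneg[OF less_imp_le[OF a] flux_times_pd_nonneg[OF i]])
        fix x assume "x \<in> ball (z + r j *\<^sub>R y0) (r j * \<eta>)"
        then have "dist (r j *\<^sub>R y0) (x - z) < r j * \<eta>" by (simp add: dist_norm algebra_simps)
        moreover have "r j *\<^sub>R y0 - (x - z) = r j *\<^sub>R (y0 - (x - z) /\<^sub>R r j)"
          using rj by (simp add: scaleR_diff_right)
        ultimately have "r j * norm (y0 - (x - z) /\<^sub>R r j) < r j * \<eta>"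
          unfolding dist_norm using rj by simp
        then have "dist y0 ((x - z) /\<^sub>R r j) < \<eta>" unfolding dist_norm using rj by simp
        then show "a j * \<delta> \<le> ?F x * pd \<psi> i x" unfolding val using w a[of j] by (simp add: less_imp_le)
      qed (use a[of j] \<delta> \<omega> rj \<eta> in \<open>auto intro!: mult_nonneg_nonneg\<close>)
      also have "(\<integral>x. ?F x * pd \<psi> i x \<partial>lborel) = (\<integral>x\<in>\<Omega>. ?F x * pd \<psi> i x \<partial>lebesgue)"
        by (rule set_integral_bs[OF profile_flux[OF p] K_sub \<psi>b(4), symmetric])
      also have "\<dots> = - (\<integral>x\<in>\<Omega>. (H x \<bullet> i) * \<psi> x \<partial>lebesgue)"
        using wd t unfolding weak_deriv_def by blast
      also have "(\<integral>x\<in>\<Omega>. (H x \<bullet> i) * \<psi> x \<partial>lebesgue) = (\<integral>x. g x * \<psi> x \<partial>lebesgue)"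
        unfolding set_lebesgue_integral_def g_def by (intro Bochner_Integration.integral_cong) auto
      finally have low: "a j * \<delta> * (?\<omega> * (r j * \<eta>) ^ DIM('a)) \<le> \<bar>\<integral>x. g x * \<psi> x \<partial>lebesgue\<bar>" by linarith
      let ?Bz = "cball z (r j)"
      let ?L = "\<integral>\<^sup>+x. ennreal \<bar>g x\<bar> * indicator ?Bz x \<partial>lebesgue"
      have "ennreal \<bar>\<integral>x. g x * \<psi> x \<partial>lebesgue\<bar> \<le> (\<integral>\<^sup>+x. ennreal (norm (g x * \<psi> x)) \<partial>lebesgue)"
      \<comment> \<open>A non-integrable function has Bochner integral 0 by convention, so the bound
        is trivial in that case.\<close>
      proof (cases "integrable lebesgue (\<lambda>x. g x * \<psi> x)")
        case True
        from integral_norm_bound_ennreal[OF this] show ?thesis by simp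
      qed (simp add: not_integrable_integral_eq)
      also have "\<dots> \<le> (\<integral>\<^sup>+x. ennreal B1 * (ennreal \<bar>g x\<bar> * indicator ?Bz x) \<partial>lebesgue)"
      proof (intro nn_integral_mono)
        fix x
        have "\<bar>g x\<bar> * \<bar>\<psi> x\<bar> \<le> B1 * \<bar>g x\<bar>" using B1(2) mult_left_mono[of "\<bar>\<psi> x\<bar>" B1 "\<bar>g x\<bar>"] by (simp add: \<psi>_def mult.commute)
        then show "ennreal (norm (g x * \<psi> x)) \<le> ennreal B1 * (ennreal \<bar>g x\<bar> * indicator ?Bz x)"
          using B1 \<psi>0[of x] by (cases "x \<in> ?Bz") (auto simp: abs_mult ennreal_mult[symmetric] intro!: ennreal_leI)
      qed
      also have "\<dots> = ennreal B1 * ?L"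
        using gm by (intro nn_integral_cmult) (auto intro!: borel_measurable_times_ennreal borel_measurable_indicator)
      finally have L: "ennreal (a j * \<delta> * (?\<omega> * (r j * \<eta>) ^ DIM('a))) \<le> ennreal B1 * ?L"
        using low by (meson ennreal_leI order_trans)
      define R where "R = (\<integral>\<^sup>+x. ennreal (\<bar>g x\<bar> powr \<rho>) * indicator ?Bz x \<partial>lebesgue)"
      have Rfin: "R < \<infinity>" unfolding R_def
        by (rule le_less_trans[OF nn_integral_mono gfin]) (auto simp: indicator_def)
      then obtain R' where R': "R = ennreal R'" "0 \<le> R'" by (cases R) auto
      have em: "emeasure lebesgue ?Bz = ennreal (?\<omega> * r j ^ DIM('a))" using rj by (simp add: emeasure_cball)
      have "ennreal ((T * a j) powr (\<rho> - 1)) * ?L = (\<integral>\<^sup>+x. ennreal ((T * a j) powr (\<rho> - 1)) * (ennreal \<bar>g x\<bar> * indicator ?Bz x) \<partial>lebesgue)"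
        using gm by (intro nn_integral_cmult[symmetric]) (auto intro!: borel_measurable_times_ennreal borel_measurable_indicator)
      also have "\<dots> \<le> (\<integral>\<^sup>+x. ennreal (\<bar>g x\<bar> powr \<rho>) * indicator ?Bz x + ennreal ((T * a j) powr \<rho>) * indicator ?Bz x \<partial>lebesgue)"
      proof (intro nn_integral_mono)
        fix x
        have "\<bar>g x\<bar> * (T * a j) powr (\<rho> - 1) \<le> \<bar>g x\<bar> powr \<rho> + (T * a j) powr \<rho>"
          using T a[of j] \<rho> by (intro powr_ge_linear) auto
        then show "ennreal ((T * a j) powr (\<rho> - 1)) * (ennreal \<bar>g x\<bar> * indicator ?Bz x)
          \<le> ennreal (\<bar>g x\<bar> powr \<rho>) * indicator ?Bz x + ennreal ((T * a j) powr \<rho>) * indicator ?Bz x"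
          by (cases "x \<in> ?Bz") (auto simp: ennreal_mult[symmetric] ennreal_plus[symmetric] mult.commute intro!: ennreal_leI simp del: ennreal_plus)
      qed
      also have "\<dots> = R + ennreal ((T * a j) powr \<rho>) * emeasure lebesgue ?Bz"
      proof -
        have bl: "?Bz \<in> sets lebesgue" by simp
        have "(\<lambda>x. ennreal (\<bar>g x\<bar> powr \<rho>) * indicator ?Bz x) \<in> borel_measurable lebesgue"
          using gm by (auto intro!: borel_measurable_times_ennreal borel_measurable_indicator)
        moreover have "(\<lambda>x. ennreal ((T * a j) powr \<rho>) * indicator ?Bz x) \<in> borel_measurable lebesgue"
          by (intro borel_measurable_times_ennreal borel_measurable_const borel_measurable_indicator bl)
        ultimately show ?thesis
          unfolding R_def nn_integral_cmult_indicator[OF bl, symmetric] by (rule nn_integral_add)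
      qed
      finally have up: "ennreal ((T * a j) powr (\<rho> - 1)) * ?L \<le> R + ennreal ((T * a j) powr \<rho>) * ennreal (?\<omega> * r j ^ DIM('a))"
        unfolding em .
      have "ennreal ((T * a j) powr (\<rho> - 1) / B1) * ennreal (a j * \<delta> * (?\<omega> * (r j * \<eta>) ^ DIM('a)))
          \<le> ennreal ((T * a j) powr (\<rho> - 1) / B1) * (ennreal B1 * ?L)"
        by (intro mult_left_mono L) simp
      also have "\<dots> = ennreal ((T * a j) powr (\<rho> - 1)) * ?L"
        unfolding mult.assoc[symmetric] using B1 by (simp add: ennreal_mult[symmetric])
      also note up
      also have "R + ennreal ((T * a j) powr \<rho>) * ennreal (?\<omega> * r j ^ DIM('a)) = ennreal (R' + (T * a j) powr \<rho> * (?\<omega> * r j ^ DIM('a)))"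
        using R' rj by (simp add: ennreal_mult[symmetric] ennreal_plus[symmetric] del: ennreal_plus)
      finally have "ennreal ((T * a j) powr (\<rho> - 1) / B1 * (a j * \<delta> * (?\<omega> * (r j * \<eta>) ^ DIM('a)))) \<le> ennreal (R' + (T * a j) powr \<rho> * (?\<omega> * r j ^ DIM('a)))"
        using B1 a[of j] \<delta> rj \<eta> by (simp add: ennreal_mult[symmetric])
      then have fin: "(T * a j) powr (\<rho> - 1) / B1 * (a j * \<delta> * (?\<omega> * (r j * \<eta>) ^ DIM('a))) \<le> R' + (T * a j) powr \<rho> * (?\<omega> * r j ^ DIM('a))"
        using R' rj by (subst (asm) ennreal_le_iff) auto
      have ap: "a j powr (\<rho> - 1) * a j = a j powr \<rho>" using a[of j] powr_add[of "a j" "\<rho> - 1" 1] by simp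
      have "(T * a j) powr (\<rho> - 1) / B1 * (a j * \<delta> * (?\<omega> * (r j * \<eta>) ^ DIM('a))) = c1 * T powr (\<rho> - 1) * (a j powr \<rho> * r j ^ DIM('a))"
        unfolding ap[symmetric] c1_def by (simp add: powr_mult power_mult_distrib)
      moreover have "(T * a j) powr \<rho> * (?\<omega> * r j ^ DIM('a)) = ?\<omega> * T powr \<rho> * (a j powr \<rho> * r j ^ DIM('a))"
        by (simp add: powr_mult)
      ultimately have "c2 * (a j powr \<rho> * r j ^ DIM('a)) \<le> R'"
        using fin unfolding c2_def left_diff_distrib by linarith
      then show ?thesis using R' unfolding R_def[symmetric] by (simp add: ennreal_leI)
    qed
    define N where "N = (\<integral>\<^sup>+x. ennreal (\<bar>g x\<bar> powr \<rho>) \<partial>lebesgue)"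
    obtain N' where N': "N = ennreal N'" "0 \<le> N'" using gfin unfolding N_def[symmetric] by (cases N) auto
    have "real n * (c2 * kap) \<le> N'" for n
    proof -
      \<comment> \<open>Since \<alpha> \<rho> \<ge> d, the growth of a^\<rho> at least compensates
        for the decay of the level volume; at equality all these lower bounds coincide.\<close>
      have lev: "ennreal (c2 * kap) \<le> (\<Sum>z\<in>P j. \<integral>\<^sup>+x. ?E j z x \<partial>lebesgue)" for j
      proof -
        have "2 powr 0 \<le> 2 powr ((\<alpha> * \<rho> + - ?d) * real j)" using \<rho> by (intro powr_mono) auto
        then have "kap \<le> geo kap (\<alpha> * \<rho> + - ?d) j" using kap by (simp add: geo_def)
        also have "\<dots> = a j powr \<rho> * (real (card (P j)) * r j ^ DIM('a))"
          unfolding card_P a_def by (simp add: geo_powr geo_mult)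
        finally have "c2 * kap \<le> (\<Sum>z\<in>P j. c2 * (a j powr \<rho> * r j ^ DIM('a)))"
          using c2 by (simp add: mult_left_mono mult_ac)
        then have "ennreal (c2 * kap) \<le> (\<Sum>z\<in>P j. ennreal (c2 * (a j powr \<rho> * r j ^ DIM('a))))"
          using c2 r_pos[of j] by (subst sum_ennreal) (auto intro!: ennreal_leI mult_nonneg_nonneg)
        also have "\<dots> \<le> (\<Sum>z\<in>P j. \<integral>\<^sup>+x. ?E j z x \<partial>lebesgue)"
          by (intro sum_mono ball_lower)
        finally show ?thesis .
      qed
      \<comment> \<open>\<open>cnt\<close> counts the balls of the first \<open>n\<close> levels
        that contain a point. Separation allows at most one, so the contributions of all levels add
        up under a single integral.\<close>
      define cnt where "cnt x = (\<Sum>j<n. \<Sum>z\<in>P j. (indicator (cball z (r j)) x :: ennreal))" for x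
      have cnt1: "cnt x \<le> 1" for x
        using profile_bump
      proof (cases rule: bs_cases[of bump x])
        case (near j z)
        have "indicator (cball z' (r k)) x = (0::ennreal)" if "z' \<in> P k" "(j, z) \<noteq> (k, z')" for k z'
        proof -
          have "5 * r j + 5 * r k < dist z z'" using sep[OF near(1) that] .
          also have "\<dots> \<le> dist z x + dist z' x" by (rule dist_triangle2)
          finally have "x \<notin> cball z' (r k)" using near(2) r_pos[of k] by auto
          then show ?thesis by simp
        qed
        then have "cnt x \<le> (\<Sum>k<n. \<Sum>z'\<in>P k. if k = j then (if z' = z then 1 else 0) else 0)"
          unfolding cnt_def by (intro sum_mono) (auto simp: indicator_def)
        also have "\<dots> \<le> (\<Sum>k<n. if k = j then 1 else 0)"
          using finite_P by (intro sum_mono) (auto)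
        also have "\<dots> \<le> 1" by simp
        finally show ?thesis .
      next
        case far
        have "indicator (cball z' (r k)) x = (0::ennreal)" if "z' \<in> P k" for k z'
          using far(1)[of k] that by (auto simp: V_def indicator_def)
        then show ?thesis unfolding cnt_def by simp
      qed
      have m1: "(\<lambda>x. ?E j z x) \<in> borel_measurable lebesgue" for z j
        using gm by (auto intro!: borel_measurable_times_ennreal borel_measurable_indicator)
      have "ennreal (real n * (c2 * kap)) = (\<Sum>j<n. ennreal (c2 * kap))"
        using c2 kap by (subst sum_ennreal) auto
      also have "\<dots> \<le> (\<Sum>j<n. \<Sum>z\<in>P j. \<integral>\<^sup>+x. ?E j z x \<partial>lebesgue)"
        by (intro sum_mono lev)
      also have "\<dots> = (\<Sum>j<n. \<integral>\<^sup>+x. (\<Sum>z\<in>P j. ?E j z x) \<partial>lebesgue)"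
        using m1 by (intro sum.cong refl nn_integral_sum[symmetric]) auto
      also have "\<dots> = (\<integral>\<^sup>+x. (\<Sum>j<n. \<Sum>z\<in>P j. ?E j z x) \<partial>lebesgue)"
        using m1 by (intro nn_integral_sum[symmetric] borel_measurable_sum) auto
      also have "\<dots> \<le> N"
        unfolding N_def
      proof (intro nn_integral_mono)
        fix x
        have "(\<Sum>j<n. \<Sum>z\<in>P j. ?E j z x) = ennreal (\<bar>g x\<bar> powr \<rho>) * cnt x"
          by (simp add: cnt_def sum_distrib_left)
        also have "\<dots> \<le> ennreal (\<bar>g x\<bar> powr \<rho>) * 1" by (intro mult_left_mono cnt1) simp
        finally show "(\<Sum>j<n. \<Sum>z\<in>P j. ?E j z x) \<le> ennreal (\<bar>g x\<bar> powr \<rho>)" by simp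
      qed
      finally show ?thesis using N' by simp
    qed
    moreover have "0 < c2 * kap" using c2 kap by simp
    ultimately show False using reals_Archimedean3[of "c2 * kap"] by (meson not_less)
  qed
qed

end

section \<open>Existence of bump arrays\<close>

text \<open>Level \<open>j\<close> is a cubic grid of spacing 32 r j with \<open>M j\<close> points
  per direction, in the cube whose coordinates relative to \<open>c\<close> range from 64 h j to 96
  h j. The cubes halve from level to level and stay apart, as 96 h (j + 1) = 48 h j < 64 h j. An
  integer \<open>m\<close> makes the number of points a power of two.\<close>

lemma bump_array_exists:
  fixes \<Omega> :: "'a::euclidean_space set"
  assumes \<Omega>: "open \<Omega>" "\<Omega> \<noteq> {}" and m: "1 \<le> m"
  shows "\<exists>P K lam kap. bump_array (P :: nat \<Rightarrow> 'a set) K lam kap (real m) \<and> K \<subseteq> \<Omega>"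
proof -
  obtain c R where R: "0 < R" "cball c R \<subseteq> \<Omega>" using \<Omega> by (meson all_not_in_conv open_contains_cball)
  define d where "d = real DIM('a)"
  have d: "1 \<le> d" unfolding d_def using DIM_positive[where 'a='a] by linarith
  \<comment> \<open>101 = 96 + 5: a centre is at most 96 d lam away from \<open>c\<close>, and the
    enlarged ball adds at most 5 d lam.\<close>
  define lam where "lam = R / (101 * d)"
  have lam: "0 < lam" using R d by (simp add: lam_def)
  let ?r = "geo lam (- real m)"
  have rp: "0 < ?r j" for j by (rule geo_pos[OF lam])
  define h where "h j = lam / 2 ^ j" for j :: nat
  have h: "0 < h j" for j using lam by (simp add: h_def)
  \<comment> \<open>Chosen such that \<open>M j\<close> radii make up \<open>h j\<close>; the level
    volume is then governed by h^d, which gives \<open>kap\<close> the value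
    \<open>lam ^ DIM('a)\<close>.\<close>
  define M :: "nat \<Rightarrow> nat" where "M j = 2 ^ ((m - 1) * j)" for j
  have rpow: "?r j = lam / 2 ^ (m * j)" for j
    by (simp add: geo_def powr_minus_divide powr_realpow of_nat_mult[symmetric] del: of_nat_mult)
  have rM: "?r j * real (M j) = h j" for j
  proof -
    have "m * j = (m - 1) * j + j" using m by (cases m) auto
    then show ?thesis unfolding rpow M_def h_def by (simp add: power_add)
  qed
  have rh: "?r j \<le> h j" for j
    using rp[of j] mult_left_mono[of 1 "real (M j)" "?r j"] unfolding rM[symmetric] M_def by simp
  define pt where "pt j k = c + (\<Sum>i\<in>Basis. (64 * h j + 32 * ?r j * real (k i)) *\<^sub>R i)" for j and k :: "'a \<Rightarrow> nat"
  have ptc: "(pt j k - c) \<bullet> i = 64 * h j + 32 * ?r j * real (k i)" if "i \<in> Basis" for j k i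
    using that by (simp add: pt_def inner_sum_left inner_Basis if_distrib cong: if_cong)
  define I where "I j = PiE (Basis :: 'a set) (\<lambda>_. {..<M j})" for j
  define P where "P j = pt j ` I j" for j
  have inj: "inj_on (pt j) (I j)" for j
  proof (rule inj_onI)
    fix k k' assume k: "k \<in> I j" "k' \<in> I j" "pt j k = pt j k'"
    show "k = k'"
    proof (rule PiE_ext[OF k(1,2)[unfolded I_def]])
      fix i :: 'a assume "i \<in> Basis"
      then show "k i = k' i" using ptc[of i j k] ptc[of i j k'] k(3) rp[of j] by simp
    qed
  qed
  have lo: "64 * h j \<le> (z - c) \<bullet> i" and hi: "(z - c) \<bullet> i \<le> 96 * h j" if z: "z \<in> P j" and i: "i \<in> Basis" for z j i
  proof -
    obtain k where k: "k \<in> I j" "z = pt j k" using z by (auto simp: P_def)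
    have "k i < M j" using k(1) i by (auto simp: I_def)
    then have "?r j * real (k i) \<le> ?r j * real (M j)" using rp[of j] by (intro mult_left_mono) auto
    then show "(z - c) \<bullet> i \<le> 96 * h j" unfolding k(2) ptc[OF i] rM by simp
    show "64 * h j \<le> (z - c) \<bullet> i" unfolding k(2) ptc[OF i] using rp[of j] by simp
  qed
  have far: "5 * ?r j + 5 * ?r k < dist z z'" if z: "z \<in> P j" "z' \<in> P k" and jk: "j < k" for j k z z'
  proof -
    obtain i :: 'a where i: "i \<in> Basis" using nonempty_Basis by blast
    have hk: "h k \<le> h j / 2"
    proof -
      have "(2::real) ^ Suc j \<le> 2 ^ k" using jk by (intro power_increasing) auto
      then show ?thesis using lam unfolding h_def by (simp add: frac_le)
    qed
    have "5 * ?r j + 5 * ?r k < 16 * h j" using rh[of j] rh[of k] hk h[of j] by linarith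
    also have "\<dots> \<le> (z - z') \<bullet> i"
      using lo[OF z(1) i] hi[OF z(2) i] hk by (simp add: inner_diff_left)
    also have "\<dots> \<le> dist z z'" using Basis_le_norm[OF i, of "z - z'"] by (simp add: dist_norm)
    finally show ?thesis .
  qed
  have "bump_array P (cball c R) lam (lam ^ DIM('a)) (real m)"
  proof
    show "finite (P j)" for j unfolding P_def I_def by (intro finite_imageI finite_PiE) auto
    show "5 * ?r j + 5 * ?r k < dist z z'" if z: "z \<in> P j" "z' \<in> P k" "(j, z) \<noteq> (k, z')" for j k z z'
    proof -
      consider "j < k" | "k < j" | "j = k" by linarith
      then show ?thesis
      proof cases
        case 1 then show ?thesis by (rule far[OF z(1,2)])
      next
        case 2 then show ?thesis using far[OF z(2,1)] by (simp add: dist_commute add.commute)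
      next
        case 3
        obtain l l' where l: "l \<in> I j" "z = pt j l" "l' \<in> I j" "z' = pt j l'" using z 3 by (auto simp: P_def)
        have "l \<noteq> l'" using z(3) 3 l by auto
        then obtain i where i: "i \<in> Basis" "l i \<noteq> l' i"
          using l(1,3) PiE_ext[of l Basis _ l'] unfolding I_def by metis
        have "1 \<le> \<bar>real (l i) - real (l' i)\<bar>" using i(2) by linarith
        then have "32 * ?r j * 1 \<le> 32 * ?r j * \<bar>real (l i) - real (l' i)\<bar>" using rp[of j] by (intro mult_left_mono) auto
        also have "\<dots> = \<bar>(z - c) \<bullet> i - (z' - c) \<bullet> i\<bar>"
          unfolding l(2,4) ptc[OF i(1)] using rp[of j] by (simp add: abs_mult right_diff_distrib[symmetric])
        also have "\<dots> = \<bar>(z - z') \<bullet> i\<bar>" by (simp add: inner_diff_left)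
        also have "\<dots> \<le> dist z z'" using Basis_le_norm[OF i(1), of "z - z'"] by (simp add: dist_norm)
        finally show ?thesis using rp[of j] 3 by simp
      qed
    qed
    show "cball z (5 * ?r j) \<subseteq> cball c R" if z: "z \<in> P j" for j z
    proof -
      have h0: "h j \<le> lam" using lam by (simp add: h_def divide_le_eq mult_left_le)
      have "norm (z - c) \<le> (\<Sum>i\<in>Basis. \<bar>(z - c) \<bullet> i\<bar>)" by (rule norm_le_l1)
      also have "\<dots> \<le> (\<Sum>i\<in>(Basis::'a set). 96 * lam)"
        using lo[OF z] hi[OF z] h[of j] h0 by (intro sum_mono) (smt (verit))
      also have "\<dots> = 96 * d * lam" by (simp add: d_def)
      finally have "norm (z - c) + 5 * ?r j \<le> 96 * d * lam + 5 * lam" using rh[of j] h0 by linarith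
      also have "\<dots> \<le> 96 * d * lam + 5 * d * lam" using d lam by simp
      also have "\<dots> = R" using d by (simp add: lam_def field_simps)
      finally show ?thesis using rp[of j] by (simp add: cball_subset_cball_iff dist_norm)
    qed
    show "real (card (P j)) * ?r j ^ DIM('a) = geo (lam ^ DIM('a)) (- real DIM('a)) j" for j
    proof -
      have "card (P j) = M j ^ DIM('a)" unfolding P_def card_image[OF inj] by (simp add: I_def card_PiE)
      then have "real (card (P j)) * ?r j ^ DIM('a) = (?r j * real (M j)) ^ DIM('a)"
        by (simp add: power_mult_distrib)
      also have "\<dots> = lam ^ DIM('a) * 2 powr (- real DIM('a) * real j)"
        unfolding rM h_def by (simp add: power_divide powr_minus_divide powr_realpow[symmetric] powr_powr mult.commute power_mult[symmetric])
      finally show ?thesis by (simp add: geo_def)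
    qed
  qed (use lam m in auto)
  then show ?thesis using R(2) by blast
qed

section \<open>Critical exponents and choice of parameters\<close>

lemma rinv_strict_antimono: "0 < x \<Longrightarrow> x < y \<Longrightarrow> rinv y < rinv x"
proof (cases y)
  case (real b)
  assume "0 < x" "x < y"
  with real obtain a where "x = ereal a" "0 < a" "a < b" by (cases x) auto
  then show ?thesis using real by (simp add: rinv_def divide_strict_left_mono)
next
  case PInf
  assume "0 < x" "x < y"
  with PInf obtain a where "x = ereal a" "0 < a" by (cases x) auto
  then show ?thesis using PInf by (simp add: rinv_def)
qed auto

lemma rinv_times: "0 < c \<Longrightarrow> 0 < x \<Longrightarrow> rinv (x * ereal c) = rinv x * (1 / c)"
  by (cases x) (auto simp: rinv_def)

lemma rinv_nonneg: "0 < x \<Longrightarrow> 0 \<le> rinv x"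
  by (cases x) (auto simp: rinv_def)

theorem theorem1p6:
  fixes \<Omega> :: "'a::euclidean_space set" and p \<epsilon> :: real
  assumes hp: "2 < p"
    and h\<Omega>: "\<Omega> = UNIV \<or> bounded_lipschitz_domain \<Omega> \<or>
              (DIM('a) = 1 \<and> is_interval \<Omega> \<and> open \<Omega> \<and> \<Omega> \<noteq> {})"
    and h\<epsilon>: "0 < \<epsilon>" "\<epsilon> < min (1 / (p - 1)) (1 - 1 / (p - 1))"
  shows "\<forall>\<mu>::ereal. 1 < \<mu> \<longrightarrow>
    (\<exists>f u G.
       compact_supp_in \<Omega> f \<and>
       dual_sobolev (ereal p) \<Omega> f \<and>
       (\<forall>\<nu>::ereal. 0 < \<nu> \<and> (\<nu> < \<mu> \<or> \<mu> = \<infinity>) \<longrightarrow> lp_mem \<nu> \<Omega> f) \<and>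
       weak_sol_plap p \<Omega> u G f \<and>
       compact_supp_in \<Omega> u \<and>
       (\<forall>\<rho> q::ereal.
          (\<mu> * ereal (p - 1) < \<rho> \<and> 0 < q \<longrightarrow>
             besov_on \<Omega> (1 + 1 / (p - 1) - \<epsilon>) \<rho> q u \<and>
             \<not> besov_on \<Omega> (1 + 1 / (p - 1)) \<rho> q u) \<and>
          (\<rho> = \<mu> * ereal (p - 1) \<and> 0 < q \<and> q < \<infinity> \<longrightarrow>
             besov_on \<Omega> (1 + 1 / (p - 1)) \<rho> \<infinity> u \<and>
             \<not> besov_on \<Omega> (1 + 1 / (p - 1)) \<rho> q u) \<and>
          (1 \<le> \<rho> \<and> \<rho> < \<mu> * ereal (p - 1) \<and> 0 < q \<longrightarrow>
             besov_on \<Omega> (1 + 1 / (p - 1)) \<rho> q u \<and>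
             \<not> besov_on \<Omega> (1 + 1 / (p - 1) + \<epsilon>) \<rho> q u)) \<and>
       (\<forall>\<rho>::real. 1 < \<rho> \<longrightarrow>
          ((\<forall>i\<in>Basis. sobolev1 (ereal \<rho>) \<Omega> (\<lambda>x. pA p (G x) \<bullet> i)) \<longleftrightarrow> ereal \<rho> < \<mu>)))"
proof (intro allI impI, goal_cases)
  case (1 \<mu>)
  then have \<mu>: "1 < \<mu>" .
  have "open \<Omega>" "\<Omega> \<noteq> {}" using h\<Omega> by (auto simp: bounded_lipschitz_domain_def)
  define d where "d = real DIM('a)"
  have d: "1 \<le> d" unfolding d_def using DIM_positive[where 'a='a] by linarith
  \<comment> \<open>\<theta> is 1 / \<mu>, with value 0 for \<mu> = \<infinity>; the growth exponent
    of \<open>f\<close> will be d \<theta>.\<close>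
  define \<theta> where "\<theta> = rinv \<mu>"
  \<comment> \<open>\<open>DIM('a) + 1\<close> exceeds the growth exponent of \<open>f\<close>. The
    ceiling gives m \<epsilon> > 2 d, which outweighs d (\<theta> \<sigma> - 1 / \<rho>): this is at
    most d in absolute value for \<rho> \<ge> 1.\<close>
  define m where "m = DIM('a) + 1 + nat \<lceil>2 * d / \<epsilon>\<rceil>"
  have m: "1 \<le> m" "d < real m" unfolding m_def d_def by auto
  have "2 * d / \<epsilon> < real m" unfolding m_def by linarith
  then have m\<epsilon>: "2 * d < real m * \<epsilon>" using h\<epsilon>(1) by (simp add: divide_less_eq)
  have \<theta>: "0 \<le> \<theta>" "\<theta> < 1" using \<mu> by (cases \<mu>; simp add: \<theta>_def rinv_def)+
  obtain P :: "nat \<Rightarrow> 'a set" and K lam kap where A: "bump_array P K lam kap (real m)" "K \<subseteq> \<Omega>"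
    using bump_array_exists[OF \<open>open \<Omega>\<close> \<open>\<Omega> \<noteq> {}\<close> m(1)] by blast
  have d\<theta>: "0 \<le> d * \<theta>" "d * \<theta> < d" using d \<theta> by auto
  have dm: "d * \<theta> < real m" using d\<theta>(2) m(2) by linarith
  interpret plap_array P K lam kap "real m" p "d * \<theta>" \<Omega>
    using A hp d\<theta> dm \<open>open \<Omega>\<close> unfolding d_def
    by (intro plap_array.intro plap_array_axioms.intro) auto
  have \<sigma>: "0 < \<sigma>" "\<sigma> < 1" by (rule \<sigma>_pos, rule \<sigma>_less_1)
  have s0: "1 + 1 / (p - 1) = 1 + \<sigma>" by (simp add: \<sigma>_def)
  have \<epsilon>: "0 < \<epsilon>" "\<epsilon> < \<sigma>" "\<epsilon> < 1 - \<sigma>" using h\<epsilon> by (auto simp: \<sigma>_def)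
  \<comment> \<open>At s = 1 + \<sigma> the term with the large factor drops out, and the sign is
    that of \<theta> \<sigma> - 1 / \<rho>, which changes at \<rho> = \<mu> (p - 1).\<close>
  have be: "besov_exp s i = real m * (s - (1 + \<sigma>)) + d * (\<theta> * \<sigma> - i)" for s i
    unfolding besov_exp_def by (simp add: d_def algebra_simps)
  have \<theta>\<sigma>: "0 \<le> \<theta> * \<sigma>" "\<theta> * \<sigma> < 1" using \<theta> \<sigma> mult_left_mono[of \<sigma> 1 \<theta>] by auto
  have \<mu>p0: "0 < \<mu> * ereal (p - 1)" using \<mu> hp by (cases \<mu>) auto
  have "0 < \<mu>" by (rule less_trans[OF _ \<mu>]) simp
  then have \<theta>\<sigma>_rinv: "\<theta> * \<sigma> = rinv (\<mu> * ereal (p - 1))"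
    using hp by (simp add: rinv_times \<theta>_def \<sigma>_def)
  have dle: "d * x \<le> d" if "x \<le> 1" for x using that d mult_left_mono[of x 1 d] by simp
  have s0_pos: "0 < d * x" if "0 < x" for x using that d by simp
  have lp_f: "lp_mem \<nu> \<Omega> f" if \<nu>: "0 < \<nu>" "\<nu> < \<mu> \<or> \<mu> = \<infinity>" for \<nu>
  proof (cases \<nu>)
    case (real x)
    have "\<theta> * x < 1" using \<nu> real by (cases \<mu>) (auto simp: \<theta>_def rinv_def)
    then have "d * \<theta> * x < d" using d by (simp add: mult.assoc)
    then show ?thesis unfolding f_def real using \<nu> real
      by (intro lp_mem_bs profile_f \<Omega>_meas) (auto simp: d_def)
  next
    case PInf
    then have "\<theta> = 0" using \<nu> by (auto simp: \<theta>_def rinv_def)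
    then show ?thesis unfolding f_def PInf by (intro lp_mem_bs_infty profile_f) simp
  qed (use \<nu> in auto)
  have besov_f: "(\<mu> * ereal (p - 1) < \<rho> \<and> 0 < q \<longrightarrow>
             besov_on \<Omega> (1 + \<sigma> - \<epsilon>) \<rho> q u \<and> \<not> besov_on \<Omega> (1 + \<sigma>) \<rho> q u) \<and>
          (\<rho> = \<mu> * ereal (p - 1) \<and> 0 < q \<and> q < \<infinity> \<longrightarrow>
             besov_on \<Omega> (1 + \<sigma>) \<rho> \<infinity> u \<and> \<not> besov_on \<Omega> (1 + \<sigma>) \<rho> q u) \<and>
          (1 \<le> \<rho> \<and> \<rho> < \<mu> * ereal (p - 1) \<and> 0 < q \<longrightarrow>
             besov_on \<Omega> (1 + \<sigma>) \<rho> q u \<and> \<not> besov_on \<Omega> (1 + \<sigma> + \<epsilon>) \<rho> q u)" for \<rho> q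
  proof (intro conjI[of _ "_ \<and> _"] conjI[of "_ \<longrightarrow> _" "_ \<longrightarrow> _"] impI)
    assume *: "\<mu> * ereal (p - 1) < \<rho> \<and> 0 < q"
    have \<rho>0: "0 < \<rho>" by (rule less_trans[OF \<mu>p0 conjunct1[OF *]])
    have i: "0 \<le> rinv \<rho>" "rinv \<rho> < \<theta> * \<sigma>"
      using rinv_nonneg[OF \<rho>0] rinv_strict_antimono[OF \<mu>p0, of \<rho>] * unfolding \<theta>\<sigma>_rinv by auto
    have "d * (\<theta> * \<sigma> - rinv \<rho>) \<le> d" using i \<theta>\<sigma> by (intro dle) simp
    moreover have "besov_exp (1 + \<sigma> - \<epsilon>) (rinv \<rho>) = d * (\<theta> * \<sigma> - rinv \<rho>) - real m * \<epsilon>"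
      by (simp add: be)
    ultimately have "besov_exp (1 + \<sigma> - \<epsilon>) (rinv \<rho>) < 0" using m\<epsilon> d by linarith
    then show "besov_on \<Omega> (1 + \<sigma> - \<epsilon>) \<rho> q u \<and> \<not> besov_on \<Omega> (1 + \<sigma>) \<rho> q u"
      using \<epsilon> \<sigma> * \<rho>0 s0_pos[of "\<theta> * \<sigma> - rinv \<rho>"] i
      by (intro conjI besov_on_u besov_u not_besov) (auto simp: be)
  next
    assume *: "\<rho> = \<mu> * ereal (p - 1) \<and> 0 < q \<and> q < \<infinity>"
    have \<rho>0: "0 < \<rho>" using * \<mu>p0 by simp
    have i: "rinv \<rho> = \<theta> * \<sigma>" using * unfolding \<theta>\<sigma>_rinv by simp
    obtain q' where q': "q = ereal q'" "0 < q'" using * by (cases q) auto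
    show "besov_on \<Omega> (1 + \<sigma>) \<rho> \<infinity> u \<and> \<not> besov_on \<Omega> (1 + \<sigma>) \<rho> q u"
      unfolding q'(1) using \<epsilon> \<sigma> \<rho>0 q'(2) i
      by (intro conjI besov_on_u besov_u_infty not_besov_finite) (auto simp: be)
  next
    assume *: "1 \<le> \<rho> \<and> \<rho> < \<mu> * ereal (p - 1) \<and> 0 < q"
    obtain x where x: "\<rho> = ereal x" "1 \<le> x" using * by (cases \<rho>) auto
    \<comment> \<open>The restriction \<rho> \<ge> 1 enters here: it bounds 1 / \<rho> by 1, so that
      the gain m \<epsilon> prevails.\<close>
    have i: "rinv \<rho> \<le> 1" "\<theta> * \<sigma> < rinv \<rho>"
      using x rinv_strict_antimono[of \<rho> "\<mu> * ereal (p - 1)"] * unfolding \<theta>\<sigma>_rinv by (auto simp: rinv_def)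
    have "d * (rinv \<rho> - \<theta> * \<sigma>) \<le> d" using i \<theta>\<sigma> by (intro dle) simp
    then have "- d \<le> d * (\<theta> * \<sigma> - rinv \<rho>)" by (simp add: algebra_simps)
    then have "0 < besov_exp (1 + \<sigma> + \<epsilon>) (rinv \<rho>)" unfolding be using m\<epsilon> d by simp
    moreover have "besov_exp (1 + \<sigma>) (rinv \<rho>) < 0"
      unfolding be using s0_pos[of "rinv \<rho> - \<theta> * \<sigma>"] i by (simp add: algebra_simps)
    ultimately show "besov_on \<Omega> (1 + \<sigma>) \<rho> q u \<and> \<not> besov_on \<Omega> (1 + \<sigma> + \<epsilon>) \<rho> q u"
      using \<epsilon> \<sigma> * x by (intro conjI besov_on_u besov_u not_besov) auto
  qed
  have sobolev: "(\<forall>i\<in>Basis. sobolev1 (ereal \<rho>) \<Omega> (\<lambda>x. pA p (G x) \<bullet> i)) \<longleftrightarrow> ereal \<rho> < \<mu>" if \<rho>: "1 < \<rho>" for \<rho> :: real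
  proof (cases "ereal \<rho> < \<mu>")
    case True
    then have "\<theta> * \<rho> < 1" using \<rho> by (cases \<mu>) (auto simp: \<theta>_def rinv_def)
    then have "d * \<theta> * \<rho> < real DIM('a)" using d unfolding d_def by (simp add: mult.assoc)
    then show ?thesis using sobolev1_flux[OF \<rho>] True by blast
  next
    case False
    then have "1 \<le> \<theta> * \<rho>" using \<rho> \<mu> by (cases \<mu>) (auto simp: \<theta>_def rinv_def)
    then have "real DIM('a) \<le> d * \<theta> * \<rho>" using d mult_left_mono[of 1 "\<theta> * \<rho>" d] unfolding d_def by (simp add: mult.assoc)
    then show ?thesis using not_sobolev1_flux[OF \<rho>] False by blast
  qed
  show ?case
    unfolding s0
    by (rule exI[of _ f], rule exI[of _ u], rule exI[of _ G])
       (intro conjI[OF compact_supp(2)] conjI[OF dual_sobolev_f] conjI[OF allI[OF impI[OF lp_f]]] conjI[OF weak_sol]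
          conjI[OF compact_supp(1)] conjI[OF allI[OF allI[OF besov_f]]] allI impI sobolev; blast)
qed

end
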